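(* Let $f\in L^2_r(G)$ and $x\in G$. Then $$\pi(x)^*A_f\,\pi(x)=A_{R_{x^{-1}}f},$$ where $R_{x^{-1}}f(y)=f(yx^{-1})$.
   Context: Setting. $G$ is a connected exponential Lie group with Lie algebra $\mathfrak{g}$ ($\exp:\mathfrak{g}\to G$ is a diffeomorphism, with inverse $\log$). The co-adjoint map $K$ is $\langle K(g)Y,X\rangle=\langle Y,\mathrm{Ad}_{g^{-1}}X\rangle$ for $Y\in\mathfrak g^*$. Fix $F\in\mathfrak{g}^*$ with trivial stabilizer $\{g\in G:K(g)F=F\}=\{e\}$, and let $\mathcal{O}_F=K(G)F$ (so $\dim\mathcal{O}_F=\dim G=2n$). $(\pi,\mathcal{H})$ is the irreducible unitary representation attached to $\mathcal{O}_F$ by the Kirillov orbit method: $\pi=\mathrm{ind}_H^G\chi_F$ with $H=\exp\mathfrak{h}$, $\mathfrak{h}$ a subalgebra of maximal dimension with $\langle F,[\mathfrak{h},\mathfrak{h}]\rangle=0$ satisfying the Pukanszky condition $K(H)F=F+\mathfrak{h}^{\perp}$, and $\chi_F(\exp X)=e^{-2\pi i\langle F,X\rangle}$; it is square integrable. Measures. $\mu_l,\mu_r$ are left and right Haar measures with $d\mu_l=\Delta\, d\mu_r$, $\Delta$ the modular function; $L^p_r(G)=L^p(G,\mu_r)$. Inner products are linear in the first variable. $\check f(x)=f(x^{-1})$. Duflo-Moore operator. With $\mathcal{W}_\phi\psi(x)=\langle\psi,\pi(x)^*\phi\rangle_{\mathcal H}$, $\mathcal{D}^{-1}$ is the unique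 positive densely defined operator on $\mathcal{H}$ with $\langle \mathcal{W}_{\phi_1}\psi_1,\mathcal{W}_{\phi_2}\psi_2\rangle_{L^2_r}=\langle\psi_1,\psi_2\rangle\overline{\langle\mathcal{D}^{-1}\phi_1,\mathcal{D}^{-1}\phi_2\rangle}$ for $\phi_i\in\mathrm{Dom}(\mathcal{D}^{-1})$, $\psi_i\in\mathcal H$; $\mathcal{D}$ is its inverse. Inverse Fourier-Wigner transform. $\mathcal{S}^2$ is the space of Hilbert-Schmidt operators on $\mathcal H$. $\mathcal{F}_{\mathrm{W}}^{-1}(f)=\pi(\check f)\mathcal{D}=\int_G f(x)\pi(x^{-1})\mathcal{D}\,d\mu_r(x)$ for $f\in L^1_r(G)$ (on $\mathrm{Dom}(\mathcal D)$), extended by continuity from $L^1_r\cap L^2_r$ to a bounded map $L^2_r(G)\to\mathcal{S}^2$. Inverse Fourier-Kirillov transform. Fix a basis $X_1,\dots,X_{2n}$ of $\mathfrak{g}$, the corresponding Lebesgue measure $dX$ on $\mathfrak g$ and dual Lebesgue measure $dY$ on $\mathfrak{g}^*$; $\mathrm{Pf}_F$ is the Pfaffian of the matrix $(F([X_i,X_j]))_{i,j}$. $\Theta(X)=\left|\det\frac{e^{\mathrm{ad}X}-1}{\mathrm{ad}X}\right|$ and $\mu_r$ is normalized by $d\mu_r(\exp X)=\Theta(X)\,dX$. The map $\kappa:G\to\mathcal{O}_F$, $\kappa(x)=K(x^{-1})F$, is a diffeomorphism, and the basis is chosen so that $\kappa$ carries $\mu_r$ to $|\mathrm{Pf}_F|\,\Delta(\kappa^{-1}(Y))\,dY$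 on $\mathcal{O}_F$ (this compatibility of normalizations amounts to $|\mathrm{Pf}_F|=1$). On $L^2_r(G)$, with the integral understood in the $L^2$ (Plancherel) sense, $$\mathcal{F}_{\mathrm{KO}}^{-1}(f)(x)=\sqrt{\Theta(\log x)}\int_{G}f(y)e^{-2\pi i\langle\kappa(y),\log x\rangle}\frac{d\mu_r(y)}{\sqrt{|\mathrm{Pf}_F|\Delta(y)}}.$$ Quantization. $A_f=\mathcal{F}_{\mathrm{W}}^{-1}(\mathcal{F}_{\mathrm{KO}}^{-1}(f))\in\mathcal{S}^2(\mathcal{H})$ for $f\in L^2_r(G)$.
   Formalization: The printed prefactor Θ(log x)^{1/2} does not map L²_r into L²_r (Θ is unbounded, e.g. ax+b group), so A_f can be undefined; the result is stated both for it (A_f := 0 when the transform is not in L²_r) and for the isometric prefactor Θ(log x)^{-1/2}, where A_f exists for all f. *)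

theory Defs
  imports "HOL-Analysis.Analysis" "HOL-Algebra.Coset" "HOL-Combinatorics.Permutations"
begin

section \<open>Complex Hilbert spaces and operators\<close>

text \<open>The inner product is linear in the first variable.\<close>

class complex_hilbert = banach +
  fixes scaleC :: "complex \<Rightarrow> 'a \<Rightarrow> 'a"  (infixr "*\<^sub>C" 75)
    and cinner :: "'a \<Rightarrow> 'a \<Rightarrow> complex"
  assumes scaleC_add_right: "a *\<^sub>C (x + y) = a *\<^sub>C x + a *\<^sub>C y"
    and scaleC_add_left: "(a + b) *\<^sub>C x = a *\<^sub>C x + b *\<^sub>C x"
    and scaleC_scaleC: "a *\<^sub>C (b *\<^sub>C x) = (a * b) *\<^sub>C x"
    and scaleC_of_real: "complex_of_real r *\<^sub>C x = r *\<^sub>R x"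
    and cinner_commute: "cinner x y = cnj (cinner y x)"
    and cinner_add_left: "cinner (x + y) z = cinner x z + cinner y z"
    and cinner_scaleC_left: "cinner (a *\<^sub>C x) y = a * cinner x y"
    and norm_eq_sqrt_cinner: "norm x = sqrt (Re (cinner x x))"

definition clinear_on :: "'h::complex_hilbert set \<Rightarrow> ('h \<Rightarrow> 'h) \<Rightarrow> bool" where
  "clinear_on S A \<longleftrightarrow>
     (\<forall>u\<in>S. \<forall>v\<in>S. A (u + v) = A u + A v) \<and> (\<forall>c. \<forall>u\<in>S. A (c *\<^sub>C u) = c *\<^sub>C A u)"

definition csubspace :: "'h::complex_hilbert set \<Rightarrow> bool" where
  "csubspace S \<longleftrightarrow> 0 \<in> S \<and> (\<forall>u\<in>S. \<forall>v\<in>S. u + v \<in> S) \<and> (\<forall>c. \<forall>u\<in>S. c *\<^sub>C u \<in> S)"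

definition cadj :: "('h::complex_hilbert \<Rightarrow> 'h) \<Rightarrow> 'h \<Rightarrow> 'h" where
  "cadj A = (THE B. \<forall>u v. cinner (A u) v = cinner u (B v))"

definition orthonormal_basis :: "'h::complex_hilbert set \<Rightarrow> bool" where
  "orthonormal_basis E \<longleftrightarrow>
     (\<forall>e\<in>E. \<forall>e'\<in>E. cinner e e' = (if e = e' then 1 else 0)) \<and>
     (\<forall>v. (\<forall>e\<in>E. cinner v e = 0) \<longrightarrow> v = 0)"

text \<open>The Hilbert-Schmidt norm does not depend on the orthonormal basis; we quantify over all
  bases instead of choosing one.\<close>

definition hilbert_schmidt :: "('h::complex_hilbert \<Rightarrow> 'h) \<Rightarrow> bool" where
  "hilbert_schmidt A \<longleftrightarrow> clinear_on UNIV A \<and> bounded_linear A \<and>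
     (\<forall>E. orthonormal_basis E \<longrightarrow> (\<lambda>e. (norm (A e))\<^sup>2) summable_on E)"

definition HS_tendsto :: "(nat \<Rightarrow> 'h::complex_hilbert \<Rightarrow> 'h) \<Rightarrow> ('h \<Rightarrow> 'h) \<Rightarrow> bool" where
  "HS_tendsto B A \<longleftrightarrow> (\<forall>n. hilbert_schmidt (B n)) \<and> hilbert_schmidt A \<and>
     (\<forall>E. orthonormal_basis E \<longrightarrow> (\<lambda>n. \<Sum>\<^sub>\<infinity>e\<in>E. (norm (B n e - A e))\<^sup>2) \<longlonglongrightarrow> 0)"

text \<open>An unbounded operator is given by its domain \<open>S\<close> and a function \<open>T\<close> whose values outside
  \<open>S\<close> are irrelevant. The last conjunct says that the adjoint is the operator itself.\<close>

definition positive_selfadjoint :: "'h::complex_hilbert set \<Rightarrow> ('h \<Rightarrow> 'h) \<Rightarrow> bool" where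
  "positive_selfadjoint S T \<longleftrightarrow>
     csubspace S \<and> closure S = UNIV \<and> clinear_on S T \<and>
     (\<forall>u\<in>S. Im (cinner (T u) u) = 0 \<and> 0 \<le> Re (cinner (T u) u)) \<and>
     (\<forall>v w. (\<forall>u\<in>S. cinner (T u) v = cinner u w) \<longleftrightarrow> v \<in> S \<and> w = T v)"


section \<open>Square integrable functions\<close>

definition L2 :: "'a measure \<Rightarrow> ('a \<Rightarrow> complex) set" where
  "L2 M = {f \<in> borel_measurable M. integrable M (\<lambda>x. (cmod (f x))\<^sup>2)}"

definition L2_tendsto :: "'a measure \<Rightarrow> (nat \<Rightarrow> 'a \<Rightarrow> complex) \<Rightarrow> ('a \<Rightarrow> complex) \<Rightarrow> bool" where
  "L2_tendsto M fs f \<longleftrightarrow> (\<forall>n. fs n \<in> L2 M) \<and> f \<in> L2 M \<and>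
     (\<lambda>n. \<integral>x. (cmod (fs n x - f x))\<^sup>2 \<partial>M) \<longlonglongrightarrow> 0"

text \<open>The function with property \<open>P\<close> that is unique up to null sets. As everywhere in HOL, the
  operation is made total: the value is \<open>0\<close> if there is no such function.\<close>

definition the_AE :: "'a measure \<Rightarrow> (('a \<Rightarrow> complex) \<Rightarrow> bool) \<Rightarrow> 'a \<Rightarrow> complex" where
  "the_AE M P = (if \<exists>h. P h \<and> (\<forall>h'. P h' \<longrightarrow> (AE x in M. h' x = h x)) then SOME h. P h else (\<lambda>_. 0))"


section \<open>Exponential Lie groups\<close>

primrec times_differentiable ::
    "nat \<Rightarrow> ('a::real_normed_vector \<Rightarrow> 'b::real_normed_vector) \<Rightarrow> bool" where
  "times_differentiable 0 f \<longleftrightarrow> continuous_on UNIV f"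
| "times_differentiable (Suc k) f \<longleftrightarrow>
     (\<forall>x. f differentiable (at x)) \<and>
     (\<forall>v. times_differentiable k (\<lambda>x. frechet_derivative f (at x) v))"

definition smooth_map :: "('a::real_normed_vector \<Rightarrow> 'b::real_normed_vector) \<Rightarrow> bool" where
  "smooth_map f \<longleftrightarrow> (\<forall>k. times_differentiable k f)"

definition lie_log :: "(real^'n \<Rightarrow> 'g) \<Rightarrow> 'g \<Rightarrow> real^'n" where
  "lie_log Exp = the_inv_into UNIV Exp"

text \<open>Since the exponential map of an exponential Lie group is a diffeomorphism, it is a global
  chart, and the manifold structure is the one transported by it. The tangent space at the
  identity is identified with \<open>real^'n\<close> through this chart; then \<open>t \<mapsto> Exp (t *\<^sub>R X)\<close> is
  the one-parameter subgroup with initial velocity \<open>X\<close>. Inversion is \<open>X \<mapsto> - X\<close> in the chart.\<close>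

locale exponential_lie_group = group G
  for G :: "('g, 'e) monoid_scheme" (structure) +
  fixes Exp :: "real^'n \<Rightarrow> 'g"
  assumes bij_Exp: "bij_betw Exp UNIV (carrier G)"
    and one_parameter: "Exp ((s + t) *\<^sub>R X) = Exp (s *\<^sub>R X) \<otimes> Exp (t *\<^sub>R X)"
    and smooth_mult: "smooth_map (\<lambda>(X, Y). lie_log Exp (Exp X \<otimes> Exp Y))"

definition lie_Ad :: "('g, 'e) monoid_scheme \<Rightarrow> (real^'n \<Rightarrow> 'g) \<Rightarrow> 'g \<Rightarrow> real^'n \<Rightarrow> real^'n" where
  "lie_Ad G Exp x Y =
     vector_derivative (\<lambda>t. lie_log Exp (x \<otimes>\<^bsub>G\<^esub> Exp (t *\<^sub>R Y) \<otimes>\<^bsub>G\<^esub> inv\<^bsub>G\<^esub> x)) (at 0)"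

definition lie_bracket ::
    "('g, 'e) monoid_scheme \<Rightarrow> (real^'n \<Rightarrow> 'g) \<Rightarrow> real^'n \<Rightarrow> real^'n \<Rightarrow> real^'n" where
  "lie_bracket G Exp X Y = vector_derivative (\<lambda>s. lie_Ad G Exp (Exp (s *\<^sub>R X)) Y) (at 0)"

text \<open>\<open>\<Theta>(X) = \<bar>det ((e\<^sup>a\<^sup>d\<^sup>X - 1) / ad X)\<bar>\<close>, with the power series of \<open>(e\<^sup>z - 1) / z\<close>.\<close>

definition lie_Theta :: "('g, 'e) monoid_scheme \<Rightarrow> (real^'n \<Rightarrow> 'g) \<Rightarrow> real^'n \<Rightarrow> real" where
  "lie_Theta G Exp X =
     \<bar>det (matrix (\<lambda>V. \<Sum>k. (1 / fact (Suc k)) *\<^sub>R ((lie_bracket G Exp X ^^ k) V)))\<bar>"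

definition coadjoint ::
    "('g, 'e) monoid_scheme \<Rightarrow> (real^'n \<Rightarrow> 'g) \<Rightarrow> 'g \<Rightarrow> ((real^'n) \<Rightarrow>\<^sub>L real) \<Rightarrow> ((real^'n) \<Rightarrow>\<^sub>L real)" where
  "coadjoint G Exp g Y = Y o\<^sub>L Blinfun (lie_Ad G Exp (inv\<^bsub>G\<^esub> g))"

definition coadjoint_orbit ::
    "('g, 'e) monoid_scheme \<Rightarrow> (real^'n \<Rightarrow> 'g) \<Rightarrow> ((real^'n) \<Rightarrow>\<^sub>L real) \<Rightarrow> ((real^'n) \<Rightarrow>\<^sub>L real) set" where
  "coadjoint_orbit G Exp F = (\<lambda>g. coadjoint G Exp g F) ` carrier G"

definition kappa ::
    "('g, 'e) monoid_scheme \<Rightarrow> (real^'n \<Rightarrow> 'g) \<Rightarrow> ((real^'n) \<Rightarrow>\<^sub>L real) \<Rightarrow> 'g \<Rightarrow> ((real^'n) \<Rightarrow>\<^sub>L real)" where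
  "kappa G Exp F x = coadjoint G Exp (inv\<^bsub>G\<^esub> x) F"


section \<open>Haar measures\<close>

definition group_borel :: "('g, 'e) monoid_scheme \<Rightarrow> (real^'n \<Rightarrow> 'g) \<Rightarrow> 'g measure" where
  "group_borel G Exp = vimage_algebra (carrier G) (lie_log Exp) borel"

text \<open>Haar measures on a closed subgroup \<open>H\<close>: nonzero, finite on compact sets (the sets
  \<open>Exp ` C \<inter> H\<close> with \<open>C\<close> compact are exactly the compact subsets of \<open>H\<close>), and invariant.\<close>

definition borel_radon_on ::
    "('g, 'e) monoid_scheme \<Rightarrow> (real^'n \<Rightarrow> 'g) \<Rightarrow> 'g set \<Rightarrow> 'g measure \<Rightarrow> bool" where
  "borel_radon_on G Exp H M \<longleftrightarrow>
     sets M = sets (restrict_space (group_borel G Exp) H) \<and>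
     emeasure M H \<noteq> 0 \<and> (\<forall>C. compact C \<longrightarrow> emeasure M (Exp ` C \<inter> H) < \<infinity>)"

definition left_haar ::
    "('g, 'e) monoid_scheme \<Rightarrow> (real^'n \<Rightarrow> 'g) \<Rightarrow> 'g set \<Rightarrow> 'g measure \<Rightarrow> bool" where
  "left_haar G Exp H M \<longleftrightarrow> borel_radon_on G Exp H M \<and>
     (\<forall>g\<in>H. \<forall>E\<in>sets M. emeasure M (g <#\<^bsub>G\<^esub> E) = emeasure M E)"

definition right_haar ::
    "('g, 'e) monoid_scheme \<Rightarrow> (real^'n \<Rightarrow> 'g) \<Rightarrow> 'g set \<Rightarrow> 'g measure \<Rightarrow> bool" where
  "right_haar G Exp H M \<longleftrightarrow> borel_radon_on G Exp H M \<and>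
     (\<forall>g\<in>H. \<forall>E\<in>sets M. emeasure M (E #>\<^bsub>G\<^esub> g) = emeasure M E)"

text \<open>The modular function of \<open>H\<close>, for a left Haar measure \<open>M\<close>: \<open>M(E h) = \<Delta>(h) M(E)\<close>. With this
  convention \<open>\<Delta>\<^sup>-\<^sup>1 M\<close> is a right Haar measure.\<close>

definition modular_function ::
    "('g, 'e) monoid_scheme \<Rightarrow> 'g set \<Rightarrow> 'g measure \<Rightarrow> ('g \<Rightarrow> real) \<Rightarrow> bool" where
  "modular_function G H M \<Delta> \<longleftrightarrow> (\<forall>h\<in>H. 0 < \<Delta> h \<and>
     (\<forall>E\<in>sets M. emeasure M (E #>\<^bsub>G\<^esub> h) = ennreal (\<Delta> h) * emeasure M E))"


section \<open>Bases, Lebesgue measures, Pfaffian\<close>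

definition basis_family :: "nat \<Rightarrow> (nat \<Rightarrow> 'v::euclidean_space) \<Rightarrow> bool" where
  "basis_family d b \<longleftrightarrow> inj_on b {..<d} \<and> independent (b ` {..<d}) \<and> span (b ` {..<d}) = UNIV"

definition basis_lebesgue :: "nat \<Rightarrow> (nat \<Rightarrow> 'v::euclidean_space) \<Rightarrow> 'v measure" where
  "basis_lebesgue d b = distr (\<Pi>\<^sub>M i\<in>{..<d}. lborel) borel (\<lambda>c. \<Sum>i<d. c i *\<^sub>R b i)"

definition dual_lebesgue ::
    "nat \<Rightarrow> (nat \<Rightarrow> 'v::euclidean_space) \<Rightarrow> ('v \<Rightarrow>\<^sub>L real) measure" where
  "dual_lebesgue d b = distr (\<Pi>\<^sub>M i\<in>{..<d}. lborel) borel
     (\<lambda>c. THE Y. \<forall>i<d. blinfun_apply Y (b i) = c i)"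

definition pfaffian :: "nat \<Rightarrow> (nat \<Rightarrow> nat \<Rightarrow> real) \<Rightarrow> real" where
  "pfaffian n a = 1 / (2 ^ n * fact n) *
     (\<Sum>p | p permutes {..<2 * n}. of_int (sign p) * (\<Prod>i<n. a (p (2 * i)) (p (2 * i + 1))))"

definition Pf_form :: "('g, 'e) monoid_scheme \<Rightarrow> (real^'n \<Rightarrow> 'g) \<Rightarrow> nat \<Rightarrow> (nat \<Rightarrow> real^'n) \<Rightarrow>
    ((real^'n) \<Rightarrow>\<^sub>L real) \<Rightarrow> real" where
  "Pf_form G Exp n b F = pfaffian n (\<lambda>i j. blinfun_apply F (lie_bracket G Exp (b i) (b j)))"


section \<open>Unitary representations\<close>

definition unitary_rep :: "('g, 'e) monoid_scheme \<Rightarrow> (real^'n \<Rightarrow> 'g) \<Rightarrow>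
    ('g \<Rightarrow> 'h::complex_hilbert \<Rightarrow> 'h) \<Rightarrow> bool" where
  "unitary_rep G Exp \<pi> \<longleftrightarrow>
     (\<forall>x\<in>carrier G. clinear_on UNIV (\<pi> x) \<and> surj (\<pi> x) \<and>
        (\<forall>u v. cinner (\<pi> x u) (\<pi> x v) = cinner u v)) \<and>
     (\<forall>x\<in>carrier G. \<forall>y\<in>carrier G. \<pi> (x \<otimes>\<^bsub>G\<^esub> y) = \<pi> x \<circ> \<pi> y) \<and>
     (\<forall>v. continuous_on UNIV (\<lambda>X. \<pi> (Exp X) v))"

definition irreducible_rep ::
    "('g, 'e) monoid_scheme \<Rightarrow> ('g \<Rightarrow> 'h::complex_hilbert \<Rightarrow> 'h) \<Rightarrow> bool" where
  "irreducible_rep G \<pi> \<longleftrightarrow> (\<exists>v::'h. v \<noteq> 0) \<and>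
     (\<forall>S. csubspace S \<and> closed S \<and> (\<forall>x\<in>carrier G. \<pi> x ` S \<subseteq> S) \<longrightarrow> S = {0} \<or> S = UNIV)"

definition wavelet :: "('g \<Rightarrow> 'h::complex_hilbert \<Rightarrow> 'h) \<Rightarrow> 'h \<Rightarrow> 'h \<Rightarrow> 'g \<Rightarrow> complex" where
  "wavelet \<pi> \<phi> \<psi> x = cinner \<psi> (cadj (\<pi> x) \<phi>)"

definition square_integrable_rep ::
    "'g measure \<Rightarrow> ('g \<Rightarrow> 'h::complex_hilbert \<Rightarrow> 'h) \<Rightarrow> bool" where
  "square_integrable_rep \<mu>r \<pi> \<longleftrightarrow> (\<exists>\<phi> \<psi>. \<phi> \<noteq> 0 \<and> \<psi> \<noteq> 0 \<and> wavelet \<pi> \<phi> \<psi> \<in> L2 \<mu>r)"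

text \<open>Subalgebras subordinate to \<open>F\<close> and, among them, those of maximal dimension that satisfy
  the Pukanszky condition.\<close>

definition subordinate :: "('g, 'e) monoid_scheme \<Rightarrow> (real^'n \<Rightarrow> 'g) \<Rightarrow>
    ((real^'n) \<Rightarrow>\<^sub>L real) \<Rightarrow> (real^'n) set \<Rightarrow> bool" where
  "subordinate G Exp F \<hh> \<longleftrightarrow> subspace \<hh> \<and>
     (\<forall>X\<in>\<hh>. \<forall>Y\<in>\<hh>. lie_bracket G Exp X Y \<in> \<hh> \<and> blinfun_apply F (lie_bracket G Exp X Y) = 0)"

definition pukanszky_polarization :: "('g, 'e) monoid_scheme \<Rightarrow> (real^'n \<Rightarrow> 'g) \<Rightarrow>
    ((real^'n) \<Rightarrow>\<^sub>L real) \<Rightarrow> (real^'n) set \<Rightarrow> bool" where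
  "pukanszky_polarization G Exp F \<hh> \<longleftrightarrow>
     subordinate G Exp F \<hh> \<and> (\<forall>\<kk>. subordinate G Exp F \<kk> \<longrightarrow> dim \<kk> \<le> dim \<hh>) \<and>
     (\<lambda>g. coadjoint G Exp g F) ` (Exp ` \<hh>) = {F + Z |Z. \<forall>X\<in>\<hh>. blinfun_apply Z X = 0}"

definition orbit_character :: "(real^'n \<Rightarrow> 'g) \<Rightarrow> ((real^'n) \<Rightarrow>\<^sub>L real) \<Rightarrow> 'g \<Rightarrow> complex" where
  "orbit_character Exp F x = cis (- 2 * pi * blinfun_apply F (lie_log Exp x))"

text \<open>The space of the induced representation consists of the measurable \<open>f\<close> on \<open>G\<close> with
  \<open>f(x h) = (\<Delta>\<^sub>H(h) / \<Delta>\<^sub>G(h))\<^sup>1\<^sup>/\<^sup>2 \<xi>(h)\<^sup>-\<^sup>1 f(x)\<close> that are square integrable modulo \<open>H\<close>, and \<open>G\<close> acts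
  by left translation. For such \<open>f\<close>, integration of \<open>\<bar>f\<bar>\<^sup>2\<close> over \<open>G/H\<close> is integration of \<open>w \<bar>f\<bar>\<^sup>2\<close>
  over \<open>G\<close> for any weight \<open>w \<ge> 0\<close> whose integral over every coset \<open>x H\<close> is \<open>1\<close>; the result
  does not depend on \<open>w\<close>.\<close>

definition bruhat_weight :: "('g, 'e) monoid_scheme \<Rightarrow> (real^'n \<Rightarrow> 'g) \<Rightarrow>
    'g measure \<Rightarrow> ('g \<Rightarrow> real) \<Rightarrow> bool" where
  "bruhat_weight G Exp \<nu>H w \<longleftrightarrow> w \<in> borel_measurable (group_borel G Exp) \<and>
     (\<forall>x\<in>carrier G. 0 \<le> w x \<and> (\<integral>\<^sup>+h. ennreal (w (x \<otimes>\<^bsub>G\<^esub> h)) \<partial>\<nu>H) = 1)"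

definition induced_space :: "('g, 'e) monoid_scheme \<Rightarrow> 'g set \<Rightarrow> 'g measure \<Rightarrow>
    ('g \<Rightarrow> real) \<Rightarrow> ('g \<Rightarrow> real) \<Rightarrow> ('g \<Rightarrow> real) \<Rightarrow> ('g \<Rightarrow> complex) \<Rightarrow> ('g \<Rightarrow> complex) set" where
  "induced_space G H \<mu>l \<Delta> \<Delta>H w \<xi> = {f \<in> borel_measurable \<mu>l.
     (\<forall>x\<in>carrier G. \<forall>h\<in>H.
        f (x \<otimes>\<^bsub>G\<^esub> h) = complex_of_real (sqrt (\<Delta>H h / \<Delta> h)) * inverse (\<xi> h) * f x) \<and>
     integrable \<mu>l (\<lambda>x. w x * (cmod (f x))\<^sup>2)}"

text \<open>\<open>\<pi>\<close> is unitarily equivalent, via \<open>U\<close>, to the representation induced by \<open>\<xi>\<close> from \<open>H\<close>.\<close>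

definition is_induced_rep :: "('g, 'e) monoid_scheme \<Rightarrow> (real^'n \<Rightarrow> 'g) \<Rightarrow> 'g set \<Rightarrow>
    ('g \<Rightarrow> complex) \<Rightarrow> 'g measure \<Rightarrow> ('g \<Rightarrow> real) \<Rightarrow> ('g \<Rightarrow> 'h::complex_hilbert \<Rightarrow> 'h) \<Rightarrow> bool" where
  "is_induced_rep G Exp H \<xi> \<mu>l \<Delta> \<pi> \<longleftrightarrow>
     (\<exists>\<nu>H \<Delta>H w. \<exists>U :: 'h \<Rightarrow> 'g \<Rightarrow> complex.
        left_haar G Exp H \<nu>H \<and> modular_function G H \<nu>H \<Delta>H \<and> bruhat_weight G Exp \<nu>H w \<and>
        (\<forall>v. U v \<in> induced_space G H \<mu>l \<Delta> \<Delta>H w \<xi>) \<and>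
        (\<forall>u v. AE y in \<mu>l. U (u + v) y = U u y + U v y) \<and>
        (\<forall>c v. AE y in \<mu>l. U (c *\<^sub>C v) y = c * U v y) \<and>
        (\<forall>u v. cinner u v = (\<integral>y. complex_of_real (w y) * U u y * cnj (U v y) \<partial>\<mu>l)) \<and>
        (\<forall>f\<in>induced_space G H \<mu>l \<Delta> \<Delta>H w \<xi>. \<exists>v. AE y in \<mu>l. U v y = f y) \<and>
        (\<forall>x\<in>carrier G. \<forall>v. AE y in \<mu>l. U (\<pi> x v) y = U v (inv\<^bsub>G\<^esub> x \<otimes>\<^bsub>G\<^esub> y)))"


section \<open>Duflo-Moore operator, Fourier transforms and quantization\<close>

text \<open>The operator \<open>\<D>\<^sup>-\<^sup>1\<close> is \<open>Dinv\<close> with domain \<open>S\<close>. For it to be determined by the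
  orthogonality relation, "positive" has to include self-adjointness, and the domain has to be
  the full set of admissible vectors, as in the theorem of Duflo and Moore.\<close>

definition duflo_moore ::
    "'g measure \<Rightarrow> ('g \<Rightarrow> 'h::complex_hilbert \<Rightarrow> 'h) \<Rightarrow> 'h set \<Rightarrow> ('h \<Rightarrow> 'h) \<Rightarrow> bool" where
  "duflo_moore \<mu>r \<pi> S Dinv \<longleftrightarrow>
     positive_selfadjoint S Dinv \<and>
     S = {\<phi>. \<forall>\<psi>. wavelet \<pi> \<phi> \<psi> \<in> L2 \<mu>r} \<and>
     (\<forall>\<phi>1\<in>S. \<forall>\<phi>2\<in>S. \<forall>\<psi>1 \<psi>2.
        (\<integral>x. wavelet \<pi> \<phi>1 \<psi>1 x * cnj (wavelet \<pi> \<phi>2 \<psi>2 x) \<partial>\<mu>r) =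
        cinner \<psi>1 \<psi>2 * cnj (cinner (Dinv \<phi>1) (Dinv \<phi>2)))"

text \<open>\<open>B\<close> is the bounded extension of the operator \<open>\<integral> f(x) \<pi>(x\<^sup>-\<^sup>1) \<D> d\<mu>\<^sub>r(x)\<close>, which is
  defined on \<open>Dom(\<D>) = Dinv ` S\<close>.\<close>

definition fourier_wigner_integral :: "('g, 'e) monoid_scheme \<Rightarrow> 'g measure \<Rightarrow>
    ('g \<Rightarrow> 'h \<Rightarrow> 'h) \<Rightarrow> 'h set \<Rightarrow> ('h \<Rightarrow> 'h) \<Rightarrow> ('g \<Rightarrow> complex) \<Rightarrow>
    ('h::{complex_hilbert, second_countable_topology} \<Rightarrow> 'h) \<Rightarrow> bool" where
  "fourier_wigner_integral G \<mu>r \<pi> S Dinv f B \<longleftrightarrow> hilbert_schmidt B \<and>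
     (\<forall>\<phi>\<in>Dinv ` S. B \<phi> = (\<integral>x. f x *\<^sub>C \<pi> (inv\<^bsub>G\<^esub> x) (inv_into S Dinv \<phi>) \<partial>\<mu>r))"

text \<open>Extension by continuity from \<open>L\<^sup>1 \<inter> L\<^sup>2\<close> to \<open>L\<^sup>2\<close>.\<close>

definition fourier_wigner_limit :: "('g, 'e) monoid_scheme \<Rightarrow> 'g measure \<Rightarrow>
    ('g \<Rightarrow> 'h \<Rightarrow> 'h) \<Rightarrow> 'h set \<Rightarrow> ('h \<Rightarrow> 'h) \<Rightarrow> ('g \<Rightarrow> complex) \<Rightarrow>
    ('h::{complex_hilbert, second_countable_topology} \<Rightarrow> 'h) \<Rightarrow> bool" where
  "fourier_wigner_limit G \<mu>r \<pi> S Dinv f A \<longleftrightarrow>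
     (\<exists>fs B. (\<forall>k. integrable \<mu>r (fs k) \<and> fourier_wigner_integral G \<mu>r \<pi> S Dinv (fs k) (B k)) \<and>
        L2_tendsto \<mu>r fs f \<and> HS_tendsto B A)"

text \<open>The inverse Fourier-Wigner transform, made total by the value \<open>0\<close> outside its domain
  \<open>L\<^sup>2\<^sub>r\<close> (note that the limit relation forces \<open>f \<in> L\<^sup>2\<^sub>r\<close>).\<close>

definition fourier_wigner_inv :: "('g, 'e) monoid_scheme \<Rightarrow> 'g measure \<Rightarrow>
    ('g \<Rightarrow> 'h \<Rightarrow> 'h) \<Rightarrow> 'h set \<Rightarrow> ('h \<Rightarrow> 'h) \<Rightarrow> ('g \<Rightarrow> complex) \<Rightarrow>
    ('h::{complex_hilbert, second_countable_topology} \<Rightarrow> 'h)" where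
  "fourier_wigner_inv G \<mu>r \<pi> S Dinv f =
     (if \<exists>!A. fourier_wigner_limit G \<mu>r \<pi> S Dinv f A
      then THE A. fourier_wigner_limit G \<mu>r \<pi> S Dinv f A else (\<lambda>_. 0))"

definition fourier_kirillov_integral :: "('g, 'e) monoid_scheme \<Rightarrow> (real^'n \<Rightarrow> 'g) \<Rightarrow> nat \<Rightarrow>
    (nat \<Rightarrow> real^'n) \<Rightarrow> ((real^'n) \<Rightarrow>\<^sub>L real) \<Rightarrow> 'g measure \<Rightarrow> ('g \<Rightarrow> real) \<Rightarrow>
    ('g \<Rightarrow> complex) \<Rightarrow> real^'n \<Rightarrow> complex" where
  "fourier_kirillov_integral G Exp n b F \<mu>r \<Delta> f X =
     (\<integral>y. f y * cis (- 2 * pi * blinfun_apply (kappa G Exp F y) X) /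
            complex_of_real (sqrt (\<bar>Pf_form G Exp n b F\<bar> * \<Delta> y)) \<partial>\<mu>r)"

text \<open>The Plancherel sense of this integral: after the substitution \<open>Y = \<kappa>(y)\<close> it is a
  Euclidean Fourier transform, extended by continuity from the \<open>f \<in> L\<^sup>2\<^sub>r\<close> for which the
  integral converges absolutely to a map \<open>L\<^sup>2\<^sub>r \<rightarrow> L\<^sup>2(dX)\<close>.\<close>

definition fourier_kirillov_limit :: "('g, 'e) monoid_scheme \<Rightarrow> (real^'n \<Rightarrow> 'g) \<Rightarrow> nat \<Rightarrow>
    (nat \<Rightarrow> real^'n) \<Rightarrow> ((real^'n) \<Rightarrow>\<^sub>L real) \<Rightarrow> 'g measure \<Rightarrow> ('g \<Rightarrow> real) \<Rightarrow>
    ('g \<Rightarrow> complex) \<Rightarrow> (real^'n \<Rightarrow> complex) \<Rightarrow> bool" where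
  "fourier_kirillov_limit G Exp n b F \<mu>r \<Delta> f h \<longleftrightarrow>
     (\<exists>fs. (\<forall>k. integrable \<mu>r
              (\<lambda>y. fs k y / complex_of_real (sqrt (\<bar>Pf_form G Exp n b F\<bar> * \<Delta> y)))) \<and>
        L2_tendsto \<mu>r fs f \<and>
        L2_tendsto (basis_lebesgue (2 * n) b)
          (\<lambda>k. fourier_kirillov_integral G Exp n b F \<mu>r \<Delta> (fs k)) h)"

text \<open>The inverse Fourier-Kirillov transform with prefactor \<open>\<sigma>(\<Theta>(log x))\<close>. The choice
  \<open>\<sigma> = sqrt\<close> is the prefactor \<open>\<Theta>(log x)\<^sup>1\<^sup>/\<^sup>2\<close>. With \<open>d\<mu>\<^sub>r(exp X) = \<Theta>(X) dX\<close>, the prefactor that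
  makes the transform isometric from \<open>L\<^sup>2\<^sub>r\<close> to \<open>L\<^sup>2\<^sub>r\<close> is \<open>\<Theta>(log x)\<^sup>-\<^sup>1\<^sup>/\<^sup>2\<close>; with the
  former, the result need not lie in \<open>L\<^sup>2\<^sub>r\<close>.\<close>

definition fourier_kirillov_inv :: "(real \<Rightarrow> real) \<Rightarrow> ('g, 'e) monoid_scheme \<Rightarrow>
    (real^'n \<Rightarrow> 'g) \<Rightarrow> nat \<Rightarrow> (nat \<Rightarrow> real^'n) \<Rightarrow> ((real^'n) \<Rightarrow>\<^sub>L real) \<Rightarrow> 'g measure \<Rightarrow>
    ('g \<Rightarrow> real) \<Rightarrow> ('g \<Rightarrow> complex) \<Rightarrow> 'g \<Rightarrow> complex" where
  "fourier_kirillov_inv \<sigma> G Exp n b F \<mu>r \<Delta> f x =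
     complex_of_real (\<sigma> (lie_Theta G Exp (lie_log Exp x))) *
     the_AE (basis_lebesgue (2 * n) b) (fourier_kirillov_limit G Exp n b F \<mu>r \<Delta> f) (lie_log Exp x)"

definition quantization :: "(real \<Rightarrow> real) \<Rightarrow> ('g, 'e) monoid_scheme \<Rightarrow>
    (real^'n \<Rightarrow> 'g) \<Rightarrow> nat \<Rightarrow> (nat \<Rightarrow> real^'n) \<Rightarrow> ((real^'n) \<Rightarrow>\<^sub>L real) \<Rightarrow> 'g measure \<Rightarrow>
    ('g \<Rightarrow> real) \<Rightarrow> ('g \<Rightarrow> 'h \<Rightarrow> 'h) \<Rightarrow> 'h set \<Rightarrow> ('h \<Rightarrow> 'h) \<Rightarrow> ('g \<Rightarrow> complex) \<Rightarrow>
    ('h::{complex_hilbert, second_countable_topology} \<Rightarrow> 'h)" where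
  "quantization \<sigma> G Exp n b F \<mu>r \<Delta> \<pi> S Dinv f =
     fourier_wigner_inv G \<mu>r \<pi> S Dinv (fourier_kirillov_inv \<sigma> G Exp n b F \<mu>r \<Delta> f)"

end

theory Submission
  imports Defs
begin

text \<open>
  In the global chart conjugation by \<open>x\<close> is the linear map \<open>Ad\<^sub>x\<close>, and
  \<open>\<kappa>(y x) = \<kappa>(y) \<circ> Ad\<^sub>x\<close>. Substituting \<open>y \<mapsto> y x\<close> in the Fourier-Kirillov integral
  of \<open>R f\<close>, where \<open>R f(y) = f(y x\<^sup>-\<^sup>1)\<close>, therefore shows that the inverse transform \<open>g\<close> of \<open>f\<close>
  is replaced by \<open>\<Delta>(x)\<^sup>-\<^sup>1\<^sup>/\<^sup>2 g(x z x\<^sup>-\<^sup>1)\<close>; here \<open>\<Theta> \<circ> Ad\<^sub>x = \<Theta>\<close>, so that the prefactor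
  does not matter. On the other side, the orthogonality relations and
  \<open>\<mu>\<^sub>r(x E) = \<Delta>(x)\<^sup>-\<^sup>1 \<mu>\<^sub>r(E)\<close> give \<open>\<parallel>\<D>\<^sup>-\<^sup>1 \<pi>(x) \<phi>\<parallel>\<^sup>2 = \<Delta>(x)\<^sup>-\<^sup>1 \<parallel>\<D>\<^sup>-\<^sup>1 \<phi>\<parallel>\<^sup>2\<close>. A positive
  self-adjoint operator is determined by the form of its square, hence
  \<open>\<D> \<pi>(x) = \<Delta>(x)\<^sup>1\<^sup>/\<^sup>2 \<pi>(x) \<D>\<close>. Substituting \<open>z \<mapsto> x z x\<^sup>-\<^sup>1\<close>, which scales \<open>\<mu>\<^sub>r\<close> by
  \<open>\<Delta>(x)\<^sup>-\<^sup>1\<close>, in the Fourier-Wigner integral of \<open>g\<close> produces the same factor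
  \<open>\<Delta>(x)\<^sup>-\<^sup>1\<^sup>/\<^sup>2\<close>. Both identities pass to the \<open>L\<^sup>2\<close> and Hilbert-Schmidt limits.
\<close>

section \<open>Positive self-adjoint operators\<close>

text \<open>Each transform is a limit relation, made total by the value 0 where a limit does not
  exist uniquely. Covariance is therefore proved for the relations themselves. The substitutions
  attached to \<open>x\<close> and to \<open>inv x\<close> carry their solutions onto each other, so
  the two sides of an identity are well defined together or fall back to 0 together. This also
  covers a prefactor that leads out of the square integrable functions: both operators are then 0.
  For the same reason integrals are transformed as total operations, with equality also in the case
  of the default value. The main obstacle is the unbounded operator \<open>Dinv\<close>. The
  orthogonality relations give only the inner products of \<open>Dinv u\<close> and
  \<open>Dinv v\<close>, that is, the form of its square, and a positive square root has to be
  recovered from it. Bounded functions of the operator are compared first: the resolvent of the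
  square is determined by the form, and multiplying it by the operator gives a bounded positive root
  of a known operator.\<close>

lemma scaleC_scaleR_commute: "a *\<^sub>C (r *\<^sub>R u) = r *\<^sub>R (a *\<^sub>C (u::'h::complex_hilbert))"
  by (simp add: scaleC_of_real[symmetric] scaleC_scaleC mult.commute)

lemma cinner_add_right: "cinner u (v + w) = cinner u v + cinner (u::'h::complex_hilbert) w"
  by (metis cinner_commute cinner_add_left complex_cnj_add)

lemma cinner_scaleC_right: "cinner u (a *\<^sub>C v) = cnj a * cinner (u::'h::complex_hilbert) v"
  by (metis cinner_commute cinner_scaleC_left complex_cnj_mult)

lemma cinner_scaleR_left: "cinner (r *\<^sub>R u) v = of_real r * cinner (u::'h::complex_hilbert) v"
  by (metis cinner_scaleC_left scaleC_of_real)

lemma cinner_scaleR_right: "cinner u (r *\<^sub>R v) = of_real r * cinner (u::'h::complex_hilbert) v"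
  by (metis cinner_scaleC_right scaleC_of_real complex_cnj_complex_of_real)

lemma cinner_minus_left: "cinner (- u) v = - cinner (u::'h::complex_hilbert) v"
  using cinner_scaleR_left[of "-1" u v] by simp

lemma cinner_minus_right: "cinner u (- v) = - cinner (u::'h::complex_hilbert) v"
  using cinner_scaleR_right[of u "-1" v] by simp

lemma cinner_diff_left: "cinner (u - v) w = cinner u w - cinner (v::'h::complex_hilbert) w"
  using cinner_add_left[of u "-v" w] by (simp add: cinner_minus_left)

lemma cinner_diff_right: "cinner w (u - v) = cinner w u - cinner w (v::'h::complex_hilbert)"
  using cinner_add_right[of w u "-v"] by (simp add: cinner_minus_right)

lemma cinner_zero_left [simp]: "cinner 0 v = (0::complex)"
  using cinner_diff_left[of v v v] by simp

lemma cinner_zero_right [simp]: "cinner v 0 = (0::complex)"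
  using cinner_diff_right[of v v v] by simp

lemmas cinner_simps = cinner_add_left cinner_add_right cinner_diff_left cinner_diff_right
  cinner_scaleR_left cinner_scaleR_right cinner_minus_left cinner_minus_right

lemma Im_cinner_self: "Im (cinner u u) = 0" for u :: "'h::complex_hilbert"
  using cinner_commute[of u u] by (metis Reals_cnj_iff complex_is_Real_iff)

lemma Re_cinner_self: "Re (cinner u u) = (norm u)\<^sup>2" for u :: "'h::complex_hilbert"
proof -
  have "0 \<le> sqrt (Re (cinner u u))" using norm_eq_sqrt_cinner[of u] norm_ge_zero[of u] by simp
  then show ?thesis by (simp add: norm_eq_sqrt_cinner)
qed

lemma cinner_self: "cinner u u = complex_of_real ((norm u)\<^sup>2)" for u :: "'h::complex_hilbert"
  by (simp add: complex_eq_iff Re_cinner_self Im_cinner_self)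

lemma Re_cinner_commute: "Re (cinner u v) = Re (cinner v u)" for u :: "'h::complex_hilbert"
  using cinner_commute[of u v] by simp

lemma Re_cinner_i: "Re (cinner u (\<i> *\<^sub>C v)) = Im (cinner u v)" for u :: "'h::complex_hilbert"
  by (simp add: cinner_scaleC_right)

lemma norm_diff_sq: "(norm (u - v))\<^sup>2 = (norm u)\<^sup>2 - 2 * Re (cinner u v) + (norm v)\<^sup>2"
  for u :: "'h::complex_hilbert"
  by (simp add: Re_cinner_self[symmetric] cinner_simps Re_cinner_commute[of v u])

lemma norm_add_sq: "(norm (u + v))\<^sup>2 = (norm u)\<^sup>2 + 2 * Re (cinner u v) + (norm v)\<^sup>2"
  for u :: "'h::complex_hilbert"
  by (simp add: Re_cinner_self[symmetric] cinner_simps Re_cinner_commute[of v u])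

text \<open>The triangle inequality is already available for the norm, so Cauchy-Schwarz is read off
  from its square.\<close>

lemma Re_cinner_le: "Re (cinner u v) \<le> norm u * norm v" for u :: "'h::complex_hilbert"
proof -
  have "(norm (u + v))\<^sup>2 \<le> (norm u + norm v)\<^sup>2"
    by (intro power_mono norm_triangle_ineq) auto
  then show ?thesis unfolding norm_add_sq power2_sum by simp
qed

lemma abs_Re_cinner_le: "\<bar>Re (cinner u v)\<bar> \<le> norm u * norm v" for u :: "'h::complex_hilbert"
  using Re_cinner_le[of u v] Re_cinner_le[of "-u" v] by (simp add: cinner_minus_left abs_le_iff)

text \<open>The factor 2 comes from estimating real and imaginary part separately, the latter being
  the real part against \<open>\<i> *\<^sub>C v\<close>. Any constant would do for boundedness,
  hence for continuity.\<close>

lemma norm_cinner_le: "norm (cinner u v) \<le> 2 * (norm u * norm v)" for u :: "'h::complex_hilbert"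
proof -
  have i: "norm (\<i> *\<^sub>C v) = norm v"
    by (simp add: norm_eq_sqrt_cinner cinner_scaleC_left cinner_scaleC_right)
  have "cmod (cinner u v) \<le> \<bar>Re (cinner u v)\<bar> + \<bar>Im (cinner u v)\<bar>" by (rule cmod_le)
  also have "\<dots> \<le> 2 * (norm u * norm v)"
    using abs_Re_cinner_le[of u v] abs_Re_cinner_le[of u "\<i> *\<^sub>C v"] i by (simp add: Re_cinner_i)
  finally show ?thesis .
qed

lemma bounded_bilinear_cinner: "bounded_bilinear (cinner :: 'h::complex_hilbert \<Rightarrow> 'h \<Rightarrow> complex)"
proof
  show "\<exists>K. \<forall>a b. norm (cinner a (b::'h)) \<le> norm a * norm b * K"
    by (rule exI[of _ 2]) (use norm_cinner_le in \<open>auto simp: mult_ac\<close>)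
qed (auto simp: cinner_simps scaleR_conv_of_real)

lemmas tendsto_cinner [tendsto_intros] = bounded_bilinear.tendsto[OF bounded_bilinear_cinner]

lemma cinner_eqI:
  assumes "\<And>w. cinner w u = cinner w v" shows "u = (v::'h::complex_hilbert)"
proof -
  have "cinner (u - v) (u - v) = 0" using assms by (simp add: cinner_diff_right)
  then show ?thesis by (simp add: cinner_self)
qed

text \<open>This is the operator inequality A^2 \<le> M A. It follows from positivity of the form at
  u - A u / M, where the quadratic term is at most |A u|^2 / M and eats up half of the linear one.
  Its use: where the form of a positive operator is small, the image vector is small.\<close>

lemma pos_selfadj_norm_le:
  fixes A :: "'h::complex_hilbert \<Rightarrow> 'h"
  assumes A: "bounded_linear A" and pos: "\<And>u. 0 \<le> Re (cinner (A u) u)"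
    and sym: "\<And>u v. Re (cinner (A u) v) = Re (cinner u (A v))"
    and M: "\<And>u. norm (A u) \<le> M * norm u" "0 < M"
  shows "(norm (A u))\<^sup>2 \<le> M * Re (cinner (A u) u)"
proof -
  interpret A: bounded_linear A by fact
  define w where "w = u - (1 / M) *\<^sub>R A u"
  have Au: "Re (cinner (A (A u)) (A u)) \<le> M * (norm (A u))\<^sup>2"
    using Re_cinner_le[of "A (A u)" "A u"] mult_right_mono[OF M(1)[of "A u"], of "norm (A u)"]
    by (simp add: power2_eq_square)
  have "0 \<le> Re (cinner (A w) w)" by (rule pos)
  also have "\<dots> = Re (cinner (A u) u) - 2 / M * (norm (A u))\<^sup>2
      + (1 / M\<^sup>2) * Re (cinner (A (A u)) (A u))"
    using sym[of "A u" u] 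
    by (simp add: w_def A.diff A.scaleR cinner_simps Re_cinner_self power2_eq_square algebra_simps)
  also have "\<dots> \<le> Re (cinner (A u) u) - 2 / M * (norm (A u))\<^sup>2 + (1 / M\<^sup>2) * (M * (norm (A u))\<^sup>2)"
    using Au by (intro add_left_mono mult_left_mono) auto
  also have "\<dots> = Re (cinner (A u) u) - (norm (A u))\<^sup>2 / M"
    using M(2) by (simp add: field_simps power2_eq_square)
  finally show ?thesis using M(2) by (simp add: field_simps)
qed

text \<open>Put \<open>Z = A - B\<close> and \<open>P = A + B\<close>. Then \<open>P Z = - Z P\<close>, so \<open>\<langle>P Z\<^sup>2 u, u\<rangle> = - \<langle>P Z u, Z u\<rangle> \<le> 0\<close>.
  On an almost maximizing sequence \<open>u\<close> of \<open>\<parallel>Z u\<parallel>\<close> the left-hand side is close to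
  \<open>\<parallel>Z\<parallel>\<^sup>2 \<langle>P u, u\<rangle>\<close>, which forces \<open>\<langle>P u, u\<rangle> \<longrightarrow> 0\<close>, hence \<open>Z u \<longrightarrow> 0\<close>.\<close>

lemma pos_selfadj_sqrt_unique:
  fixes A B :: "'h::complex_hilbert \<Rightarrow> 'h"
  assumes A: "bounded_linear A" "\<And>u. 0 \<le> Re (cinner (A u) u)"
      "\<And>u v. Re (cinner (A u) v) = Re (cinner u (A v))"
    and B: "bounded_linear B" "\<And>u. 0 \<le> Re (cinner (B u) u)"
      "\<And>u v. Re (cinner (B u) v) = Re (cinner u (B v))"
    and eq: "\<And>u. A (A u) = B (B u)"
  shows "A u = B u"
proof (rule ccontr)
  assume neq: "A u \<noteq> B u"
  interpret A: bounded_linear A by fact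
  interpret B: bounded_linear B by fact
  define Z P where "Z = (\<lambda>u. A u - B u)" and "P = (\<lambda>u. A u + B u)"
  have Z: "bounded_linear Z" and P: "bounded_linear P"
    unfolding Z_def P_def by (intro bounded_linear_sub bounded_linear_add A(1) B(1))+
  interpret Z: bounded_linear Z by fact
  interpret P: bounded_linear P by fact
  have symZ: "Re (cinner (Z u) v) = Re (cinner u (Z v))" for u v
    using A(3) B(3) by (simp add: Z_def cinner_simps)
  have posP: "0 \<le> Re (cinner (P u) u)" for u using A(2) B(2) by (simp add: P_def cinner_simps)
  have anti: "P (Z u) = - Z (P u)" for u
    by (simp add: P_def Z_def A.diff B.diff A.add B.add eq)
  have le0: "Re (cinner (P (Z (Z u))) u) \<le> 0" for u
    using posP[of "Z u"] symZ[of "P (Z u)" u] by (simp add: anti cinner_minus_left)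
  obtain M where M: "0 < M" "\<And>u. norm (A u) \<le> norm u * M" using A.pos_bounded by blast
  obtain M' where M': "0 < M'" "\<And>u. norm (B u) \<le> norm u * M'" using B.pos_bounded by blast
  obtain Q where Q: "0 < Q" "\<And>u. norm (P u) \<le> norm u * Q" using P.pos_bounded by blast
  define N where "N = onorm Z"
  have ZN: "norm (Z u) \<le> N * norm u" for u unfolding N_def by (rule onorm[OF Z])
  have N: "0 < N" 
    using neq onorm_pos_lt[OF Z] by (auto simp: N_def Z_def)
  have key: "(norm (Z u))\<^sup>2 \<le> 2 * (M + M') * (Q * sqrt (2 * N^4 - 2 * N\<^sup>2 * (norm (Z u))\<^sup>2) / N\<^sup>2)"
    if u: "norm u = 1" for u
  proof -
    define \<delta> where "\<delta> = sqrt (2 * N^4 - 2 * N\<^sup>2 * (norm (Z u))\<^sup>2)"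
    have ZZ: "norm (Z (Z u)) \<le> N\<^sup>2"
      using order_trans[OF ZN[of "Z u"] mult_left_mono[OF ZN[of u], of N]] N u
      by (simp add: power2_eq_square)
    \<comment> \<open>A unit vector that nearly attains the operator norm N of Z is nearly an
      eigenvector of Z^2 for N^2, with squared defect at most 2 N^2 (N^2 - |Z u|^2).\<close>
    have "(norm (N\<^sup>2 *\<^sub>R u - Z (Z u)))\<^sup>2 = N^4 - 2 * N\<^sup>2 * (norm (Z u))\<^sup>2 + (norm (Z (Z u)))\<^sup>2"
      using symZ[of u "Z u", symmetric] u N
      by (simp add: norm_diff_sq cinner_simps Re_cinner_self power_mult_distrib[symmetric]
          flip: power_mult)
    also have "\<dots> \<le> 2 * N^4 - 2 * N\<^sup>2 * (norm (Z u))\<^sup>2"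
      using power_mono[OF ZZ, of 2] by (simp flip: power_mult)
    finally have \<delta>: "norm (N\<^sup>2 *\<^sub>R u - Z (Z u)) \<le> \<delta>"
      unfolding \<delta>_def by (rule real_le_rsqrt)
    \<comment> \<open>Subtracting the nonpositive quantity from \<open>le0\<close> leaves P applied
      to the small defect only.\<close>
    have "N\<^sup>2 * Re (cinner (P u) u) \<le> Re (cinner (P (N\<^sup>2 *\<^sub>R u - Z (Z u))) u)"
      using le0[of u] by (simp add: P.diff P.scaleR cinner_simps)
    also have "\<dots> \<le> norm (P (N\<^sup>2 *\<^sub>R u - Z (Z u))) * norm u" by (rule Re_cinner_le)
    also have "\<dots> \<le> Q * \<delta>"
      using order_trans[OF Q(2)[of "N\<^sup>2 *\<^sub>R u - Z (Z u)"] mult_right_mono[OF \<delta>, of Q]] Q(1) u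
      by (simp add: mult.commute)
    finally have Pu: "Re (cinner (P u) u) \<le> Q * \<delta> / N\<^sup>2" using N by (simp add: field_simps)
    have "(norm (A u))\<^sup>2 \<le> M * Re (cinner (A u) u)" "(norm (B u))\<^sup>2 \<le> M' * Re (cinner (B u) u)"
      by (rule pos_selfadj_norm_le; use A B M M' in \<open>simp add: mult.commute\<close>)+
    moreover have "M * Re (cinner (A u) u) \<le> M * Re (cinner (P u) u)"
        "M' * Re (cinner (B u) u) \<le> M' * Re (cinner (P u) u)"
      using A(2)[of u] B(2)[of u] M(1) M'(1) by (auto simp: P_def cinner_simps)
    moreover have "(norm (Z u))\<^sup>2 \<le> 2 * ((norm (A u))\<^sup>2 + (norm (B u))\<^sup>2)"
    proof -
      have "(norm (Z u))\<^sup>2 \<le> (norm (A u) + norm (B u))\<^sup>2"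
        unfolding Z_def by (intro power_mono norm_triangle_ineq4) auto
      also have "\<dots> \<le> 2 * ((norm (A u))\<^sup>2 + (norm (B u))\<^sup>2)"
        using sum_squares_bound[of "norm (A u)" "norm (B u)"] by (simp add: power2_sum)
      finally show ?thesis .
    qed
    ultimately have "(norm (Z u))\<^sup>2 \<le> 2 * (M + M') * Re (cinner (P u) u)"
      by (simp add: algebra_simps)
    also have "\<dots> \<le> 2 * (M + M') * (Q * \<delta> / N\<^sup>2)"
      using M(1) M'(1) by (intro mult_left_mono Pu) auto
    finally show ?thesis by (simp add: \<delta>_def)
  qed
  have "\<exists>u. norm u = 1 \<and> N - 1 / Suc k < norm (Z u)" for k
  proof (rule ccontr)
    assume *: "\<not> ?thesis"
    \<comment> \<open>The maximum with 0 makes K admissible as an operator norm bound even when N <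
      1 / (k + 1). Since N > 0, K is smaller than N in either case.\<close>
    define K where "K = max 0 (N - 1 / Suc k)"
    have "norm (Z u) \<le> K * norm u" for u
    proof (cases "u = 0")
      case False
      then have "norm ((1 / norm u) *\<^sub>R u) = 1" by simp
      with * have "\<not> N - 1 / Suc k < norm (Z ((1 / norm u) *\<^sub>R u))" by blast
      then have "norm (Z ((1 / norm u) *\<^sub>R u)) \<le> K" by (simp add: K_def)
      with False show ?thesis by (simp add: Z.scaleR field_simps)
    qed (simp add: Z.zero)
    then have "N \<le> K" unfolding N_def by (intro onorm_bound) (auto simp: K_def)
    moreover have "N - 1 / Suc k < N" by simp
    ultimately show False using N unfolding K_def by linarith
  qed
  then obtain u where u: "\<And>k. norm (u k) = 1" "\<And>k. N - 1 / Suc k < norm (Z (u k))" by metis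
  have ub: "norm (Z (u k)) \<le> N" for k using ZN[of "u k"] u(1)[of k] by simp
  have lim: "(\<lambda>k. norm (Z (u k))) \<longlonglongrightarrow> N"
  proof (rule tendsto_sandwich)
    show "(\<lambda>k. N - 1 / Suc k) \<longlonglongrightarrow> N"
      using tendsto_diff[OF tendsto_const[of N] LIMSEQ_inverse_real_of_nat]
      by (simp add: inverse_eq_divide)
    show "\<forall>\<^sub>F k in sequentially. N - 1 / Suc k \<le> norm (Z (u k))" using u(2) by (simp add: less_imp_le)
    show "\<forall>\<^sub>F k in sequentially. norm (Z (u k)) \<le> N"
      using ub by simp
  qed simp
  have lim1: "(\<lambda>k. 2 * (M + M') * (Q * sqrt (2 * N^4 - 2 * N\<^sup>2 * (norm (Z (u k)))\<^sup>2) / N\<^sup>2))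
      \<longlonglongrightarrow> 2 * (M + M') * (Q * sqrt (2 * N^4 - 2 * N\<^sup>2 * N\<^sup>2) / N\<^sup>2)"
    using N by (intro tendsto_intros lim) auto
  have lim2: "(\<lambda>k. (norm (Z (u k)))\<^sup>2) \<longlonglongrightarrow> N\<^sup>2" by (intro tendsto_intros lim)
  have "N\<^sup>2 \<le> 2 * (M + M') * (Q * sqrt (2 * N^4 - 2 * N\<^sup>2 * N\<^sup>2) / N\<^sup>2)"
    by (rule LIMSEQ_le[OF lim2 lim1]) (use key u(1) in auto)
  moreover have "2 * N^4 - 2 * N\<^sup>2 * N\<^sup>2 = 0" by (simp add: power2_eq_square power4_eq_xxxx)
  ultimately show False using N by simp
qed

section \<open>Unbounded positive self-adjoint operators and the resolvent of their square\<close>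

lemma positive_selfadjoint_sym:
  assumes "positive_selfadjoint S T" "u \<in> S" "v \<in> S"
  shows "cinner (T u) v = cinner u (T v)"
  using assms unfolding positive_selfadjoint_def by blast

text \<open>An adjoint has a closed graph: the relation that defines it is continuous in both
  vectors, and self-adjointness turns the limiting relation back into membership in the
  domain.\<close>

lemma positive_selfadjoint_closed:
  assumes T: "positive_selfadjoint S T" and u: "\<And>k::nat. u k \<in> S"
    and lim: "u \<longlonglongrightarrow> v" "(\<lambda>k. T (u k)) \<longlonglongrightarrow> w"
  shows "v \<in> S \<and> w = T v"
proof -
  have "cinner (T s) v = cinner s w" if "s \<in> S" for s
  proof (rule LIMSEQ_unique)
    show "(\<lambda>k. cinner (T s) (u k)) \<longlonglongrightarrow> cinner (T s) v" by (intro tendsto_intros lim)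
    show "(\<lambda>k. cinner (T s) (u k)) \<longlonglongrightarrow> cinner s w"
      unfolding positive_selfadjoint_sym[OF T that u] by (intro tendsto_intros lim)
  qed
  then show ?thesis using T unfolding positive_selfadjoint_def by blast
qed

text \<open>The solution \<open>u\<close> of \<open>(1 + T\<^sup>2) u = h\<close> in its weak form minimizes
  \<open>\<parallel>u\<parallel>\<^sup>2 + \<parallel>T u\<parallel>\<^sup>2 - 2 Re \<langle>u, h\<rangle>\<close>; a minimizing sequence is Cauchy in the graph norm.\<close>

lemma positive_selfadjoint_weak_solution:
  fixes h :: "'h::complex_hilbert"
  assumes T: "positive_selfadjoint S T"
  obtains u where "u \<in> S" "\<And>v. v \<in> S \<Longrightarrow> cinner u v + cinner (T u) (T v) = cinner h v"
proof -
  have S: "csubspace S" and lin: "clinear_on S T" using T by (auto simp: positive_selfadjoint_def)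
  have S0: "0 \<in> S" and Sadd: "\<And>u v. u \<in> S \<Longrightarrow> v \<in> S \<Longrightarrow> u + v \<in> S"
    and Sc: "\<And>c u. u \<in> S \<Longrightarrow> c *\<^sub>C u \<in> S" using S by (auto simp: csubspace_def)
  have SR: "r *\<^sub>R u \<in> S" if "u \<in> S" for r u using Sc[OF that, of "of_real r"] by (simp add: scaleC_of_real)
  have Tadd: "T (u + v) = T u + T v" if "u \<in> S" "v \<in> S" for u v using lin that by (auto simp: clinear_on_def)
  have Tc: "T (c *\<^sub>C u) = c *\<^sub>C T u" if "u \<in> S" for c u using lin that by (auto simp: clinear_on_def)
  have TR: "T (r *\<^sub>R u) = r *\<^sub>R T u" if "u \<in> S" for r u
    using Tc[OF that, of "of_real r"] by (simp add: scaleC_of_real)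
  define J where "J = (\<lambda>u. (norm u)\<^sup>2 + (norm (T u))\<^sup>2 - 2 * Re (cinner u h))"
  have J_ge: "- (norm h)\<^sup>2 \<le> J u" for u
    using norm_diff_sq[of u h] zero_le_power2[of "norm (u - h)"] zero_le_power2[of "norm (T u)"]
    unfolding J_def by linarith
  define m where "m = Inf (J ` S)"
  have bdd: "bdd_below (J ` S)" by (rule bdd_belowI2) (rule J_ge)
  have m_le: "m \<le> J u" if "u \<in> S" for u unfolding m_def using that bdd by (intro cInf_lower) auto
  have "\<exists>u\<in>S. J u < m + 1 / Suc k" for k
    using cInf_lessD[of "J ` S" "m + 1 / Suc k"] S0 by (auto simp: m_def)
  then obtain u where u: "\<And>k. u k \<in> S" "\<And>k. J (u k) < m + 1 / Suc k" by metis
  \<comment> \<open>Parallelogram law in the graph norm: at the midpoint c the linear terms of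
    \<open>J\<close> cancel, and J c is at least the infimum m.\<close>
  have par: "(norm (a - b))\<^sup>2 + (norm (T a - T b))\<^sup>2 \<le> 2 * (J a + J b - 2 * m)"
    if ab: "a \<in> S" "b \<in> S" for a b
  proof -
    define c where "c = (1 / 2) *\<^sub>R (a + b)"
    have "c \<in> S" unfolding c_def by (intro SR Sadd ab)
    have Tc': "T c = (1 / 2) *\<^sub>R (T a + T b)" unfolding c_def by (simp add: TR Tadd Sadd ab)
    have "4 * J c = 2 * J a + 2 * J b - ((norm (a - b))\<^sup>2 + (norm (T a - T b))\<^sup>2)"
      unfolding J_def Tc' unfolding c_def
      by (simp add: norm_diff_sq norm_add_sq power_divide cinner_simps add_divide_distrib)
    then show ?thesis using m_le[OF \<open>c \<in> S\<close>] by simp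
  qed
  have bound: "(norm (u k - u l))\<^sup>2 + (norm (T (u k) - T (u l)))\<^sup>2 \<le> 4 / Suc N" if "N \<le> k" "N \<le> l" for k l N
  proof -
    have "1 / Suc k \<le> 1 / Suc N" "1 / Suc l \<le> 1 / Suc N" using that by (auto intro!: divide_left_mono)
    then show ?thesis using par[OF u(1)[of k] u(1)[of l]] u(2)[of k] u(2)[of l] by simp
  qed
  have cauchy: "Cauchy X" if X: "\<And>k l N. N \<le> k \<Longrightarrow> N \<le> l \<Longrightarrow> (norm (X k - X l))\<^sup>2 \<le> 4 / Suc N" for X :: "nat \<Rightarrow> 'h"
  proof (rule CauchyI)
    fix e :: real assume e: "0 < e"
    obtain N :: nat where N: "4 / e\<^sup>2 < N" using reals_Archimedean2 by blast
    have "4 < N * e\<^sup>2" using N e by (simp add: pos_divide_less_eq)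
    also have "\<dots> \<le> Suc N * e\<^sup>2" by (intro mult_right_mono) auto
    finally have N': "4 / Suc N < e\<^sup>2" by (simp add: field_simps)
    have "norm (X k - X l) < e" if "N \<le> k" "N \<le> l" for k l
    proof (rule power2_less_imp_less)
      show "(norm (X k - X l))\<^sup>2 < e\<^sup>2" using X[OF that] N' by simp
    qed (use e in simp)
    then show "\<exists>M. \<forall>m\<ge>M. \<forall>n\<ge>M. norm (X m - X n) < e" by blast
  qed
  have "(norm (u k - u l))\<^sup>2 \<le> 4 / Suc N" "(norm (T (u k) - T (u l)))\<^sup>2 \<le> 4 / Suc N"
    if "N \<le> k" "N \<le> l" for k l N
    using bound[OF that] zero_le_power2[of "norm (u k - u l)"]
      zero_le_power2[of "norm (T (u k) - T (u l))"] by linarith+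
  then have "Cauchy u" "Cauchy (\<lambda>k. T (u k))" by (blast intro: cauchy)+
  then obtain p w where p: "u \<longlonglongrightarrow> p" "(\<lambda>k. T (u k)) \<longlonglongrightarrow> w"
    using Cauchy_convergent_iff convergent_def by metis
  have pS: "p \<in> S" and w: "w = T p" using positive_selfadjoint_closed[OF T u(1) p] by auto
  have "(\<lambda>k. J (u k)) \<longlonglongrightarrow> J p"
    unfolding J_def using p(2)[unfolded w] by (intro tendsto_intros p)
  moreover have "(\<lambda>k. m + 1 / Suc k) \<longlonglongrightarrow> m"
    using tendsto_add[OF tendsto_const[of m] LIMSEQ_inverse_real_of_nat] by (simp add: inverse_eq_divide)
  ultimately have Jp: "J p \<le> m" by (rule LIMSEQ_le) (use u(2) less_imp_le in blast)
  have Re0: "Re (cinner p v) + Re (cinner (T p) (T v)) = Re (cinner h v)" if v: "v \<in> S" for v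
  proof -
    define L K where "L = Re (cinner p v) + Re (cinner (T p) (T v)) - Re (cinner h v)"
      and "K = (norm v)\<^sup>2 + (norm (T v))\<^sup>2"
    \<comment> \<open>Along p + t v the functional changes by 2 t L + t^2 K. The optimal t = - L / K
      is undefined for v = 0, so K + 1 replaces K; the change is still at most - L^2 s, which forces
      L = 0.\<close>
    define s where "s = 1 / (K + 1)"
    define t where "t = - L * s"
    have K: "0 \<le> K" by (simp add: K_def)
    have "J (p + t *\<^sub>R v) = J p + 2 * t * L + t\<^sup>2 * K"
      unfolding J_def
      by (simp add: Tadd TR pS v SR norm_add_sq cinner_simps power_mult_distrib L_def K_def
          Re_cinner_commute[of h v] algebra_simps)
    moreover have "m \<le> J (p + t *\<^sub>R v)" by (intro m_le Sadd SR pS v)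
    ultimately have "0 \<le> 2 * t * L + t\<^sup>2 * K" using Jp by simp
    also have "\<dots> = (L\<^sup>2 * s) * (s * K - 2)"
      by (simp add: t_def power2_eq_square algebra_simps)
    also have "\<dots> \<le> (L\<^sup>2 * s) * (- 1)"
      using K by (intro mult_left_mono) (auto simp: s_def field_simps)
    finally have "L\<^sup>2 * s \<le> 0" by simp
    moreover have "0 < s" using K by (simp add: s_def)
    ultimately have "L = 0" by (simp add: mult_le_0_iff)
    then show ?thesis by (simp add: L_def)
  qed
  show ?thesis
  proof (rule that[OF pS])
    fix v assume v: "v \<in> S"
    \<comment> \<open>Replacing v by i v in the real identity supplies the imaginary part.\<close>
    show "cinner p v + cinner (T p) (T v) = cinner h v"
      using Re0[OF v] Re0[OF Sc[OF v, of \<i>]]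
      by (simp add: complex_eq_iff Tc v Re_cinner_i)
  qed
qed

text \<open>\<open>C\<close> is (1 + T^2)^-1, given only as a choice of weak solutions. Linearity
  comes from uniqueness of the solution, and self-adjointness upgrades the weak equation to the
  strong one. The conclusions say that \<open>T \<circ> C\<close> is a bounded positive symmetric
  square root of C - C^2 and that C is symmetric and injective.\<close>

lemma positive_selfadjoint_resolvent:
  fixes C :: "'h::complex_hilbert \<Rightarrow> 'h"
  assumes T: "positive_selfadjoint S T"
    and C: "\<And>h. C h \<in> S"
      "\<And>h v. v \<in> S \<Longrightarrow> cinner (C h) v + cinner (T (C h)) (T v) = cinner h v"
  shows "bounded_linear (\<lambda>h. T (C h))"
    and "0 \<le> Re (cinner (T (C h)) h)"
    and "cinner (T (C h)) k = cinner h (T (C k))"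
    and "T (C (T (C h))) = C h - C (C h)"
    and "cinner (C h) k = cinner h (C k)"
    and "C h = 0 \<Longrightarrow> h = 0"
proof -
  have S: "csubspace S" and lin: "clinear_on S T" and pos: "\<And>u. u \<in> S \<Longrightarrow> 0 \<le> Re (cinner (T u) u)"
    using T by (auto simp: positive_selfadjoint_def)
  have S0: "0 \<in> S" and Sadd: "\<And>u v. u \<in> S \<Longrightarrow> v \<in> S \<Longrightarrow> u + v \<in> S"
    and Sc: "\<And>c u. u \<in> S \<Longrightarrow> c *\<^sub>C u \<in> S" using S by (auto simp: csubspace_def)
  have SR: "r *\<^sub>R u \<in> S" if "u \<in> S" for r u using Sc[OF that, of "of_real r"] by (simp add: scaleC_of_real)
  have Sdiff: "u - v \<in> S" if "u \<in> S" "v \<in> S" for u v using Sadd[OF that(1) SR[OF that(2), of "-1"]] by simp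
  have Tadd: "T (u + v) = T u + T v" if "u \<in> S" "v \<in> S" for u v using lin that by (auto simp: clinear_on_def)
  have TR: "T (r *\<^sub>R u) = r *\<^sub>R T u" if "u \<in> S" for r u
    using lin that by (metis clinear_on_def scaleC_of_real)
  have Tdiff: "T (u - v) = T u - T v" if "u \<in> S" "v \<in> S" for u v
    using Tadd[OF that(1) SR[OF that(2), of "-1"]] TR[OF that(2), of "-1"] by simp
  note sym = positive_selfadjoint_sym[OF T]
  \<comment> \<open>Testing the difference d of two solutions against itself gives |d|^2 + |T d|^2 =
    0.\<close>
  have unique: "u = C h" if u: "u \<in> S" "\<And>v. v \<in> S \<Longrightarrow> cinner u v + cinner (T u) (T v) = cinner h v" for u h
  proof -
    define d where "d = u - C h"
    have d: "d \<in> S" unfolding d_def by (intro Sdiff u C)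
    have Td: "T d = T u - T (C h)" by (simp add: d_def Tdiff u(1) C(1))
    have "cinner d d = cinner u d - cinner (C h) d"
      unfolding cinner_diff_left[symmetric] by (simp only: d_def)
    moreover have "cinner (T d) (T d) = cinner (T u) (T d) - cinner (T (C h)) (T d)"
      unfolding cinner_diff_left[symmetric] by (simp only: Td)
    ultimately have "cinner d d + cinner (T d) (T d) =
        (cinner u d + cinner (T u) (T d)) - (cinner (C h) d + cinner (T (C h)) (T d))" by simp
    also have "\<dots> = 0" using u(2)[OF d] C(2)[OF d, of h] by simp
    finally have "cinner d d + cinner (T d) (T d) = 0" .
    then have "complex_of_real ((norm d)\<^sup>2 + (norm (T d))\<^sup>2) = 0" by (simp add: cinner_self)
    then have "(norm d)\<^sup>2 + (norm (T d))\<^sup>2 = 0" by (simp only: of_real_eq_0_iff)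
    then have "d = 0" by (simp add: add_nonneg_eq_0_iff)
    then show ?thesis by (simp add: d_def)
  qed
  \<comment> \<open>The weak equation says that h - C h represents the functional sending u to the
    inner product of \<open>T u\<close> with \<open>T (C h)\<close>. This is the condition for
    \<open>T (C h)\<close> to lie in the domain of the adjoint, which is T.\<close>
  have TT: "T (C h) \<in> S \<and> h - C h = T (T (C h))" for h
  proof -
    have "cinner (T u) (T (C h)) = cinner u (h - C h)" if "u \<in> S" for u
    proof -
      have "cnj (cinner (C h) u + cinner (T (C h)) (T u)) = cnj (cinner h u)"
        using C(2)[OF that] by simp
      then have "cinner u (C h) + cinner (T u) (T (C h)) = cinner u h"
        by (simp add: cinner_commute[symmetric])
      then show ?thesis by (simp add: cinner_diff_right eq_diff_eq add.commute)
    qed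
    then show ?thesis using T unfolding positive_selfadjoint_def by blast
  qed
  have TCS: "T (C h) \<in> S" and TTC: "T (T (C h)) = h - C h" for h using TT[of h] by auto
  have Cadd: "C (h + k) = C h + C k" for h k
  proof (rule unique[symmetric])
    fix v assume v: "v \<in> S"
    show "cinner (C h + C k) v + cinner (T (C h + C k)) (T v) = cinner (h + k) v"
      unfolding cinner_add_left[of h] C(2)[OF v, of h, symmetric] C(2)[OF v, of k, symmetric]
      by (simp add: Tadd C(1) cinner_add_left)
  qed (intro Sadd C)
  have CR: "C (r *\<^sub>R h) = r *\<^sub>R C h" for h r
    by (rule unique[symmetric]) (use C in \<open>auto simp: SR TR cinner_simps simp flip: distrib_left\<close>)
  \<comment> \<open>Expand the square of h = C h + T T C h; by symmetry the mixed term is 2 |T C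
    h|^2, so every term is nonnegative.\<close>
  have nrm: "norm (T (C h)) \<le> norm h" for h
  proof -
    have "(norm h)\<^sup>2 = (norm (C h + T (T (C h))))\<^sup>2" by (simp add: TTC)
    also have "\<dots> = (norm (C h))\<^sup>2 + 2 * (norm (T (C h)))\<^sup>2 + (norm (T (T (C h))))\<^sup>2"
      unfolding norm_add_sq sym[OF C(1) TCS, of h h, symmetric] by (simp add: Re_cinner_self)
    finally have "(norm (T (C h)))\<^sup>2 \<le> (norm h)\<^sup>2"
      using zero_le_power2[of "norm (C h)"] zero_le_power2[of "norm (T (T (C h)))"]
        zero_le_power2[of "norm (T (C h))"] by linarith
    then show ?thesis by (rule power2_le_imp_le) simp
  qed
  show "bounded_linear (\<lambda>h. T (C h))"
    by (rule bounded_linear_intro[where K = 1]) (auto simp: Cadd CR Tadd TR C nrm)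
  show "0 \<le> Re (cinner (T (C h)) h)"
  proof -
    have "cinner (T (C h)) h = cinner (T (C h)) (C h) + cinner (T (C h)) (T (T (C h)))"
      by (simp add: TTC flip: cinner_add_right)
    also have "\<dots> = cinner (T (C h)) (C h) + cinner (T (T (C h))) (T (C h))"
      using sym[OF TCS TCS] by simp
    finally show ?thesis using pos[OF C(1)] pos[OF TCS] by simp
  qed
  show "cinner (T (C h)) k = cinner h (T (C k))"
  proof -
    have "cinner (T (C h)) k = cinner (T (C h)) (C k) + cinner (T (C h)) (T (T (C k)))"
      by (simp add: TTC flip: cinner_add_right)
    also have "\<dots> = cinner (C h) (T (C k)) + cinner (T (T (C h))) (T (C k))"
      using sym[OF TCS TCS] sym[OF C(1) C(1)] by simp
    also have "\<dots> = cinner h (T (C k))" by (simp add: TTC flip: cinner_add_left)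
    finally show ?thesis .
  qed
  show "cinner (C h) k = cinner h (C k)"
  proof -
    have "cinner (C h) k = cnj (cinner (C k) (C h) + cinner (T (C k)) (T (C h)))"
      unfolding C(2)[OF C(1)] by (rule cinner_commute)
    also have "\<dots> = cinner (C h) (C k) + cinner (T (C h)) (T (C k))"
      by (simp add: cinner_commute[symmetric])
    also have "\<dots> = cinner h (C k)" by (rule C(2)[OF C(1)])
    finally show ?thesis .
  qed
  \<comment> \<open>T and C commute on the range of C, because T C C h solves the weak equation with
    right-hand side T C h. This is what turns T C T C into T T C C = C - C^2.\<close>
  have CT: "C (T (C h)) = T (C (C h))"
  proof (rule unique[symmetric, OF TCS])
    fix v assume v: "v \<in> S"
    have "T (T (C (C h))) = C h - C (C h)" by (rule TTC)
    then have "cinner (T (T (C (C h)))) (T v) = cinner (T (C h)) v - cinner (T (C (C h))) v"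
      using sym[of "C h" v] sym[of "C (C h)" v] C(1) v by (simp add: cinner_diff_left)
    then show "cinner (T (C (C h))) v + cinner (T (T (C (C h)))) (T v) = cinner (T (C h)) v" by simp
  qed
  show "T (C (T (C h))) = C h - C (C h)" by (simp add: CT TTC)
  show "h = 0" if "C h = 0"
    using TTC[of h] TR[OF S0, of 0] that by simp
qed

text \<open>\<open>T\<close> is recovered from its quadratic form through the bounded positive square root
  \<open>T (1 + T\<^sup>2)\<^sup>-\<^sup>1\<close> of \<open>C - C\<^sup>2\<close>, where \<open>C = (1 + T\<^sup>2)\<^sup>-\<^sup>1\<close> depends only on the form.\<close>

lemma positive_selfadjoint_form_unique:
  fixes u :: "'h::complex_hilbert"
  assumes T: "positive_selfadjoint S T" and T': "positive_selfadjoint S T'"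
    and form: "\<And>u v. u \<in> S \<Longrightarrow> v \<in> S \<Longrightarrow> cinner (T u) (T v) = cinner (T' u) (T' v)"
    and u: "u \<in> S"
  shows "T u = T' u"
proof -
  have "\<exists>u\<in>S. \<forall>v\<in>S. cinner u v + cinner (T u) (T v) = cinner h v" for h
    using positive_selfadjoint_weak_solution[OF T, of h] by metis
  then obtain C where C: "\<And>h. C h \<in> S"
      "\<And>h v. v \<in> S \<Longrightarrow> cinner (C h) v + cinner (T (C h)) (T v) = cinner h v"
    by metis
  have C': "cinner (C h) v + cinner (T' (C h)) (T' v) = cinner h v" if "v \<in> S" for h v
    using C(2)[OF that] form[OF C(1) that] by simp
  note r = positive_selfadjoint_resolvent[OF T C] and r' = positive_selfadjoint_resolvent[OF T' C(1) C']
  have TC: "T (C h) = T' (C h)" for h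
    by (rule pos_selfadj_sqrt_unique) (use r(1-4) r'(1-4) in auto)
  \<comment> \<open>The operators are known to agree only on the range of C. Symmetry moves them
    onto that range, so \<open>T u - T' u\<close> is orthogonal to it; as C is symmetric and
    injective, this vector vanishes.\<close>
  have "cinner (C h) (T u - T' u) = 0" for h
    using positive_selfadjoint_sym[OF T C(1)[of h] u] positive_selfadjoint_sym[OF T' C(1)[of h] u] TC
    by (simp add: cinner_diff_right)
  then have "cinner h (C (T u - T' u)) = 0" for h using r(5) by simp
  then have "C (T u - T' u) = 0" by (intro cinner_eqI) simp
  from r(6)[OF _ this] show ?thesis by simp
qed

section \<open>Measure scaling maps\<close>

text \<open>Orientation: preimages under \<tau> have c times the measure, so composing an integrand
  with \<tau> multiplies its integral by c. The inverse belongs to the data so that integrability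
  can be pulled back as well as pushed forward.\<close>

definition scaling_map :: "'a measure \<Rightarrow> ('a \<Rightarrow> 'a) \<Rightarrow> ('a \<Rightarrow> 'a) \<Rightarrow> real \<Rightarrow> bool" where
  "scaling_map M \<tau> \<tau>' c \<longleftrightarrow> \<tau> \<in> measurable M M \<and> \<tau>' \<in> measurable M M \<and>
     (\<forall>x\<in>space M. \<tau>' (\<tau> x) = x \<and> \<tau> (\<tau>' x) = x) \<and> 0 < c \<and>
     distr M M \<tau> = density M (\<lambda>_. ennreal c)"

lemma scaling_mapD:
  assumes "scaling_map M \<tau> \<tau>' c"
  shows "\<tau> \<in> measurable M M" "\<tau>' \<in> measurable M M" "0 < c"
    "x \<in> space M \<Longrightarrow> \<tau>' (\<tau> x) = x" "x \<in> space M \<Longrightarrow> \<tau> (\<tau>' x) = x"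
    "distr M M \<tau> = density M (\<lambda>_. ennreal c)"
  using assms by (auto simp: scaling_map_def)

lemma scaling_map_emeasure:
  assumes "scaling_map M \<tau> \<tau>' c" "E \<in> sets M"
  shows "emeasure M (\<tau> -` E \<inter> space M) = ennreal c * emeasure M E"
  using arg_cong[OF scaling_mapD(6)[OF assms(1)], of "\<lambda>N. emeasure N E"] assms(2)
  by (simp add: emeasure_distr emeasure_density_const scaling_mapD(1)[OF assms(1)])

lemma scaling_mapI:
  assumes m: "\<tau> \<in> measurable M M" "\<tau>' \<in> measurable M M"
    and inv: "\<And>x. x \<in> space M \<Longrightarrow> \<tau>' (\<tau> x) = x" "\<And>x. x \<in> space M \<Longrightarrow> \<tau> (\<tau>' x) = x"
    and c: "0 < c" "\<And>E. E \<in> sets M \<Longrightarrow> emeasure M (\<tau> -` E \<inter> space M) = ennreal c * emeasure M E"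
  shows "scaling_map M \<tau> \<tau>' c"
  unfolding scaling_map_def
  using assms by (auto intro!: measure_eqI simp: emeasure_distr emeasure_density_const)

lemma scaling_map_inverse:
  assumes s: "scaling_map M \<tau> \<tau>' c"
  shows "scaling_map M \<tau>' \<tau> (1 / c)"
proof (rule scaling_mapI)
  have m: "\<tau> \<in> measurable M M" "\<tau>' \<in> measurable M M" and c: "0 < c"
    using s by (auto simp: scaling_map_def)
  fix E assume E: "E \<in> sets M"
  have "\<tau> -` (\<tau>' -` E \<inter> space M) \<inter> space M = E"
    using s sets.sets_into_space[OF E] measurable_space[OF m(1)] by (auto simp: scaling_map_def)
  then have "emeasure M E = ennreal c * emeasure M (\<tau>' -` E \<inter> space M)"
    using scaling_map_emeasure[OF s measurable_sets[OF m(2) E]] by simp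
  then have "ennreal (1 / c) * emeasure M E =
      ennreal (1 / c) * ennreal c * emeasure M (\<tau>' -` E \<inter> space M)"
    by (simp add: mult.assoc)
  then show "emeasure M (\<tau>' -` E \<inter> space M) = ennreal (1 / c) * emeasure M E"
    using c by (simp flip: ennreal_mult')
qed (use s in \<open>auto simp: scaling_map_def\<close>)

lemma scaling_map_comp:
  assumes s: "scaling_map M \<tau> \<tau>' c" and t: "scaling_map M \<upsilon> \<upsilon>' d"
  shows "scaling_map M (\<lambda>x. \<tau> (\<upsilon> x)) (\<lambda>x. \<upsilon>' (\<tau>' x)) (d * c)"
proof (rule scaling_mapI)
  have m: "\<tau> \<in> measurable M M" "\<tau>' \<in> measurable M M" "\<upsilon> \<in> measurable M M" "\<upsilon>' \<in> measurable M M"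
    and cd: "0 < c" "0 < d" using s t by (auto simp: scaling_map_def)
  show "(\<lambda>x. \<tau> (\<upsilon> x)) \<in> measurable M M" "(\<lambda>x. \<upsilon>' (\<tau>' x)) \<in> measurable M M"
    by (rule measurable_compose[OF m(3) m(1)] measurable_compose[OF m(2) m(4)])+
  show "\<upsilon>' (\<tau>' (\<tau> (\<upsilon> x))) = x" "\<tau> (\<upsilon> (\<upsilon>' (\<tau>' x))) = x" if "x \<in> space M" for x
    using s t that measurable_space[OF m(3)] measurable_space[OF m(2)] by (auto simp: scaling_map_def)
  show "0 < d * c" using cd by simp
  fix E assume E: "E \<in> sets M"
  have "(\<lambda>x. \<tau> (\<upsilon> x)) -` E \<inter> space M = \<upsilon> -` (\<tau> -` E \<inter> space M) \<inter> space M"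
    using measurable_space[OF m(3)] by auto
  then show "emeasure M ((\<lambda>x. \<tau> (\<upsilon> x)) -` E \<inter> space M) = ennreal (d * c) * emeasure M E"
    using scaling_map_emeasure[OF t measurable_sets[OF m(1) E]] scaling_map_emeasure[OF s E] cd
    by (simp add: ennreal_mult mult.assoc)
qed

lemma scaling_map_nn_integral:
  assumes s: "scaling_map M \<tau> \<tau>' c" and f: "f \<in> borel_measurable M"
  shows "(\<integral>\<^sup>+x. f (\<tau> x) \<partial>M) = ennreal c * (\<integral>\<^sup>+x. f x \<partial>M)"
proof -
  have "(\<integral>\<^sup>+x. f (\<tau> x) \<partial>M) = (\<integral>\<^sup>+x. f x \<partial>distr M M \<tau>)"
    using f by (simp add: nn_integral_distr scaling_mapD(1)[OF s])
  also have "\<dots> = (\<integral>\<^sup>+x. f x \<partial>density M (\<lambda>_. ennreal c))" by (simp add: scaling_mapD(6)[OF s])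
  also have "\<dots> = ennreal c * (\<integral>\<^sup>+x. f x \<partial>M)"
    using f by (simp add: nn_integral_density nn_integral_cmult)
  finally show ?thesis .
qed

lemma scaling_map_integrable:
  fixes f :: "'a \<Rightarrow> 'b::{banach, second_countable_topology}"
  assumes s: "scaling_map M \<tau> \<tau>' c" and f: "integrable M f"
  shows "integrable M (\<lambda>x. f (\<tau> x))"
proof (rule integrable_distr[of _ _ M])
  show "\<tau> \<in> measurable M M" using s by (simp add: scaling_map_def)
  have "integrable (density M (\<lambda>_. ennreal c)) f"
    using s f by (subst integrable_density) (auto simp: scaling_map_def)
  then show "integrable (distr M M \<tau>) f" using s by (simp add: scaling_map_def)
qed

lemma scaling_map_integrable_iff:
  fixes f :: "'a \<Rightarrow> 'b::{banach, second_countable_topology}"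
  assumes s: "scaling_map M \<tau> \<tau>' c"
  shows "integrable M (\<lambda>x. f (\<tau> x)) \<longleftrightarrow> integrable M f"
proof
  assume "integrable M (\<lambda>x. f (\<tau> x))"
  then have "integrable M (\<lambda>x. f (\<tau> (\<tau>' x)))"
    by (rule scaling_map_integrable[OF scaling_map_inverse[OF s]])
  moreover have "integrable M (\<lambda>x. f (\<tau> (\<tau>' x))) = integrable M f"
    using s by (intro Bochner_Integration.integrable_cong) (auto simp: scaling_map_def)
  ultimately show "integrable M f" by simp
qed (rule scaling_map_integrable[OF s])

text \<open>Integrability of f and of its composition with \<tau> are equivalent, so in the
  remaining case both integrals have the default value 0. The formula can thus be used on transform
  integrals whose convergence is not known.\<close>

lemma scaling_map_integral:
  fixes f :: "'a \<Rightarrow> 'b::{banach, second_countable_topology}"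
  assumes s: "scaling_map M \<tau> \<tau>' c"
  shows "(\<integral>x. f (\<tau> x) \<partial>M) = c *\<^sub>R (\<integral>x. f x \<partial>M)"
proof (cases "integrable M f")
  case True
  have "(\<integral>x. f (\<tau> x) \<partial>M) = (\<integral>x. f x \<partial>distr M M \<tau>)"
    using s True by (intro integral_distr[symmetric]) (auto simp: scaling_map_def)
  also have "\<dots> = (\<integral>x. f x \<partial>density M (\<lambda>_. ennreal c))" using s by (simp add: scaling_map_def)
  also have "\<dots> = c *\<^sub>R (\<integral>x. f x \<partial>M)"
    using True s by (subst integral_density) (auto simp: scaling_map_def)
  finally show ?thesis .
next
  case False
  then show ?thesis using scaling_map_integrable_iff[OF s, of f] by (simp add: not_integrable_integral_eq)
qed

lemma scaling_map_AE:
  assumes s: "scaling_map M \<tau> \<tau>' c" and P: "AE x in M. P x"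
  shows "AE x in M. P (\<tau> x)"
proof (rule AE_distrD[of _ _ M])
  show "\<tau> \<in> measurable M M" using s by (simp add: scaling_map_def)
  have "AE x in density M (\<lambda>_. ennreal c). P x" using P by (subst AE_density) auto
  then show "AE x in distr M M \<tau>. P x" unfolding scaling_mapD(6)[OF s] .
qed

section \<open>Square integrable functions and the almost everywhere unique choice\<close>

lemma L2_scaling:
  assumes s: "scaling_map M \<tau> \<tau>' c" and f: "f \<in> L2 M"
  shows "(\<lambda>x. a * f (\<tau> x)) \<in> L2 M"
proof -
  have [measurable]: "\<tau> \<in> measurable M M" "f \<in> borel_measurable M"
    using s f by (auto simp: scaling_map_def L2_def)
  have "integrable M (\<lambda>x. (cmod a)\<^sup>2 * (cmod (f (\<tau> x)))\<^sup>2)"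
    using scaling_map_integrable[OF s, of "\<lambda>x. (cmod (f x))\<^sup>2"] f by (simp add: L2_def)
  then show ?thesis by (simp add: L2_def norm_mult power_mult_distrib)
qed

lemma L2_tendsto_scaling:
  assumes s: "scaling_map M \<tau> \<tau>' c" and f: "L2_tendsto M fs f"
  shows "L2_tendsto M (\<lambda>k x. a * fs k (\<tau> x)) (\<lambda>x. a * f (\<tau> x))"
proof -
  have "(\<integral>x. (cmod (a * fs k (\<tau> x) - a * f (\<tau> x)))\<^sup>2 \<partial>M)
      = (cmod a)\<^sup>2 * c * (\<integral>x. (cmod (fs k x - f x))\<^sup>2 \<partial>M)" for k
    using scaling_map_integral[OF s, of "\<lambda>x. (cmod (fs k x - f x))\<^sup>2"]
    by (simp add: norm_mult power_mult_distrib flip: right_diff_distrib)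
  then have "(\<lambda>k. \<integral>x. (cmod (a * fs k (\<tau> x) - a * f (\<tau> x)))\<^sup>2 \<partial>M) \<longlonglongrightarrow> (cmod a)\<^sup>2 * c * 0"
    using f by (simp only:) (intro tendsto_mult tendsto_const, simp add: L2_tendsto_def)
  then show ?thesis using f L2_scaling[OF s] by (simp add: L2_tendsto_def)
qed

lemma L2_tendsto_cong_AE:
  assumes f: "L2_tendsto M fs f" and g: "g \<in> borel_measurable M" "AE x in M. g x = f x"
  shows "L2_tendsto M fs g"
proof -
  have [measurable]: "f \<in> borel_measurable M" "\<And>k. fs k \<in> borel_measurable M" "g \<in> borel_measurable M"
    using f g by (auto simp: L2_tendsto_def L2_def)
  have "integrable M (\<lambda>x. (cmod (g x))\<^sup>2) \<longleftrightarrow> integrable M (\<lambda>x. (cmod (f x))\<^sup>2)"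
    by (rule integrable_cong_AE) (use g(2) in auto)
  moreover have "(\<integral>x. (cmod (fs k x - g x))\<^sup>2 \<partial>M) = (\<integral>x. (cmod (fs k x - f x))\<^sup>2 \<partial>M)" for k
    by (rule integral_cong_AE) (use g(2) in auto)
  ultimately show ?thesis using f by (simp add: L2_tendsto_def L2_def)
qed

text \<open>\<open>\<Phi>\<close> and \<open>\<Psi>\<close> are mutually inverse and respect null
  sets, so solvability with uniqueness up to null sets holds for P and Q alike. If it holds, both
  sides solve Q; otherwise both are 0, whence the hypothesis \<open>zero\<close>. Equality is only
  almost everywhere because the two representatives are chosen independently.\<close>

lemma the_AE_transport:
  assumes P: "\<And>h. P h \<Longrightarrow> Q (\<Phi> h)" and Q: "\<And>h. Q h \<Longrightarrow> P (\<Psi> h)"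
    and inv: "\<And>h. \<Phi> (\<Psi> h) = h" "\<And>h. \<Psi> (\<Phi> h) = h"
    and cong: "\<And>h h'. (AE x in M. h x = h' x) \<Longrightarrow> AE x in M. \<Phi> h x = \<Phi> h' x"
      "\<And>h h'. (AE x in M. h x = h' x) \<Longrightarrow> AE x in M. \<Psi> h x = \<Psi> h' x"
    and zero: "\<Phi> (\<lambda>_. 0) = (\<lambda>_. 0)"
  shows "AE x in M. the_AE M Q x = \<Phi> (the_AE M P) x"
proof -
  define U where "U = (\<lambda>R :: ('a \<Rightarrow> complex) \<Rightarrow> bool. \<exists>h. R h \<and> (\<forall>h'. R h' \<longrightarrow> (AE x in M. h' x = h x)))"
  have PQ: "U Q" if "U P"
  proof -
    from that obtain h where h: "P h" "\<And>h'. P h' \<Longrightarrow> AE x in M. h' x = h x" by (auto simp: U_def)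
    have "AE x in M. h' x = \<Phi> h x" if "Q h'" for h'
      using cong(1)[OF h(2)[OF Q[OF that]]] by (simp add: inv)
    with P[OF h(1)] show ?thesis by (auto simp: U_def)
  qed
  have QP: "U P" if "U Q"
  proof -
    from that obtain h where h: "Q h" "\<And>h'. Q h' \<Longrightarrow> AE x in M. h' x = h x" by (auto simp: U_def)
    have "AE x in M. h' x = \<Psi> h x" if "P h'" for h'
      using cong(2)[OF h(2)[OF P[OF that]]] by (simp add: inv)
    with Q[OF h(1)] show ?thesis by (auto simp: U_def)
  qed
  have the: "R (the_AE M R)" if R: "U R" for R
  proof -
    have "the_AE M R = (SOME h. R h)" using R unfolding the_AE_def U_def by (rule if_P)
    moreover have "\<exists>h. R h" using R unfolding U_def by blast
    ultimately show ?thesis by (simp add: someI_ex)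
  qed
  show ?thesis
  proof (cases "U P")
    case True
    then have "P (the_AE M P)" by (rule the)
    moreover have "Q (the_AE M Q)" using PQ[OF True] by (rule the)
    moreover obtain h where h: "\<And>h'. Q h' \<Longrightarrow> AE x in M. h' x = h x" using PQ[OF True] by (auto simp: U_def)
    ultimately have "AE x in M. the_AE M Q x = h x" "AE x in M. \<Phi> (the_AE M P) x = h x" using P by auto
    then show ?thesis by eventually_elim simp
  next
    case False
    then have "the_AE M P = (\<lambda>_. 0)" "the_AE M Q = (\<lambda>_. 0)"
      using QP by (auto simp: the_AE_def U_def)
    then show ?thesis by (simp add: zero)
  qed
qed

lemma the_AE_measurable:
  assumes "\<And>h. P h \<Longrightarrow> h \<in> borel_measurable M"
  shows "the_AE M P \<in> borel_measurable M"
proof (cases "\<exists>h. P h \<and> (\<forall>h'. P h' \<longrightarrow> (AE x in M. h' x = h x))")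
  case True
  then have "the_AE M P = (SOME h. P h)" unfolding the_AE_def by (rule if_P)
  moreover have "\<exists>h. P h" using True by blast
  ultimately show ?thesis using assms by (simp add: someI_ex)
next
  case False
  then have "the_AE M P = (\<lambda>_. 0)" unfolding the_AE_def by (rule if_not_P)
  then show ?thesis by simp
qed

text \<open>No measurability of the density is assumed: \<open>density\<close> still yields either the indefinite
  integral or, if that is not a measure, the zero measure.\<close>

lemma AE_density_of_AE:
  assumes "AE x in M. P x"
  shows "AE x in density M w. P x"
proof -
  from assms obtain N where N: "{x \<in> space M. \<not> P x} \<subseteq> N" "emeasure M N = 0" "N \<in> sets M" by (rule AE_E)
  have "AE x in M. w x * indicator N x = 0"
    using AE_not_in[of N M] N by (auto elim!: eventually_mono simp: null_sets_def)
  then have "(\<integral>\<^sup>+x. w x * indicator N x \<partial>M) = (\<integral>\<^sup>+x. 0 \<partial>M)" by (rule nn_integral_cong_AE)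
  then have "emeasure (density M w) N = 0"
    unfolding density_def by (simp add: emeasure_measure_of_conv)
  then show ?thesis using N by (intro AE_I'[of N]) (auto simp: null_sets_def)
qed

section \<open>Lebesgue measure and linear maps\<close>

lemma translation_invariant_eq_lborel:
  fixes M :: "'a::euclidean_space measure"
  assumes M: "sigma_finite_measure M" "sets M = sets borel"
    and inv: "\<And>a A. A \<in> sets borel \<Longrightarrow> emeasure M ((\<lambda>x. x + a) -` A) = emeasure M A"
    and A: "A \<in> sets borel"
  shows "emeasure M A = emeasure M (box 0 One) * emeasure lborel A"
proof -
  interpret M: sigma_finite_measure M by fact
  interpret pair_sigma_finite M "lborel :: 'a measure" ..
  note [measurable_cong] = M(2)
  have [simp]: "space M = UNIV" using sets_eq_imp_space_eq[OF M(2)] by simp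
  define E where "E = (box 0 One :: 'a set)"
  have [measurable]: "E \<in> sets borel" "A \<in> sets borel" using A by (auto simp: E_def)
  have refl: "(\<integral>\<^sup>+y. indicator A (x - y) \<partial>lborel) = emeasure lborel A" for x
  proof -
    have "lborel = distr lborel borel (\<lambda>y. x + (-1) *\<^sub>R (y::'a))"
      using lborel_affine[of "-1" x] by (simp add: density_1)
    then have "emeasure lborel A = emeasure (distr lborel borel (\<lambda>y. x - y)) A" by simp
    also have "\<dots> = (\<integral>\<^sup>+y. indicator A y \<partial>distr lborel borel (\<lambda>y. x - y))" by simp
    also have "\<dots> = (\<integral>\<^sup>+y. indicator A (x - y) \<partial>lborel)" by (rule nn_integral_distr) auto
    finally show ?thesis by simp
  qed
  have shift: "(\<integral>\<^sup>+y. indicator E (x + y) \<partial>lborel) = 1" for x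
  proof -
    have "(\<integral>\<^sup>+y. indicator E (x + y) \<partial>lborel) = (\<integral>\<^sup>+y. indicator E y \<partial>distr lborel borel ((+) x))"
      by (rule nn_integral_distr[symmetric]) auto
    also have "\<dots> = emeasure lborel E" by (simp add: lborel_distr_plus)
    finally show ?thesis by (simp add: E_def emeasure_lborel_box_eq inner_diff_left)
  qed
  have inv': "(\<integral>\<^sup>+x. indicator A x * indicator E (x + y) \<partial>M) = (\<integral>\<^sup>+x. indicator A (x - y) * indicator E x \<partial>M)" for y
  proof -
    have "distr M M (\<lambda>x. x + y) = M" 
      by (rule measure_eqI) (simp_all add: emeasure_distr inv M(2))
    then have "(\<integral>\<^sup>+x. indicator A (x - y) * indicator E x \<partial>M)
        = (\<integral>\<^sup>+x. indicator A (x - y) * indicator E x \<partial>distr M M (\<lambda>x. x + y))" by simp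
    then show ?thesis by (simp add: nn_integral_distr)
  qed
  \<comment> \<open>Uniqueness of Haar measure by Fubini, with the unit cube E: the double integral
    of 1_A(x) 1_E(x + y) is M(A) when y is integrated first. Shifting x by y and then reflecting y
    turns the same integral into M(E) times the Lebesgue measure of A.\<close>
  have "emeasure M A = (\<integral>\<^sup>+x. indicator A x * (\<integral>\<^sup>+y. indicator E (x + y) \<partial>lborel) \<partial>M)"
    by (simp add: shift)
  also have "\<dots> = (\<integral>\<^sup>+x. (\<integral>\<^sup>+y. indicator A x * indicator E (x + y) \<partial>lborel) \<partial>M)"
    by (simp add: nn_integral_cmult)
  also have "\<dots> = (\<integral>\<^sup>+y. (\<integral>\<^sup>+x. indicator A x * indicator E (x + y) \<partial>M) \<partial>lborel)"
    by (rule Fubini'[symmetric]) measurable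
  also have "\<dots> = (\<integral>\<^sup>+y. (\<integral>\<^sup>+x. indicator A (x - y) * indicator E x \<partial>M) \<partial>lborel)" by (simp add: inv')
  also have "\<dots> = (\<integral>\<^sup>+x. (\<integral>\<^sup>+y. indicator A (x - y) * indicator E x \<partial>lborel) \<partial>M)"
    by (rule Fubini') measurable
  also have "\<dots> = (\<integral>\<^sup>+x. emeasure lborel A * indicator E x \<partial>M)"
    by (simp add: nn_integral_multc refl)
  also have "\<dots> = emeasure lborel A * emeasure M E" by (simp add: nn_integral_cmult)
  finally show ?thesis by (simp add: E_def mult.commute)
qed

text \<open>The image measure is invariant under translation by a, since this corresponds to
  translation by the preimage of a, and it is finite on bounded sets; hence it is a multiple of
  Lebesgue measure. The factor is its value on the unit cube, and it cannot be 0 because the whole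
  space has nonzero measure.\<close>

lemma lborel_linear_image:
  fixes T :: "'a::euclidean_space \<Rightarrow> 'a"
  assumes T: "linear T" "bij T"
  obtains k where "0 < k" "distr lborel borel T = density lborel (\<lambda>_. ennreal k)"
proof -
  define T' where "T' = inv_into UNIV T"
  have TT: "T (T' x) = x" "T' (T x) = x" for x
    using T(2) by (auto simp: T'_def bij_def surj_f_inv_f inv_f_f)
  have T': "linear T'"
  proof (rule linearI)
    fix x y :: 'a and r :: real
    have "T' (x + y) = T' (T (T' x + T' y))" by (simp only: linear_add[OF T(1)] TT)
    then show "T' (x + y) = T' x + T' y" by (simp only: TT)
    have "T' (r *\<^sub>R x) = T' (T (r *\<^sub>R T' x))" by (simp only: linear_scale[OF T(1)] TT)
    then show "T' (r *\<^sub>R x) = r *\<^sub>R T' x" by (simp only: TT)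
  qed
  have bl: "bounded_linear T" "bounded_linear T'"
    using T(1) T' by (simp_all add: linear_conv_bounded_linear)
  have [measurable]: "T \<in> borel_measurable borel" "T' \<in> borel_measurable borel"
    using bl by (auto intro!: borel_measurable_continuous_onI linear_continuous_on)
  define M where "M = distr lborel borel T"
  have sM: "sets M = sets borel" by (simp add: M_def)
  have emM: "emeasure M A = emeasure lborel (T -` A)" if "A \<in> sets borel" for A
    using that by (simp add: M_def emeasure_distr)
  have fin: "emeasure M B < \<infinity>" if "bounded B" "B \<in> sets borel" for B
  proof -
    have "T -` B = T' ` B" by (auto simp: TT image_iff) (metis TT(2))
    then show ?thesis using emM[OF that(2)] bounded_linear_image[OF that(1) bl(2)]
      emeasure_bounded_finite[of "T' ` B"] by simp
  qed
  have sf: "sigma_finite_measure M"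
  proof
    show "\<exists>A. countable A \<and> A \<subseteq> sets M \<and> \<Union>A = space M \<and> (\<forall>a\<in>A. emeasure M a \<noteq> \<infinity>)"
    proof (intro exI[of _ "range (\<lambda>n::nat. cball 0 (real n))"] conjI ballI)
      show "\<Union> (range (\<lambda>n::nat. cball 0 (real n))) = space M"
        using real_arch_simple by (auto simp: M_def)
    qed (use fin[OF bounded_cball] sM in \<open>auto simp: less_top[symmetric]\<close>)
  qed
  have inv: "emeasure M ((\<lambda>x. x + a) -` A) = emeasure M A" if A: "A \<in> sets borel" for a A
  proof -
    have "T -` ((\<lambda>x. x + a) -` A) = (\<lambda>x. T' a + x) -` (T -` A)"
      using T(1) by (auto simp: linear_add TT add.commute)
    then have "emeasure M ((\<lambda>x. x + a) -` A) = emeasure (distr lborel borel ((+) (T' a))) (T -` A)"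
      using A measurable_sets[of "\<lambda>x. x + a" borel borel A] measurable_sets[of T borel borel A]
      by (simp add: emM emeasure_distr)
    also have "\<dots> = emeasure M A" using A by (simp add: lborel_distr_plus emM)
    finally show ?thesis .
  qed
  define k where "k = measure M (box 0 One)"
  have k: "emeasure M (box 0 One) = ennreal k"
    unfolding k_def using fin[of "box 0 One"] by (intro emeasure_eq_ennreal_measure) (auto simp: less_top)
  have eq: "emeasure M A = ennreal k * emeasure lborel A" if "A \<in> sets borel" for A
    using translation_invariant_eq_lborel[OF sf sM inv that] k by simp
  have "0 < k"
  proof (rule ccontr)
    assume "\<not> 0 < k"
    then have "k = 0" using measure_nonneg[of M] by (simp add: k_def less_le)
    then have "emeasure M UNIV = 0" using eq[of UNIV] by simp
    then show False using emM[of UNIV] by simp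
  qed
  moreover have "distr lborel borel T = density lborel (\<lambda>_. ennreal k)"
    by (rule measure_eqI) (use eq in \<open>auto simp: M_def emeasure_density_const\<close>)
  ultimately show thesis by (rule that)
qed

text \<open>An enumeration v of the standard basis identifies the product measure with Lebesgue
  measure. The linear map sending \<open>v i\<close> to \<open>b i\<close> then reduces the claim to
  the image of Lebesgue measure under a bijection.\<close>

lemma basis_lebesgue_eq_lborel:
  fixes b :: "nat \<Rightarrow> 'v::euclidean_space"
  assumes b: "basis_family d b"
  obtains k where "0 < k" "basis_lebesgue d b = density lborel (\<lambda>_. ennreal k)"
proof -
  have bb: "inj_on b {..<d}" "independent (b ` {..<d})" "span (b ` {..<d}) = UNIV"
    using b by (auto simp: basis_family_def)
  have "card (b ` {..<d}) = DIM('v)" using basis_card_eq_dim[of "b ` {..<d}" UNIV] bb by simp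
  then have d: "d = DIM('v)" using card_image[OF bb(1)] by simp
  then obtain v where v: "bij_betw v {..<d} (Basis :: 'v set)"
    using finite_same_card_bij[of "{..<d}" "Basis :: 'v set"] by auto
  have vB: "v i \<in> Basis" if "i < d" for i
    using v that by (auto simp: bij_betw_def)
  have vinner: "v i \<bullet> v j = (if i = j then 1 else 0)" if "i < d" "j < d" for i j
    using vB that bij_betw_imp_inj_on[OF v] by (auto simp: inner_Basis inj_on_def)
  interpret product_sigma_finite "\<lambda>i::nat. lborel :: real measure" ..
  let ?P = "\<Pi>\<^sub>M i\<in>{..<d}. lborel :: real measure"
  let ?s = "\<lambda>c. \<Sum>i<d. c i *\<^sub>R v i"
  have sinner: "?s c \<bullet> v j = c j" if "j < d" for c j
    using that by (simp add: inner_sum_left vinner if_distrib cong: if_cong)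
  have s_m [measurable]: "?s \<in> borel_measurable ?P" by measurable
  have lb: "lborel = distr ?P borel ?s"
  proof (rule lborel_eqI)
    fix l u :: 'v assume lu: "\<And>b. b \<in> Basis \<Longrightarrow> l \<bullet> b \<le> u \<bullet> b"
    have "?s -` box l u \<inter> space ?P = (\<Pi>\<^sub>E i\<in>{..<d}. {l \<bullet> v i <..< u \<bullet> v i})"
    proof -
      have "x \<in> box l u \<longleftrightarrow> (\<forall>i<d. l \<bullet> v i < x \<bullet> v i \<and> x \<bullet> v i < u \<bullet> v i)" for x
        unfolding mem_box bij_betw_imp_surj_on[OF v, symmetric] by auto
      then show ?thesis by (auto simp: space_PiM sinner PiE_iff)
    qed
    then have "emeasure (distr ?P borel ?s) (box l u) = (\<Prod>i<d. emeasure lborel {l \<bullet> v i <..< u \<bullet> v i})"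
      by (simp add: emeasure_distr emeasure_PiM)
    also have "\<dots> = (\<Prod>i<d. ennreal ((u - l) \<bullet> v i))"
      using lu vB by (intro prod.cong) (auto simp: inner_diff_left)
    also have "\<dots> = (\<Prod>b\<in>Basis. ennreal ((u - l) \<bullet> b))"
      by (rule prod.reindex_bij_betw[OF v])
    also have "\<dots> = ennreal (\<Prod>b\<in>Basis. (u - l) \<bullet> b)"
      using lu by (intro prod_ennreal) (auto simp: inner_diff_left)
    finally show "emeasure (distr ?P borel ?s) (box l u) = ennreal (\<Prod>b\<in>Basis. (u - l) \<bullet> b)" .
  qed simp
  define T where "T = (\<lambda>x. \<Sum>i<d. (x \<bullet> v i) *\<^sub>R b i)"
  have linT: "linear T" unfolding T_def
    by (rule linearI) (simp_all add: inner_add_left scaleR_add_left sum.distrib scaleR_sum_right)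
  have "UNIV \<subseteq> range T"
  proof -
    have "b i \<in> range T" if "i < d" for i
    proof -
      have "T (v i) = b i" using that by (simp add: T_def vinner if_distrib[of "\<lambda>a. a *\<^sub>R _"] cong: if_cong)
      then show ?thesis by (metis rangeI)
    qed
    then have "span (b ` {..<d}) \<subseteq> range T"
      using linear_subspace_image[OF linT subspace_UNIV] by (intro span_minimal) auto
    then show ?thesis using bb by simp
  qed
  then have "surj T" by auto
  then have "bij T" using linear_surjective_imp_injective[OF linT] by (simp add: bij_def)
  then obtain k where k: "0 < k" "distr lborel borel T = density lborel (\<lambda>_. ennreal k)"
    using lborel_linear_image[OF linT] by blast
  have [measurable]: "T \<in> borel_measurable borel"
    unfolding T_def by measurable
  have "T (?s c) = (\<Sum>i<d. c i *\<^sub>R b i)" for c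
    unfolding T_def by (intro sum.cong refl) (simp add: sinner)
  then have "distr lborel borel T = basis_lebesgue d b"
    by (subst lb) (simp add: distr_distr basis_lebesgue_def o_def)
  with k show thesis by (intro that) auto
qed

text \<open>The density of the basis measure is a constant and cancels. The factor c stays
  anonymous: the maps \<open>Ad x\<close> are applied below to null sets and to convergence to 0,
  which are insensitive to it.\<close>

lemma basis_lebesgue_linear_scaling:
  fixes b :: "nat \<Rightarrow> 'v::euclidean_space"
  assumes b: "basis_family d b" and L: "linear L" "linear L'" "\<And>x. L' (L x) = x" "\<And>x. L (L' x) = x"
  obtains c where "scaling_map (basis_lebesgue d b) L L' c"
proof -
  obtain k where k: "0 < k" "basis_lebesgue d b = density lborel (\<lambda>_. ennreal k)"
    using basis_lebesgue_eq_lborel[OF b] .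
  have "bij L" using L(3,4) by (metis bijI')
  then obtain c where c: "0 < c" "distr lborel borel L = density lborel (\<lambda>_. ennreal c)"
    using lborel_linear_image[OF L(1)] by blast
  have [measurable]: "L \<in> borel_measurable borel" "L' \<in> borel_measurable borel"
    using L by (auto intro!: borel_measurable_continuous_onI linear_continuous_on simp: linear_conv_bounded_linear)
  have em: "emeasure (basis_lebesgue d b) E = ennreal k * emeasure lborel E" if "E \<in> sets borel" for E
    using that by (simp add: k emeasure_density_const)
  have m: "measurable (basis_lebesgue d b) (basis_lebesgue d b) = measurable borel borel"
    by (rule measurable_cong_sets) (simp_all add: k)
  have sp: "space (basis_lebesgue d b) = UNIV" "sets (basis_lebesgue d b) = sets borel" by (simp_all add: k)
  have "scaling_map (basis_lebesgue d b) L L' c"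
  proof (rule scaling_mapI)
    fix E assume "E \<in> sets (basis_lebesgue d b)"
    then have E: "E \<in> sets borel" by (simp add: sp)
    then have "emeasure lborel (L -` E) = ennreal c * emeasure lborel E"
      using arg_cong[OF c(2), of "\<lambda>M. emeasure M E"] by (simp add: emeasure_distr emeasure_density_const)
    moreover have "L -` E \<in> sets borel" using measurable_sets[of L borel borel E] E by simp
    ultimately show "emeasure (basis_lebesgue d b) (L -` E \<inter> space (basis_lebesgue d b)) =
        ennreal c * emeasure (basis_lebesgue d b) E"
      using E by (simp add: em sp mult.left_commute)
  qed (use L c in \<open>auto simp: m\<close>)
  then show thesis by (rule that)
qed

section \<open>Exponential Lie groups in the global chart\<close>

text \<open>Steps of the form 1 / (k + 1) serve two purposes below: they are compatible with integer
  multiples, and they exhibit derivatives as limits of sequences, which preserves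
  measurability.\<close>

lemma has_vector_derivative_sequentially:
  fixes g :: "real \<Rightarrow> 'a::real_normed_vector"
  assumes "(g has_vector_derivative D) (at 0)"
  shows "(\<lambda>k. real (Suc k) *\<^sub>R (g (1 / real (Suc k)) - g 0)) \<longlonglongrightarrow> D"
proof -
  define h where "h = (\<lambda>k. 1 / real (Suc k))"
  have "((\<lambda>t. norm (g (0 + t) - g 0 - t *\<^sub>R D) / norm t) \<longlongrightarrow> 0) (at 0)"
    using assms by (simp add: has_vector_derivative_def has_derivative_at)
  moreover have "filterlim h (at 0) sequentially"
    using LIMSEQ_inverse_real_of_nat by (auto simp: filterlim_at h_def inverse_eq_divide)
  ultimately have "(\<lambda>k. norm (g (0 + h k) - g 0 - h k *\<^sub>R D) / norm (h k)) \<longlonglongrightarrow> 0"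
    by (rule filterlim_compose)
  moreover have "norm (g (0 + h k) - g 0 - h k *\<^sub>R D) / norm (h k) =
      norm (real (Suc k) *\<^sub>R (g (h k) - g 0) - D)" for k
  proof -
    have "real (Suc k) *\<^sub>R (g (h k) - g 0) - D = real (Suc k) *\<^sub>R (g (h k) - g 0 - h k *\<^sub>R D)"
      by (simp add: h_def scaleR_diff_right)
    then show ?thesis by (simp add: h_def mult.commute)
  qed
  ultimately have "(\<lambda>k. real (Suc k) *\<^sub>R (g (h k) - g 0) - D) \<longlonglongrightarrow> 0"
    by (simp only: tendsto_norm_zero_iff)
  then show ?thesis unfolding h_def by (rule LIM_zero_cancel)
qed

context exponential_lie_group
begin

lemma Exp_closed [simp]: "Exp X \<in> carrier G"
  using bij_Exp by (auto simp: bij_betw_def)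

lemma log_Exp [simp]: "lie_log Exp (Exp X) = X"
  using bij_Exp by (simp add: lie_log_def bij_betw_def the_inv_into_f_f)

lemma Exp_log [simp]: "x \<in> carrier G \<Longrightarrow> Exp (lie_log Exp x) = x"
  using bij_Exp by (auto simp: lie_log_def bij_betw_def intro!: f_the_inv_into_f)

lemma Exp_inject: "Exp X = Exp Y \<Longrightarrow> X = Y"
  by (metis log_Exp)

lemma Exp_zero: "Exp 0 = \<one>"
proof -
  have "Exp 0 \<otimes> Exp 0 = Exp 0" using one_parameter[of 0 0 0] by simp
  then show ?thesis using l_cancel_one'[of "Exp 0" "Exp 0"] by simp
qed

lemma Exp_uminus: "Exp (- X) = inv Exp X"
proof -
  have "Exp X \<otimes> Exp (- X) = \<one>" using one_parameter[of 1 "-1" X] by (simp add: Exp_zero)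
  then show ?thesis using inv_equality inv_inv Exp_closed inv_comm by metis
qed

text \<open>The group law in exponential coordinates, that is, the Baker-Campbell-Hausdorff product,
  here globally defined.\<close>

definition chart_mult :: "real^'n \<Rightarrow> real^'n \<Rightarrow> real^'n" where
  "chart_mult X Y = lie_log Exp (Exp X \<otimes> Exp Y)"

lemma chart_mult_differentiable: "(\<lambda>p. chart_mult (fst p) (snd p)) differentiable (at q)"
proof -
  have "times_differentiable (Suc 0) (\<lambda>(X, Y). lie_log Exp (Exp X \<otimes> Exp Y))"
    using smooth_mult unfolding smooth_map_def by blast
  then show ?thesis by (cases q) (simp add: chart_mult_def case_prod_beta')
qed

lemma chart_mult_continuous: "continuous_on UNIV (\<lambda>p. chart_mult (fst p) (snd p))"
  using chart_mult_differentiable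
  by (intro continuous_at_imp_continuous_on ballI differentiable_imp_continuous_within) auto

lemma continuous_on_chart_mult [continuous_intros]:
  assumes "continuous_on S f" "continuous_on S g"
  shows "continuous_on S (\<lambda>x. chart_mult (f x) (g x))"
  using continuous_on_compose2[OF chart_mult_continuous continuous_on_Pair[OF assms]] by simp

lemma differentiable_chart_mult:
  assumes "f differentiable (at x)" "g differentiable (at x)"
  shows "(\<lambda>x. chart_mult (f x) (g x)) differentiable (at x)"
proof -
  have "(\<lambda>x. (f x, g x)) differentiable (at x)"
    using assms unfolding differentiable_def by (blast intro: has_derivative_Pair)
  from differentiable_chain_at[OF this chart_mult_differentiable]
  show ?thesis by (simp add: o_def)
qed

section \<open>Conjugation and the adjoint action in the chart\<close>

definition chart_conj :: "'g \<Rightarrow> real^'n \<Rightarrow> real^'n" where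
  "chart_conj x Y = lie_log Exp (x \<otimes> Exp Y \<otimes> inv x)"

lemma chart_conj_Exp: "chart_conj (Exp X) Y = chart_mult (chart_mult X Y) (- X)"
  by (simp add: chart_conj_def chart_mult_def Exp_uminus)

lemma Exp_chart_conj: "x \<in> carrier G \<Longrightarrow> Exp (chart_conj x Y) = x \<otimes> Exp Y \<otimes> inv x"
  by (simp add: chart_conj_def)

lemma conj_mult:
  assumes "x \<in> carrier G" "y \<in> carrier G" "z \<in> carrier G"
  shows "x \<otimes> (y \<otimes> z) \<otimes> inv x = (x \<otimes> y \<otimes> inv x) \<otimes> (x \<otimes> z \<otimes> inv x)"
proof -
  have "(x \<otimes> y \<otimes> inv x) \<otimes> (x \<otimes> z \<otimes> inv x) = x \<otimes> y \<otimes> ((inv x \<otimes> x) \<otimes> (z \<otimes> inv x))"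
    using assms by (simp only: m_assoc m_closed inv_closed)
  then show ?thesis using assms by (simp add: m_assoc)
qed

text \<open>Conjugation is a homomorphism and maps the one-parameter group of \<open>Y\<close> to
  that of \<open>chart_conj x Y\<close>. Natural multiples are enough to compare a difference
  quotient with the map itself.\<close>

lemma chart_conj_of_nat_scaleR:
  assumes x: "x \<in> carrier G"
  shows "chart_conj x (real k *\<^sub>R Y) = real k *\<^sub>R chart_conj x Y"
proof (rule Exp_inject, induction k)
  case 0
  then show ?case using x by (simp add: Exp_chart_conj Exp_zero)
next
  case (Suc k)
  have "Exp (chart_conj x (real (Suc k) *\<^sub>R Y)) = x \<otimes> (Exp (real k *\<^sub>R Y) \<otimes> Exp Y) \<otimes> inv x"
    using one_parameter[of "real k" 1 Y] x by (simp add: Exp_chart_conj add.commute)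
  also have "\<dots> = Exp (chart_conj x (real k *\<^sub>R Y)) \<otimes> Exp (chart_conj x Y)"
    using x by (simp add: conj_mult Exp_chart_conj)
  also have "\<dots> = Exp (real k *\<^sub>R chart_conj x Y) \<otimes> Exp (1 *\<^sub>R chart_conj x Y)"
    by (simp add: Suc)
  also have "\<dots> = Exp (real (Suc k) *\<^sub>R chart_conj x Y)"
    unfolding one_parameter[symmetric] by (simp add: add.commute)
  finally show ?case .
qed

text \<open>Since \<open>k \<cdot> conj (Y / k) = conj Y\<close>, conjugation coincides in the chart with its derivative
  at \<open>0\<close>.\<close>

lemma linear_chart_conj:
  assumes x: "x \<in> carrier G"
  shows "linear (chart_conj x)"
proof -
  obtain X where X: "x = Exp X" using x by (metis Exp_log)
  have "chart_conj x differentiable (at 0)"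
    unfolding X chart_conj_Exp by (intro differentiable_chart_mult) auto
  then obtain D where D: "(chart_conj x has_derivative D) (at 0)" by (auto simp: differentiable_def)
  then have bl: "bounded_linear D" by (rule has_derivative_bounded_linear)
  then interpret D: bounded_linear D .
  have z: "chart_conj x 0 = 0" using chart_conj_of_nat_scaleR[OF x, of 0 0] by simp
  have "chart_conj x Y = D Y" for Y
  proof -
    have "((\<lambda>t. t *\<^sub>R Y) has_derivative (\<lambda>t. t *\<^sub>R Y)) (at (0::real))" by (auto intro!: derivative_eq_intros)
    then have "((\<lambda>t. chart_conj x (t *\<^sub>R Y)) has_derivative (\<lambda>t. D (t *\<^sub>R Y))) (at (0::real))"
      by (rule has_derivative_compose) (use D in simp)
    then have "((\<lambda>t. chart_conj x (t *\<^sub>R Y)) has_vector_derivative D Y) (at 0)"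
      by (simp add: has_vector_derivative_def D.scaleR)
    from has_vector_derivative_sequentially[OF this]
    have "(\<lambda>k. real (Suc k) *\<^sub>R chart_conj x ((1 / real (Suc k)) *\<^sub>R Y)) \<longlonglongrightarrow> D Y"
      by (simp add: z)
    moreover have "real (Suc k) *\<^sub>R chart_conj x ((1 / real (Suc k)) *\<^sub>R Y) = chart_conj x Y" for k
      using chart_conj_of_nat_scaleR[OF x, of "Suc k" "(1 / real (Suc k)) *\<^sub>R Y"] by simp
    ultimately show ?thesis by (simp add: LIMSEQ_const_iff)
  qed
  then have "chart_conj x = D" by (rule ext)
  then show ?thesis using bl by (simp add: linear_conv_bounded_linear)
qed

abbreviation Ad :: "'g \<Rightarrow> real^'n \<Rightarrow> real^'n" where "Ad \<equiv> lie_Ad G Exp"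

abbreviation ad :: "real^'n \<Rightarrow> real^'n \<Rightarrow> real^'n" where "ad \<equiv> lie_bracket G Exp"

text \<open>The curve being differentiated is linear in t, so its derivative at 0 is its value at t
  = 1.\<close>

lemma Ad_eq_chart_conj: "x \<in> carrier G \<Longrightarrow> Ad x = chart_conj x"
proof
  fix Y assume x: "x \<in> carrier G"
  have "((\<lambda>t. t *\<^sub>R chart_conj x Y) has_vector_derivative chart_conj x Y) (at 0)"
    by (auto intro!: derivative_eq_intros)
  then have "((\<lambda>t. chart_conj x (t *\<^sub>R Y)) has_vector_derivative chart_conj x Y) (at 0)"
    by (simp add: linear_scale[OF linear_chart_conj[OF x]])
  then show "Ad x Y = chart_conj x Y"
    unfolding lie_Ad_def chart_conj_def by (rule vector_derivative_at)
qed

lemma linear_Ad: "x \<in> carrier G \<Longrightarrow> linear (Ad x)"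
  by (simp add: Ad_eq_chart_conj linear_chart_conj)

lemma bounded_linear_Ad: "x \<in> carrier G \<Longrightarrow> bounded_linear (Ad x)"
  using linear_Ad by (simp add: linear_conv_bounded_linear)

lemma Exp_Ad: "x \<in> carrier G \<Longrightarrow> Exp (Ad x Y) = x \<otimes> Exp Y \<otimes> inv x"
  by (simp add: Ad_eq_chart_conj Exp_chart_conj)

lemma log_conj: "x \<in> carrier G \<Longrightarrow> z \<in> carrier G \<Longrightarrow> lie_log Exp (x \<otimes> z \<otimes> inv x) = Ad x (lie_log Exp z)"
  by (simp add: Ad_eq_chart_conj chart_conj_def)

lemma Ad_mult:
  assumes "x \<in> carrier G" "y \<in> carrier G"
  shows "Ad (x \<otimes> y) Y = Ad x (Ad y Y)"
  by (rule Exp_inject) (use assms in \<open>simp add: Exp_Ad m_assoc inv_mult_group\<close>)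

lemma Ad_one: "Ad \<one> Y = Y"
  by (rule Exp_inject) (simp add: Exp_Ad)

lemma Ad_inv: "x \<in> carrier G \<Longrightarrow> Ad (inv x) (Ad x Y) = Y" "x \<in> carrier G \<Longrightarrow> Ad x (Ad (inv x) Y) = Y"
  by (simp_all add: Ad_mult[symmetric] Ad_one)

lemma ad_has_vector_derivative:
  "((\<lambda>s. Ad (Exp (s *\<^sub>R X)) Y) has_vector_derivative ad X Y) (at 0)"
proof -
  have "(\<lambda>s. chart_mult (chart_mult (s *\<^sub>R X) Y) (- (s *\<^sub>R X))) differentiable (at (0::real))"
    by (intro differentiable_chart_mult derivative_intros)
  then have "(\<lambda>s. Ad (Exp (s *\<^sub>R X)) Y) differentiable (at 0)"
    by (simp add: Ad_eq_chart_conj chart_conj_Exp)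
  then show ?thesis unfolding lie_bracket_def by (simp add: vector_derivative_works)
qed

lemma adI: "((\<lambda>s. Ad (Exp (s *\<^sub>R X)) Y) has_vector_derivative D) (at 0) \<Longrightarrow> ad X Y = D"
  unfolding lie_bracket_def by (rule vector_derivative_at)

lemma linear_ad: "linear (ad X)"
proof (rule linearI)
  fix Y Z :: "real^'n" and c :: real
  show "ad X (Y + Z) = ad X Y + ad X Z"
    by (rule adI) (simp add: linear_add[OF linear_Ad] has_vector_derivative_add ad_has_vector_derivative)
  have "((\<lambda>s. c *\<^sub>R Ad (Exp (s *\<^sub>R X)) Y) has_vector_derivative c *\<^sub>R ad X Y) (at 0)"
    by (rule bounded_linear.has_vector_derivative[OF bounded_linear_scaleR_right ad_has_vector_derivative])
  then show "ad X (c *\<^sub>R Y) = c *\<^sub>R ad X Y"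
    by (intro adI) (simp add: linear_scale[OF linear_Ad])
qed

text \<open>\<open>Ad x\<close> is an automorphism of the Lie algebra: differentiate the action of
  both sides of Exp(s Ad_x X) x = x Exp(s X) at s = 0.\<close>

lemma Ad_ad: 
  assumes x: "x \<in> carrier G"
  shows "ad (Ad x X) (Ad x Y) = Ad x (ad X Y)"
proof (rule adI)
  have "Ad (Exp (s *\<^sub>R Ad x X)) (Ad x Y) = Ad x (Ad (Exp (s *\<^sub>R X)) Y)" for s
  proof -
    have "Exp (s *\<^sub>R Ad x X) \<otimes> x = x \<otimes> Exp (s *\<^sub>R X)"
      using x by (simp add: linear_scale[OF linear_Ad, symmetric] Exp_Ad m_assoc)
    then show ?thesis using x by (simp add: Ad_mult[symmetric])
  qed
  then show "((\<lambda>s. Ad (Exp (s *\<^sub>R Ad x X)) (Ad x Y)) has_vector_derivative Ad x (ad X Y)) (at 0)"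
    using bounded_linear.has_vector_derivative[OF bounded_linear_Ad[OF x] ad_has_vector_derivative] by simp
qed

text \<open>The difference quotients with step 1 / (k + 1) are continuous in \<open>X\<close>, being
  built from the continuous chart multiplication, and converge pointwise.\<close>

lemma borel_measurable_ad: "(\<lambda>X. ad X Y) \<in> borel_measurable borel"
proof (rule borel_measurable_LIMSEQ_metric)
  fix X :: "real^'n"
  have "(\<lambda>k. real (Suc k) *\<^sub>R (Ad (Exp ((1 / real (Suc k)) *\<^sub>R X)) Y - Ad (Exp (0 *\<^sub>R X)) Y)) \<longlonglongrightarrow> ad X Y"
    by (rule has_vector_derivative_sequentially[OF ad_has_vector_derivative])
  then show "(\<lambda>k. real (Suc k) *\<^sub>R (Ad (Exp ((1 / real (Suc k)) *\<^sub>R X)) Y - Y)) \<longlonglongrightarrow> ad X Y"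
    by (simp add: Exp_zero Ad_one)
next
  fix k
  show "(\<lambda>X. real (Suc k) *\<^sub>R (Ad (Exp ((1 / real (Suc k)) *\<^sub>R X)) Y - Y)) \<in> borel_measurable borel"
    by (intro borel_measurable_continuous_onI) (auto simp: Ad_eq_chart_conj chart_conj_Exp intro!: continuous_intros)
qed

text \<open>In \<open>ad X w\<close> both arguments vary with \<open>X\<close>. Expanding w in the
  standard basis separates them into scalar coefficients and brackets with fixed vectors.\<close>

lemma borel_measurable_ad_power: "(\<lambda>X. (ad X ^^ k) V) \<in> borel_measurable borel"
proof (induction k)
  case (Suc k)
  have ad: "ad X w = (\<Sum>b\<in>Basis. (w \<bullet> b) *\<^sub>R ad X b)" for X w
    using linear_sum[OF linear_ad, of X "\<lambda>b. (w \<bullet> b) *\<^sub>R b" Basis]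
    by (simp add: euclidean_representation linear_scale[OF linear_ad])
  have "(\<lambda>X. (ad X ^^ Suc k) V) = (\<lambda>X. \<Sum>b\<in>Basis. ((ad X ^^ k) V \<bullet> b) *\<^sub>R ad X b)"
    unfolding funpow.simps o_apply by (intro ext ad)
  also have "\<dots> \<in> borel_measurable borel"
    by (intro borel_measurable_sum borel_measurable_scaleR borel_measurable_inner Suc.IH
        borel_measurable_ad borel_measurable_const)
  finally show ?case .
qed simp

section \<open>The power series behind the density of Haar measure\<close>

definition ad_series :: "real^'n \<Rightarrow> real^'n \<Rightarrow> real^'n" where
  "ad_series X V = (\<Sum>k. (1 / fact (Suc k)) *\<^sub>R ((ad X ^^ k) V))"

lemma Theta_eq: "lie_Theta G Exp X = \<bar>det (matrix (ad_series X))\<bar>"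
  by (simp only: lie_Theta_def ad_series_def[abs_def])

lemma linear_ad_power: "linear (ad X ^^ k)"
  proof (induction k)
  case (Suc k)
  then show ?case unfolding funpow.simps by (rule linear_compose[OF _ linear_ad])
qed (simp add: linear_ident id_def)

lemma summable_ad_series: "summable (\<lambda>k. (1 / fact (Suc k)) *\<^sub>R ((ad X ^^ k) V))"
proof -
  have "bounded_linear (ad X)" using linear_ad by (simp add: linear_conv_bounded_linear)
  then obtain B where B: "0 < B" "\<And>v. norm (ad X v) \<le> norm v * B"
    using bounded_linear.pos_bounded by blast
  have "norm ((ad X ^^ k) V) \<le> norm V * B ^ k" for k
  proof (induction k)
    case (Suc k)
    have "norm ((ad X ^^ Suc k) V) \<le> norm ((ad X ^^ k) V) * B" using B(2) by simp
    also have "\<dots> \<le> norm V * B ^ k * B" using Suc B(1) by (intro mult_right_mono) auto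
    finally show ?case by (simp add: mult_ac)
  qed simp
  then have le: "norm ((1 / fact (Suc k)) *\<^sub>R ((ad X ^^ k) V)) \<le> norm V * (inverse (fact k) * B ^ k)" for k
  proof -
    have "norm ((1 / fact (Suc k)) *\<^sub>R ((ad X ^^ k) V)) \<le> (1 / fact (Suc k)) * (norm V * B ^ k)"
      using \<open>norm ((ad X ^^ k) V) \<le> norm V * B ^ k\<close> by (simp add: divide_right_mono)
    also have "\<dots> \<le> (1 / fact k) * (norm V * B ^ k)"
      using B(1) by (intro mult_right_mono divide_left_mono fact_mono) auto
    finally show ?thesis by (simp add: divide_simps)
  qed
  have "summable (\<lambda>k. norm V * (inverse (fact k) * B ^ k))"
    by (intro summable_mult summable_exp)
  then show ?thesis by (rule summable_comparison_test') (rule le)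
qed

lemma linear_ad_series: "linear (ad_series X)"
proof (rule linearI)
  fix V W :: "real^'n" and c :: real
  show "ad_series X (V + W) = ad_series X V + ad_series X W"
    unfolding ad_series_def using suminf_add[OF summable_ad_series summable_ad_series]
    by (simp add: linear_add[OF linear_ad_power] scaleR_add_right)
  show "ad_series X (c *\<^sub>R V) = c *\<^sub>R ad_series X V"
    unfolding ad_series_def using suminf_scaleR_right[OF summable_ad_series, of c]
    by (simp add: linear_scale[OF linear_ad_power] mult.commute)
qed

lemma ad_series_Ad:
  assumes x: "x \<in> carrier G"
  shows "ad_series (Ad x X) = Ad x \<circ> ad_series X \<circ> Ad (inv x)"
proof
  fix V
  have "ad (Ad x X) W = Ad x (ad X (Ad (inv x) W))" for W
    using Ad_ad[OF x, of X "Ad (inv x) W"] x by (simp add: Ad_inv)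
  then have "(ad (Ad x X) ^^ k) V = Ad x ((ad X ^^ k) (Ad (inv x) V))" for k
    using x by (induction k) (simp_all add: Ad_inv)
  then have "ad_series (Ad x X) V = (\<Sum>k. Ad x ((1 / fact (Suc k)) *\<^sub>R ((ad X ^^ k) (Ad (inv x) V))))"
    using x by (simp add: ad_series_def linear_scale[OF linear_Ad])
  also have "\<dots> = Ad x (ad_series X (Ad (inv x) V))"
    unfolding ad_series_def by (rule bounded_linear.suminf[OF bounded_linear_Ad[OF x] summable_ad_series, symmetric])
  finally show "ad_series (Ad x X) V = (Ad x \<circ> ad_series X \<circ> Ad (inv x)) V" by simp
qed

text \<open>The series at \<open>Ad x X\<close> is the series at \<open>X\<close> conjugated by
  \<open>Ad x\<close>, and the determinants of \<open>Ad x\<close> and \<open>Ad (inv x)\<close>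
  cancel.\<close>

lemma Theta_Ad:
  assumes x: "x \<in> carrier G"
  shows "lie_Theta G Exp (Ad x X) = lie_Theta G Exp X"
proof -
  have i: "inv x \<in> carrier G" using x by simp
  have "matrix (Ad x) ** matrix (Ad (inv x)) = mat 1"
    using matrix_compose[OF linear_Ad[OF i] linear_Ad[OF x]] x
    by (simp add: o_def Ad_inv matrix_id_mat_1[unfolded id_def])
  then have "det (matrix (Ad x)) * det (matrix (Ad (inv x))) = 1"
    by (metis det_mul det_I)
  moreover have "matrix (ad_series (Ad x X)) = matrix (Ad x) ** matrix (ad_series X) ** matrix (Ad (inv x))"
    unfolding ad_series_Ad[OF x] using linear_Ad[OF i] linear_Ad[OF x] linear_ad_series
    by (simp add: matrix_compose linear_compose)
  then have "det (matrix (ad_series (Ad x X))) =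
      det (matrix (ad_series X)) * (det (matrix (Ad x)) * det (matrix (Ad (inv x))))"
    by (simp add: det_mul)
  ultimately show ?thesis by (simp add: Theta_eq)
qed

lemma borel_measurable_Theta: "lie_Theta G Exp \<in> borel_measurable borel"
proof -
  have "(\<lambda>X. ad_series X V) \<in> borel_measurable borel" for V
  proof (rule borel_measurable_LIMSEQ_metric)
    show "(\<lambda>N. \<Sum>k<N. (1 / fact (Suc k)) *\<^sub>R ((ad X ^^ k) V)) \<longlonglongrightarrow> ad_series X V" for X
      unfolding ad_series_def by (rule summable_LIMSEQ[OF summable_ad_series])
    show "(\<lambda>X. \<Sum>k<N. (1 / fact (Suc k)) *\<^sub>R ((ad X ^^ k) V)) \<in> borel_measurable borel" for N
      by (intro borel_measurable_sum borel_measurable_scaleR borel_measurable_ad_power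
          borel_measurable_const)
  qed
  then have entry: "(\<lambda>X. ad_series X V $ i) \<in> borel_measurable borel" for V i
    by (rule measurable_compose[OF _ borel_measurable_continuous_onI])
      (auto intro!: continuous_intros)
  show ?thesis
    unfolding Theta_eq det_def matrix_def using entry by simp
qed

section \<open>Haar measures\<close>

abbreviation BG :: "'g measure" where "BG \<equiv> group_borel G Exp"

lemma space_group_borel [simp]: "space BG = carrier G"
  by (simp add: group_borel_def)

lemma log_measurable: "lie_log Exp \<in> measurable BG borel"
  unfolding group_borel_def by (rule measurable_vimage_algebra1) simp

lemma measurable_group_borelI:
  assumes "\<And>x. x \<in> space N \<Longrightarrow> g x \<in> carrier G" "(\<lambda>x. lie_log Exp (g x)) \<in> borel_measurable N"
  shows "g \<in> measurable N BG"
  unfolding group_borel_def by (rule measurable_vimage_algebra2) (use assms in auto)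

lemma Exp_measurable: "Exp \<in> measurable borel BG"
  by (rule measurable_group_borelI) auto

lemma log_mult: "x \<in> carrier G \<Longrightarrow> y \<in> carrier G \<Longrightarrow>
    lie_log Exp (x \<otimes> y) = chart_mult (lie_log Exp x) (lie_log Exp y)"
  by (simp add: chart_mult_def)

lemma log_inv: "x \<in> carrier G \<Longrightarrow> lie_log Exp (inv x) = - lie_log Exp x"
  by (metis Exp_log Exp_uminus log_Exp)

lemma measurable_group_mult:
  assumes f: "f \<in> measurable N BG" and g: "g \<in> measurable N BG"
  shows "(\<lambda>x. f x \<otimes> g x) \<in> measurable N BG"
proof (rule measurable_group_borelI)
  have c: "f x \<in> carrier G" "g x \<in> carrier G" if "x \<in> space N" for x
    using measurable_space[OF f that] measurable_space[OF g that] by auto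
  then show "f x \<otimes> g x \<in> carrier G" if "x \<in> space N" for x using that by simp
  have "(\<lambda>x. (lie_log Exp (f x), lie_log Exp (g x))) \<in> borel_measurable N"
    by (intro borel_measurable_Pair measurable_compose[OF f log_measurable]
        measurable_compose[OF g log_measurable])
  from measurable_compose[OF this borel_measurable_continuous_onI[OF chart_mult_continuous]]
  show "(\<lambda>x. lie_log Exp (f x \<otimes> g x)) \<in> borel_measurable N"
    by (simp add: log_mult c cong: measurable_cong)
qed

lemma measurable_group_inv:
  assumes f: "f \<in> measurable N BG"
  shows "(\<lambda>x. inv f x) \<in> measurable N BG"
proof (rule measurable_group_borelI)
  have c: "f x \<in> carrier G" if "x \<in> space N" for x
    using measurable_space[OF f that] by auto
  then show "inv f x \<in> carrier G" if "x \<in> space N" for x using that by simp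
  have "(\<lambda>x. - lie_log Exp (f x)) \<in> borel_measurable N"
    by (intro borel_measurable_uminus measurable_compose[OF f log_measurable])
  then show "(\<lambda>x. lie_log Exp (inv f x)) \<in> borel_measurable N"
    by (simp add: log_inv c cong: measurable_cong)
qed

lemma translation_measurable:
  assumes x: "x \<in> carrier G"
  shows "(\<lambda>y. x \<otimes> y) \<in> measurable BG BG" "(\<lambda>y. y \<otimes> x) \<in> measurable BG BG"
  using x by (auto intro!: measurable_group_mult)

section \<open>Radon measures on the whole group\<close>

lemma radon_sets: "borel_radon_on G Exp (carrier G) M \<Longrightarrow> sets M = sets BG"
proof -
  have "A \<in> sets (restrict_space BG (carrier G)) \<longleftrightarrow> A \<in> sets BG" for A
    using sets.sets_into_space[of A BG] sets.top[of BG] by (auto simp: sets_restrict_space_iff)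
  moreover assume "borel_radon_on G Exp (carrier G) M"
  ultimately show ?thesis by (auto simp: borel_radon_on_def)
qed

lemma Exp_image_sets: "C \<in> sets borel \<Longrightarrow> Exp ` C \<in> sets BG"
proof -
  assume C: "C \<in> sets borel"
  have "Exp ` C = lie_log Exp -` C \<inter> space BG"
    using Exp_log by (force simp: image_iff)
  then show ?thesis using measurable_sets[OF log_measurable C] by simp
qed

lemma radon_exhaustion:
  assumes M: "borel_radon_on G Exp (carrier G) M"
  shows "Exp ` cball 0 (real k) \<in> sets M" "emeasure M (Exp ` cball 0 (real k)) < \<infinity>"
    "(\<Union>k. Exp ` cball 0 (real k)) = carrier G"
proof -
  show "Exp ` cball 0 (real k) \<in> sets M" using radon_sets[OF M] by (simp add: Exp_image_sets)
  have "emeasure M (Exp ` cball 0 (real k) \<inter> carrier G) < \<infinity>"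
    using M compact_cball unfolding borel_radon_on_def by blast
  moreover have "Exp ` cball 0 (real k) \<inter> carrier G = Exp ` cball 0 (real k)" by auto
  ultimately show "emeasure M (Exp ` cball 0 (real k)) < \<infinity>" by simp
  have "x \<in> (\<Union>k. Exp ` cball 0 (real k))" if "x \<in> carrier G" for x
  proof -
    obtain k where "norm (lie_log Exp x) \<le> real k" using real_arch_simple by blast
    then have "Exp (lie_log Exp x) \<in> Exp ` cball 0 (real k)" by (intro imageI) simp
    then show ?thesis using that by auto
  qed
  then show "(\<Union>k. Exp ` cball 0 (real k)) = carrier G" by auto
qed

lemma radon_sigma_finite:
  assumes M: "borel_radon_on G Exp (carrier G) M"
  shows "sigma_finite_measure M"
proof
  have "space M = carrier G" using sets_eq_imp_space_eq[OF radon_sets[OF M]] by simp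
  then show "\<exists>A. countable A \<and> A \<subseteq> sets M \<and> \<Union>A = space M \<and> (\<forall>a\<in>A. emeasure M a \<noteq> \<infinity>)"
    using radon_exhaustion[OF M]
    by (intro exI[of _ "range (\<lambda>k::nat. Exp ` cball 0 (real k))"]) (auto simp: less_top)
qed

text \<open>The exponential images of balls have finite measure and exhaust the group, so they
  cannot all be null. The measure of such a set can be cancelled, which is how values of the modular
  function are extracted.\<close>

lemma radon_finite_set:
  assumes M: "borel_radon_on G Exp (carrier G) M"
  obtains E where "E \<in> sets M" "emeasure M E \<noteq> 0" "emeasure M E < \<infinity>"
proof (rule ccontr)
  assume *: "\<not> thesis"
  have "emeasure M (Exp ` cball 0 (real k)) = 0" for k
    using * that[OF radon_exhaustion(1)[OF M]] radon_exhaustion(2)[OF M] by blast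
  then have "(\<Union>k. Exp ` cball 0 (real k)) \<in> null_sets M"
    using radon_exhaustion(1)[OF M] by (intro null_sets_UN) auto
  then show False using radon_exhaustion(3)[OF M] M by (auto simp: borel_radon_on_def)
qed

section \<open>Translations as scaling maps\<close>

lemma preimage_right_translation:
  assumes "x \<in> carrier G" "E \<subseteq> carrier G"
  shows "(\<lambda>y. y \<otimes> x) -` E \<inter> carrier G = E #> inv x"
proof -
  have "y \<in> E #> inv x" if "y \<in> carrier G" "y \<otimes> x \<in> E" for y
  proof -
    have "y = (y \<otimes> x) \<otimes> inv x" using that assms by (simp add: m_assoc)
    then show ?thesis using that by (auto simp: r_coset_def)
  qed
  moreover have "(h \<otimes> inv x) \<otimes> x = h" if "h \<in> E" for h
    using that assms by (simp add: m_assoc subset_iff)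
  ultimately show ?thesis using assms by (auto simp: r_coset_def)
qed

lemma preimage_left_translation:
  assumes "x \<in> carrier G" "E \<subseteq> carrier G"
  shows "(\<lambda>y. x \<otimes> y) -` E \<inter> carrier G = inv x <# E"
proof -
  have "y \<in> inv x <# E" if "y \<in> carrier G" "x \<otimes> y \<in> E" for y
  proof -
    have "y = inv x \<otimes> (x \<otimes> y)" using that assms by (simp add: m_assoc[symmetric])
    then show ?thesis using that by (auto simp: l_coset_def)
  qed
  moreover have "x \<otimes> (inv x \<otimes> h) = h" if "h \<in> E" for h
    using that assms by (simp add: m_assoc[symmetric] subset_iff)
  ultimately show ?thesis using assms by (auto simp: l_coset_def)
qed

lemma radon_cong:
  assumes M: "borel_radon_on G Exp (carrier G) M"
  shows "space M = carrier G" "measurable M N = measurable BG N" "measurable N M = measurable N BG"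
  using sets_eq_imp_space_eq[OF radon_sets[OF M]] measurable_cong_sets[OF radon_sets[OF M] refl]
    measurable_cong_sets[OF refl radon_sets[OF M]] by simp_all

lemma left_haar_scaling:
  assumes M: "left_haar G Exp (carrier G) M" and x: "x \<in> carrier G"
  shows "scaling_map M (\<lambda>y. x \<otimes> y) (\<lambda>y. inv x \<otimes> y) 1"
proof (rule scaling_mapI)
  have r: "borel_radon_on G Exp (carrier G) M" using M by (simp add: left_haar_def)
  note c = radon_cong[OF r]
  show "(\<lambda>y. x \<otimes> y) \<in> measurable M M" "(\<lambda>y. inv x \<otimes> y) \<in> measurable M M"
    using x by (simp_all add: c translation_measurable)
  show "inv x \<otimes> (x \<otimes> y) = y" "x \<otimes> (inv x \<otimes> y) = y" if "y \<in> space M" for y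
    using that x by (simp_all add: c m_assoc[symmetric])
  fix E assume E: "E \<in> sets M"
  then have "E \<subseteq> carrier G" using sets.sets_into_space c(1) by blast
  then show "emeasure M ((\<lambda>y. x \<otimes> y) -` E \<inter> space M) = ennreal 1 * emeasure M E"
    using M E x by (simp add: c preimage_left_translation left_haar_def)
qed simp

lemma right_haar_scaling:
  assumes M: "right_haar G Exp (carrier G) M" and x: "x \<in> carrier G"
  shows "scaling_map M (\<lambda>y. y \<otimes> x) (\<lambda>y. y \<otimes> inv x) 1"
proof (rule scaling_mapI)
  have r: "borel_radon_on G Exp (carrier G) M" using M by (simp add: right_haar_def)
  note c = radon_cong[OF r]
  show "(\<lambda>y. y \<otimes> x) \<in> measurable M M" "(\<lambda>y. y \<otimes> inv x) \<in> measurable M M"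
    using x by (simp_all add: c translation_measurable)
  show "(y \<otimes> x) \<otimes> inv x = y" "(y \<otimes> inv x) \<otimes> x = y" if "y \<in> space M" for y
    using that x by (simp_all add: c m_assoc)
  fix E assume E: "E \<in> sets M"
  then have "E \<subseteq> carrier G" using sets.sets_into_space c(1) by blast
  then show "emeasure M ((\<lambda>y. y \<otimes> x) -` E \<inter> space M) = ennreal 1 * emeasure M E"
    using M E x by (simp add: c preimage_right_translation right_haar_def)
qed simp

section \<open>The modular function and left translation of right Haar measure\<close>

lemma modular_function_mult:
  assumes M: "left_haar G Exp (carrier G) M" and \<Delta>: "modular_function G (carrier G) M \<Delta>"
    and xy: "x \<in> carrier G" "y \<in> carrier G"
  shows "\<Delta> (x \<otimes> y) = \<Delta> x * \<Delta> y"
proof -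
  have r: "borel_radon_on G Exp (carrier G) M" using M by (simp add: left_haar_def)
  obtain E where E: "E \<in> sets M" "emeasure M E \<noteq> 0" "emeasure M E < \<infinity>"
    using radon_finite_set[OF r] .
  have sub: "E \<subseteq> carrier G" using sets.sets_into_space[OF E(1)] radon_cong(1)[OF r] by simp
  have pos: "0 < \<Delta> z" and mod: "F \<in> sets M \<Longrightarrow> emeasure M (F #> z) = ennreal (\<Delta> z) * emeasure M F"
    if "z \<in> carrier G" for z F using \<Delta> that by (auto simp: modular_function_def)
  have "E #> x = (\<lambda>y. y \<otimes> inv x) -` E \<inter> carrier G"
    using preimage_right_translation[of "inv x" E] xy sub by simp
  also have "\<dots> \<in> sets M"
    using measurable_sets[OF translation_measurable(2)[of "inv x"], of E] xy E radon_sets[OF r] by simp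
  finally have Ex: "E #> x \<in> sets M" .
  have "ennreal (\<Delta> (x \<otimes> y)) * emeasure M E = emeasure M (E #> (x \<otimes> y))"
    using mod E xy by simp
  also have "\<dots> = emeasure M ((E #> x) #> y)" using sub xy by (simp add: coset_mult_assoc)
  also have "\<dots> = ennreal (\<Delta> y) * (ennreal (\<Delta> x) * emeasure M E)"
    using mod[OF xy(2) Ex] mod[OF xy(1) E(1)] by simp
  also have "\<dots> = ennreal (\<Delta> x * \<Delta> y) * emeasure M E"
    using pos[OF xy(1)] pos[OF xy(2)] by (simp add: ennreal_mult mult_ac)
  finally have "ennreal (\<Delta> (x \<otimes> y)) = ennreal (\<Delta> x * \<Delta> y)"
    using E(2,3) by (auto simp: mult.commute[of _ "emeasure M E"] ennreal_mult_cancel_left)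
  then show ?thesis using pos[of "x \<otimes> y"] pos[OF xy(1)] pos[OF xy(2)] xy
    by (simp add: ennreal_inj less_imp_le)
qed

text \<open>For a fixed E of positive finite measure, \<Delta>(h) is M(E h) / M(E). The numerator is
  the measure of a section of the measurable set of pairs (h, y) with y h^-1 in E, hence measurable
  in h because M is \<sigma>-finite.\<close>

lemma modular_function_measurable:
  assumes M: "left_haar G Exp (carrier G) M" and \<Delta>: "modular_function G (carrier G) M \<Delta>"
  shows "\<Delta> \<in> borel_measurable BG"
proof -
  have r: "borel_radon_on G Exp (carrier G) M" using M by (simp add: left_haar_def)
  note c = radon_cong[OF r]
  interpret M: sigma_finite_measure M by (rule radon_sigma_finite[OF r])
  obtain E where E: "E \<in> sets M" "emeasure M E \<noteq> 0" "emeasure M E < \<infinity>"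
    using radon_finite_set[OF r] .
  have sub: "E \<subseteq> carrier G" using sets.sets_into_space[OF E(1)] c(1) by simp
  define q where "q = (\<lambda>p. snd p \<otimes> inv fst p)"
  have "snd \<in> measurable (BG \<Otimes>\<^sub>M M) BG" using measurable_snd[of BG M] by (simp only: c)
  then have q: "q \<in> measurable (BG \<Otimes>\<^sub>M M) BG"
    unfolding q_def by (intro measurable_group_mult measurable_group_inv) auto
  have "q -` E \<inter> space (BG \<Otimes>\<^sub>M M) \<in> sets (BG \<Otimes>\<^sub>M M)"
    by (rule measurable_sets[OF q]) (use E radon_sets[OF r] in simp)
  then have m: "(\<lambda>h. emeasure M (Pair h -` (q -` E \<inter> space (BG \<Otimes>\<^sub>M M)))) \<in> borel_measurable BG"
    by (rule M.measurable_emeasure_Pair)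
  have "\<Delta> h = enn2real (emeasure M (Pair h -` (q -` E \<inter> space (BG \<Otimes>\<^sub>M M)))) / measure M E"
    if h: "h \<in> space BG" for h
  proof -
    have "Pair h -` (q -` E \<inter> space (BG \<Otimes>\<^sub>M M)) = (\<lambda>y. y \<otimes> inv h) -` E \<inter> carrier G"
      using h by (auto simp: q_def space_pair_measure c)
    also have "\<dots> = E #> h" using preimage_right_translation[of "inv h" E] h sub by simp
    finally have "emeasure M (Pair h -` (q -` E \<inter> space (BG \<Otimes>\<^sub>M M))) = ennreal (\<Delta> h) * emeasure M E"
      using \<Delta> h E by (simp add: modular_function_def)
    moreover have "measure M E > 0" using E by (simp add: measure_def enn2real_positive_iff zero_less_iff_neq_zero)
    ultimately show ?thesis using \<Delta> h
      by (simp add: enn2real_mult measure_def modular_function_def less_imp_le)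
  qed
  then have "\<Delta> \<in> borel_measurable BG \<longleftrightarrow>
     (\<lambda>h. enn2real (emeasure M (Pair h -` (q -` E \<inter> space (BG \<Otimes>\<^sub>M M)))) / measure M E) \<in> borel_measurable BG"
    by (rule measurable_cong)
  then show ?thesis using m by simp
qed

text \<open>Written as an integral of 1 / \<Delta> against the left Haar measure, \<open>Mr\<close>
  inherits left invariance up to the factor in 1 / \<Delta>(y) = \<Delta>(x) / \<Delta>(x
  y).\<close>

lemma right_haar_left_scaling:
  assumes Ml: "left_haar G Exp (carrier G) Ml" and Mr: "right_haar G Exp (carrier G) Mr"
    and \<Delta>: "modular_function G (carrier G) Ml \<Delta>" and lr: "Ml = density Mr (\<lambda>y. ennreal (\<Delta> y))"
    and x: "x \<in> carrier G"
  shows "scaling_map Mr (\<lambda>y. x \<otimes> y) (\<lambda>y. inv x \<otimes> y) (\<Delta> x)"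
proof (rule scaling_mapI)
  have r: "borel_radon_on G Exp (carrier G) Mr" using Mr by (simp add: right_haar_def)
  have l: "borel_radon_on G Exp (carrier G) Ml" using Ml by (simp add: left_haar_def)
  note c = radon_cong[OF r] and cl = radon_cong[OF l]
  have pos: "0 < \<Delta> z" if "z \<in> carrier G" for z using \<Delta> that by (auto simp: modular_function_def)
  have \<Delta>m: "\<Delta> \<in> borel_measurable BG" by (rule modular_function_measurable[OF Ml \<Delta>])
  then have [measurable]: "\<Delta> \<in> borel_measurable Mr" "\<Delta> \<in> borel_measurable Ml" by (simp_all add: c cl)
  show "0 < \<Delta> x" by (rule pos[OF x])
  show "(\<lambda>y. x \<otimes> y) \<in> measurable Mr Mr" "(\<lambda>y. inv x \<otimes> y) \<in> measurable Mr Mr"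
    using x by (simp_all add: c translation_measurable)
  show "inv x \<otimes> (x \<otimes> y) = y" "x \<otimes> (inv x \<otimes> y) = y" if "y \<in> space Mr" for y
    using that x by (simp_all add: c m_assoc[symmetric])
  have Mr_eq: "emeasure Mr E = (\<integral>\<^sup>+y. ennreal (1 / \<Delta> y) * indicator E y \<partial>Ml)" if [measurable]: "E \<in> sets Mr" for E
  proof -
    have "(\<integral>\<^sup>+y. ennreal (1 / \<Delta> y) * indicator E y \<partial>Ml) =
        (\<integral>\<^sup>+y. ennreal (\<Delta> y) * (ennreal (1 / \<Delta> y) * indicator E y) \<partial>Mr)"
      unfolding lr by (rule nn_integral_density) auto
    also have "\<dots> = (\<integral>\<^sup>+y. indicator E y \<partial>Mr)"
    proof (rule nn_integral_cong)
      fix y assume "y \<in> space Mr"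
      then have "0 < \<Delta> y" using pos c by simp
      then have "ennreal (\<Delta> y) * ennreal (1 / \<Delta> y) = 1" by (simp flip: ennreal_mult')
      then show "ennreal (\<Delta> y) * (ennreal (1 / \<Delta> y) * indicator E y) = indicator E y"
        by (simp flip: mult.assoc)
    qed
    finally show ?thesis using that by simp
  qed
  fix E assume E: "E \<in> sets Mr"
  then have [measurable]: "E \<in> sets Ml" by (simp add: lr)
  have E': "(\<lambda>y. x \<otimes> y) -` E \<inter> space Mr \<in> sets Mr"
    using measurable_sets[OF translation_measurable(1)[OF x], of E] E radon_sets[OF r] by (simp add: c)
  have "emeasure Mr ((\<lambda>y. x \<otimes> y) -` E \<inter> space Mr) =
      (\<integral>\<^sup>+y. ennreal (1 / \<Delta> y) * indicator ((\<lambda>y. x \<otimes> y) -` E \<inter> space Mr) y \<partial>Ml)"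
    by (rule Mr_eq[OF E'])
  also have "\<dots> = (\<integral>\<^sup>+y. ennreal (\<Delta> x) * (ennreal (1 / \<Delta> (x \<otimes> y)) * indicator E (x \<otimes> y)) \<partial>Ml)"
  proof (rule nn_integral_cong)
    fix y assume y: "y \<in> space Ml"
    have "1 / \<Delta> y = \<Delta> x * (1 / \<Delta> (x \<otimes> y))"
      using pos[OF x] y x by (simp add: modular_function_mult[OF Ml \<Delta>] cl)
    then have "ennreal (1 / \<Delta> y) = ennreal (\<Delta> x) * ennreal (1 / \<Delta> (x \<otimes> y))"
      by (simp only: ennreal_mult'[OF less_imp_le[OF pos[OF x]]])
    then show "ennreal (1 / \<Delta> y) * indicator ((\<lambda>y. x \<otimes> y) -` E \<inter> space Mr) y =
        ennreal (\<Delta> x) * (ennreal (1 / \<Delta> (x \<otimes> y)) * indicator E (x \<otimes> y))"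
      using y by (simp add: c cl indicator_def mult.assoc)
  qed
  also have "\<dots> = ennreal (\<Delta> x) * (\<integral>\<^sup>+y. ennreal (1 / \<Delta> (x \<otimes> y)) * indicator E (x \<otimes> y) \<partial>Ml)"
  proof (rule nn_integral_cmult)
    have "(\<lambda>y. ennreal (1 / \<Delta> y) * indicator E y) \<in> borel_measurable Ml" by measurable
    from measurable_compose[OF scaling_mapD(1)[OF left_haar_scaling[OF Ml x]] this]
    show "(\<lambda>y. ennreal (1 / \<Delta> (x \<otimes> y)) * indicator E (x \<otimes> y)) \<in> borel_measurable Ml" .
  qed
  also have "(\<integral>\<^sup>+y. ennreal (1 / \<Delta> (x \<otimes> y)) * indicator E (x \<otimes> y) \<partial>Ml) =
      (\<integral>\<^sup>+y. ennreal (1 / \<Delta> y) * indicator E y \<partial>Ml)"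
    using scaling_map_nn_integral[OF left_haar_scaling[OF Ml x],
        of "\<lambda>y. ennreal (1 / \<Delta> y) * indicator E y"] by simp
  also have "\<dots> = emeasure Mr E" by (rule Mr_eq[OF E, symmetric])
  finally show "emeasure Mr ((\<lambda>y. x \<otimes> y) -` E \<inter> space Mr) = ennreal (\<Delta> x) * emeasure Mr E" .
qed

lemma right_haar_conj_scaling:
  assumes Ml: "left_haar G Exp (carrier G) Ml" and Mr: "right_haar G Exp (carrier G) Mr"
    and \<Delta>: "modular_function G (carrier G) Ml \<Delta>" and lr: "Ml = density Mr (\<lambda>y. ennreal (\<Delta> y))"
    and x: "x \<in> carrier G"
  shows "scaling_map Mr (\<lambda>z. x \<otimes> z \<otimes> inv x) (\<lambda>z. inv x \<otimes> (z \<otimes> x)) (\<Delta> x)"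
  using scaling_map_comp[OF right_haar_scaling[OF Mr, of "inv x"] right_haar_left_scaling[OF assms]] x
  by simp

end

section \<open>Unitary representations\<close>

lemma L2_cong: "f \<in> L2 M \<Longrightarrow> (\<And>x. x \<in> space M \<Longrightarrow> g x = f x) \<Longrightarrow> g \<in> L2 M"
  by (simp add: L2_def cong: measurable_cong Bochner_Integration.integrable_cong)

context
  fixes G :: "('g, 'e) monoid_scheme" (structure) and Exp :: "real^'n \<Rightarrow> 'g"
    and \<pi> :: "'g \<Rightarrow> 'h::complex_hilbert \<Rightarrow> 'h"
  assumes grp: "group G" and rep: "unitary_rep G Exp \<pi>"
begin

interpretation group G by (rule grp)

lemma rep_cinner: "x \<in> carrier G \<Longrightarrow> cinner (\<pi> x u) (\<pi> x v) = cinner u v"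
  using rep by (simp add: unitary_rep_def)

lemma rep_norm: "x \<in> carrier G \<Longrightarrow> norm (\<pi> x u) = norm u"
  by (simp add: norm_eq_sqrt_cinner rep_cinner)

lemma rep_mult: "x \<in> carrier G \<Longrightarrow> y \<in> carrier G \<Longrightarrow> \<pi> (x \<otimes> y) u = \<pi> x (\<pi> y u)"
  using rep by (simp add: unitary_rep_def)

lemma rep_add: "x \<in> carrier G \<Longrightarrow> \<pi> x (u + v) = \<pi> x u + \<pi> x v"
  using rep by (simp add: unitary_rep_def clinear_on_def)

lemma rep_scaleC: "x \<in> carrier G \<Longrightarrow> \<pi> x (c *\<^sub>C u) = c *\<^sub>C \<pi> x u"
  using rep by (simp add: unitary_rep_def clinear_on_def)

lemma rep_scaleR: "x \<in> carrier G \<Longrightarrow> \<pi> x (r *\<^sub>R u) = r *\<^sub>R \<pi> x u"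
  using rep_scaleC[of x "of_real r"] by (simp add: scaleC_of_real)

lemma rep_bounded_linear: "x \<in> carrier G \<Longrightarrow> bounded_linear (\<pi> x)"
  by (rule bounded_linear_intro[where K = 1]) (simp_all add: rep_add rep_scaleR rep_norm)

lemma rep_diff: "x \<in> carrier G \<Longrightarrow> \<pi> x (u - v) = \<pi> x u - \<pi> x v"
  using rep_add[of x u "- 1 *\<^sub>R v"] rep_scaleR[of x "- 1" v] by simp

lemma rep_one: "\<pi> \<one> u = u"
proof -
  have "surj (\<pi> \<one>)" using rep by (simp add: unitary_rep_def)
  then obtain v where "u = \<pi> \<one> v" by (metis surjD)
  then show ?thesis using rep_mult[of \<one> \<one> v] by simp
qed

lemma rep_inv:
  "x \<in> carrier G \<Longrightarrow> \<pi> (inv x) (\<pi> x u) = u" "x \<in> carrier G \<Longrightarrow> \<pi> x (\<pi> (inv x) u) = u"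
  by (simp_all add: rep_mult[symmetric] rep_one)

lemma rep_cinner_left: "x \<in> carrier G \<Longrightarrow> cinner (\<pi> x u) v = cinner u (\<pi> (inv x) v)"
  using rep_cinner[of x u "\<pi> (inv x) v"] by (simp add: rep_inv)

lemma rep_cadj: "x \<in> carrier G \<Longrightarrow> cadj (\<pi> x) = \<pi> (inv x)"
  unfolding cadj_def
proof (rule the_equality)
  assume x: "x \<in> carrier G"
  then show "\<forall>u v. cinner (\<pi> x u) v = cinner u (\<pi> (inv x) v)" by (simp add: rep_cinner_left)
  fix A assume "\<forall>u v. cinner (\<pi> x u) v = cinner u (A v)"
  then have "cinner u (A v) = cinner u (\<pi> (inv x) v)" for u v
    using x by (simp add: rep_cinner_left[symmetric])
  then show "A = \<pi> (inv x)" by (intro ext cinner_eqI)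
qed

lemma wavelet_eq: "z \<in> carrier G \<Longrightarrow> wavelet \<pi> \<phi> \<psi> z = cinner \<psi> (\<pi> (inv z) \<phi>)"
  by (simp add: wavelet_def rep_cadj)

text \<open>The action on the analysing vector becomes a left translation, under which right Haar
  measure is only scaled. This is the origin of the modular factor in the behaviour of
  \<open>Dinv\<close>.\<close>

lemma wavelet_rep:
  "x \<in> carrier G \<Longrightarrow> z \<in> carrier G \<Longrightarrow> wavelet \<pi> (\<pi> x \<phi>) \<psi> z = wavelet \<pi> \<phi> \<psi> (inv x \<otimes> z)"
  by (simp add: wavelet_eq rep_mult[symmetric] inv_mult_group)

lemma rep_inj: "x \<in> carrier G \<Longrightarrow> inj_on (\<pi> x) E"
  by (metis inj_onI rep_inv(1))

lemma rep_orthonormal_basis: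
  assumes x: "x \<in> carrier G" and E: "orthonormal_basis E"
  shows "orthonormal_basis (\<pi> x ` E)"
  unfolding orthonormal_basis_def
proof (intro conjI ballI allI impI)
  fix e e' assume "e \<in> \<pi> x ` E" "e' \<in> \<pi> x ` E"
  then show "cinner e e' = (if e = e' then 1 else 0)"
    using E x inj_on_eq_iff[OF rep_inj[OF x, of UNIV]]
    by (auto simp: orthonormal_basis_def rep_cinner)
next
  fix v assume v: "\<forall>e\<in>\<pi> x ` E. cinner v e = 0"
  have "cinner (\<pi> (inv x) v) e = 0" if "e \<in> E" for e
    using v that x rep_cinner_left[of "inv x" v e] by simp
  then have "\<pi> (inv x) v = 0" using E by (auto simp: orthonormal_basis_def)
  then show "v = 0" using rep_norm[of "inv x" v] x by simp
qed

section \<open>Conjugation of operators by the representation\<close>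

definition rep_conj :: "'g \<Rightarrow> ('h \<Rightarrow> 'h) \<Rightarrow> 'h \<Rightarrow> 'h" where
  "rep_conj x A = \<pi> (inv x) \<circ> A \<circ> \<pi> x"

lemma rep_conj_inv:
  assumes x: "x \<in> carrier G" 
  shows "rep_conj (inv x) (rep_conj x A) = A" "rep_conj x (rep_conj (inv x) A) = A"
  using x by (auto simp: rep_conj_def rep_inv)

lemma rep_conj_zero: "x \<in> carrier G \<Longrightarrow> rep_conj x (\<lambda>_. 0) = (\<lambda>_. 0)"
  using rep_norm[of "inv x" 0] by (auto simp: rep_conj_def)

lemma hilbert_schmidt_rep_conj:
  assumes x: "x \<in> carrier G" and A: "hilbert_schmidt A"
  shows "hilbert_schmidt (rep_conj x A)"
  unfolding hilbert_schmidt_def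
proof (intro conjI allI impI)
  have bl: "bounded_linear A" and cl: "clinear_on UNIV A" using A by (auto simp: hilbert_schmidt_def)
  show "clinear_on UNIV (rep_conj x A)"
    using cl x by (simp add: clinear_on_def rep_conj_def rep_add rep_scaleC)
  show "bounded_linear (rep_conj x A)"
    unfolding rep_conj_def o_def
    by (intro bounded_linear_compose[OF rep_bounded_linear] bounded_linear_compose[OF bl]
        rep_bounded_linear) (use x in simp_all)
  fix E :: "'h set" assume "orthonormal_basis E"
  then have "(\<lambda>e. (norm (A e))\<^sup>2) summable_on \<pi> x ` E"
    using A rep_orthonormal_basis[OF x] by (simp add: hilbert_schmidt_def)
  then show "(\<lambda>e. (norm (rep_conj x A e))\<^sup>2) summable_on E"
    using x by (simp add: summable_on_reindex rep_inj o_def rep_conj_def rep_norm)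
qed

lemma HS_tendsto_rep_conj:
  assumes x: "x \<in> carrier G" and A: "HS_tendsto As A"
  shows "HS_tendsto (\<lambda>k. rep_conj x (As k)) (rep_conj x A)"
  unfolding HS_tendsto_def
proof (intro conjI allI impI)
  fix E :: "'h set" assume E: "orthonormal_basis E"
  have "(\<lambda>n. \<Sum>\<^sub>\<infinity>e\<in>\<pi> x ` E. (norm (As n e - A e))\<^sup>2) \<longlonglongrightarrow> 0"
    using A rep_orthonormal_basis[OF x E] by (simp add: HS_tendsto_def)
  moreover have "(norm (rep_conj x (As n) e - rep_conj x A e))\<^sup>2 = (norm (As n (\<pi> x e) - A (\<pi> x e)))\<^sup>2" for n e
    using x by (simp add: rep_conj_def rep_norm flip: rep_diff)
  ultimately show "(\<lambda>n. \<Sum>\<^sub>\<infinity>e\<in>E. (norm (rep_conj x (As n) e - rep_conj x A e))\<^sup>2) \<longlonglongrightarrow> 0"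
    using x by (simp add: infsum_reindex rep_inj o_def)
qed (use A x in \<open>auto simp: HS_tendsto_def hilbert_schmidt_rep_conj\<close>)

text \<open>Because S is invariant under \<open>\<pi> x\<close>, the adjoint relation between v and
  w for the new operator is the relation between \<pi>(x) v and \<pi>(x) w / r for T. This makes the
  rescaled conjugate of \<open>Dinv\<close> comparable with \<open>Dinv\<close> itself.\<close>

lemma positive_selfadjoint_rep_conj:
  assumes x: "x \<in> carrier G" and T: "positive_selfadjoint S T" and r: "0 < r"
    and S: "\<And>u. \<pi> x u \<in> S \<longleftrightarrow> u \<in> S"
  shows "positive_selfadjoint S (\<lambda>u. r *\<^sub>R \<pi> (inv x) (T (\<pi> x u)))"
  unfolding positive_selfadjoint_def
proof (intro conjI ballI allI)
  let ?T = "\<lambda>u. r *\<^sub>R \<pi> (inv x) (T (\<pi> x u))"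
  have i: "inv x \<in> carrier G" using x by simp
  show "csubspace S" "closure S = UNIV" using T by (auto simp: positive_selfadjoint_def)
  have lin: "clinear_on S T" using T by (auto simp: positive_selfadjoint_def)
  show "clinear_on S ?T"
    using lin S x by (simp add: clinear_on_def rep_add rep_scaleC scaleR_add_right scaleC_scaleR_commute)
  have T_cinner: "cinner (?T u) v = of_real r * cinner (T (\<pi> x u)) (\<pi> x v)" for u v
    using x by (simp add: cinner_scaleR_left rep_cinner_left)
  show "Im (cinner (?T u) u) = 0" "0 \<le> Re (cinner (?T u) u)" if "u \<in> S" for u
    unfolding T_cinner using T r S[of u] that by (auto simp: positive_selfadjoint_def)
  fix v w
  have "(\<forall>u\<in>S. cinner (?T u) v = cinner u w) \<longleftrightarrow>
      (\<forall>u\<in>S. cinner (T u) (\<pi> x v) = cinner u ((1 / r) *\<^sub>R \<pi> x w))"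
  proof -
    have *: "cinner (?T u) v = cinner u w \<longleftrightarrow>
        cinner (T (\<pi> x u)) (\<pi> x v) = cinner (\<pi> x u) ((1 / r) *\<^sub>R \<pi> x w)" for u
      unfolding T_cinner using x r by (auto simp: cinner_scaleR_right rep_cinner field_simps)
    have S': "\<pi> (inv x) u \<in> S" if "u \<in> S" for u using S[of "\<pi> (inv x) u"] that x by (simp add: rep_inv)
    show ?thesis unfolding *
      using S S' x by (metis rep_inv(2))
  qed
  also have "\<dots> \<longleftrightarrow> \<pi> x v \<in> S \<and> (1 / r) *\<^sub>R \<pi> x w = T (\<pi> x v)"
    using T by (simp add: positive_selfadjoint_def)
  also have "\<dots> \<longleftrightarrow> v \<in> S \<and> w = ?T v"
  proof -
    have "(1 / r) *\<^sub>R \<pi> x w = T (\<pi> x v) \<longleftrightarrow> w = ?T v"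
    proof
      assume "(1 / r) *\<^sub>R \<pi> x w = T (\<pi> x v)"
      then have "?T v = r *\<^sub>R \<pi> (inv x) ((1 / r) *\<^sub>R \<pi> x w)" by simp
      then show "w = ?T v" using r x by (simp add: rep_scaleR rep_inv)
    next
      assume "w = ?T v"
      then show "(1 / r) *\<^sub>R \<pi> x w = T (\<pi> x v)" using r x by (simp add: rep_scaleR rep_inv)
    qed
    then show ?thesis by (simp add: S)
  qed
  finally show "(\<forall>u\<in>S. cinner (?T u) v = cinner u w) \<longleftrightarrow> v \<in> S \<and> w = ?T v" .
qed

end

section \<open>Covariance of the transforms\<close>

locale duflo_moore_setting = exponential_lie_group G Exp
  for G :: "('g, 'e) monoid_scheme" (structure) and Exp :: "real^'n \<Rightarrow> 'g" +
  fixes \<mu>l \<mu>r :: "'g measure" and \<Delta> :: "'g \<Rightarrow> real"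
    and \<pi> :: "'g \<Rightarrow> 'h \<Rightarrow> 'h::{complex_hilbert, second_countable_topology}"
    and S :: "'h set" and Dinv :: "'h \<Rightarrow> 'h"
  assumes haar: "left_haar G Exp (carrier G) \<mu>l" "right_haar G Exp (carrier G) \<mu>r"
    and modular: "modular_function G (carrier G) \<mu>l \<Delta>" "\<mu>l = density \<mu>r (\<lambda>y. ennreal (\<Delta> y))"
    and rep: "unitary_rep G Exp \<pi>"
    and nontrivial: "\<exists>v::'h. v \<noteq> 0"
    and dm: "duflo_moore \<mu>r \<pi> S Dinv"
begin

lemmas rep_rules = rep_cinner[OF group_axioms rep] rep_norm[OF group_axioms rep]
  rep_mult[OF group_axioms rep] rep_scaleC[OF group_axioms rep] rep_scaleR[OF group_axioms rep]
  rep_diff[OF group_axioms rep] rep_inv[OF group_axioms rep]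
lemmas wavelet_apply = wavelet_eq[OF group_axioms rep]
lemmas wavelet_translate = wavelet_rep[OF group_axioms rep]

lemma space_mu [simp]: "space \<mu>r = carrier G"
  using radon_cong(1) haar by (simp add: right_haar_def)

lemma modular_pos: "x \<in> carrier G \<Longrightarrow> 0 < \<Delta> x"
  using modular(1) by (simp add: modular_function_def)

lemma modular_mult: "x \<in> carrier G \<Longrightarrow> y \<in> carrier G \<Longrightarrow> \<Delta> (x \<otimes> y) = \<Delta> x * \<Delta> y"
  by (rule modular_function_mult[OF haar(1) modular(1)])

lemma modular_one: "\<Delta> \<one> = 1"
  using modular_mult[of \<one> \<one>] modular_pos[of \<one>] by simp

lemma modular_inv: "x \<in> carrier G \<Longrightarrow> \<Delta> (inv x) = 1 / \<Delta> x"
  using modular_mult[of x "inv x"] modular_one modular_pos[of x] by (simp add: field_simps)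

lemmas left_scaling = right_haar_left_scaling[OF haar modular]
lemmas right_scaling = right_haar_scaling[OF haar(2)]
lemmas conj_scaling = right_haar_conj_scaling[OF haar modular]

section \<open>The Duflo-Moore operator under the representation\<close>

lemma Dinv_props:
  "positive_selfadjoint S Dinv" "S = {\<phi>. \<forall>\<psi>. wavelet \<pi> \<phi> \<psi> \<in> L2 \<mu>r}"
  "\<phi>1 \<in> S \<Longrightarrow> \<phi>2 \<in> S \<Longrightarrow> (\<integral>x. wavelet \<pi> \<phi>1 \<psi>1 x * cnj (wavelet \<pi> \<phi>2 \<psi>2 x) \<partial>\<mu>r) =
     cinner \<psi>1 \<psi>2 * cnj (cinner (Dinv \<phi>1) (Dinv \<phi>2))"
  using dm by (auto simp: duflo_moore_def)

lemma admissible_rep: 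
  assumes x: "x \<in> carrier G" and \<phi>: "\<phi> \<in> S"
  shows "\<pi> x \<phi> \<in> S"
proof -
  have "wavelet \<pi> (\<pi> x \<phi>) \<psi> \<in> L2 \<mu>r" for \<psi>
  proof (rule L2_cong)
    show "(\<lambda>z. 1 * wavelet \<pi> \<phi> \<psi> (inv x \<otimes> z)) \<in> L2 \<mu>r"
      using \<phi> x Dinv_props(2) by (intro L2_scaling[OF left_scaling]) auto
  qed (use x in \<open>simp add: wavelet_translate\<close>)
  then show ?thesis using Dinv_props(2) by blast
qed

lemma admissible_rep_iff: "x \<in> carrier G \<Longrightarrow> \<pi> x \<phi> \<in> S \<longleftrightarrow> \<phi> \<in> S"
  using admissible_rep[of "inv x" "\<pi> x \<phi>"] admissible_rep[of x \<phi>] by (auto simp: rep_rules)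

text \<open>The orthogonality relation is used with one fixed nonzero \<psi> in both slots, so the
  squared norm of \<psi> can be cancelled. The integral picks up \<Delta>(x^-1) from the
  substitution by x^-1 z.\<close>

lemma Dinv_form_rep:
  assumes x: "x \<in> carrier G" and \<phi>: "\<phi>1 \<in> S" "\<phi>2 \<in> S"
  shows "cinner (Dinv (\<pi> x \<phi>1)) (Dinv (\<pi> x \<phi>2)) = of_real (1 / \<Delta> x) * cinner (Dinv \<phi>1) (Dinv \<phi>2)"
proof -
  obtain \<psi> :: 'h where \<psi>: "\<psi> \<noteq> 0" using nontrivial by blast
  let ?h = "\<lambda>z. wavelet \<pi> \<phi>1 \<psi> z * cnj (wavelet \<pi> \<phi>2 \<psi> z)"
  have "cinner \<psi> \<psi> * cnj (cinner (Dinv (\<pi> x \<phi>1)) (Dinv (\<pi> x \<phi>2))) =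
      (\<integral>z. wavelet \<pi> (\<pi> x \<phi>1) \<psi> z * cnj (wavelet \<pi> (\<pi> x \<phi>2) \<psi> z) \<partial>\<mu>r)"
    using Dinv_props(3) admissible_rep[OF x] \<phi> by simp
  also have "\<dots> = (\<integral>z. ?h (inv x \<otimes> z) \<partial>\<mu>r)"
    using x by (intro Bochner_Integration.integral_cong) (auto simp: wavelet_translate)
  also have "\<dots> = \<Delta> (inv x) *\<^sub>R (\<integral>z. ?h z \<partial>\<mu>r)"
    using x by (intro scaling_map_integral[OF left_scaling, where f="?h"]) auto
  also have "\<dots> = of_real (1 / \<Delta> x) * (cinner \<psi> \<psi> * cnj (cinner (Dinv \<phi>1) (Dinv \<phi>2)))"
    using Dinv_props(3)[OF \<phi>] x by (simp add: modular_inv scaleR_conv_of_real)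
  finally have "cinner \<psi> \<psi> * cnj (cinner (Dinv (\<pi> x \<phi>1)) (Dinv (\<pi> x \<phi>2))) =
      cinner \<psi> \<psi> * cnj (of_real (1 / \<Delta> x) * cinner (Dinv \<phi>1) (Dinv \<phi>2))" by (simp add: mult_ac)
  then have "cnj (cinner (Dinv (\<pi> x \<phi>1)) (Dinv (\<pi> x \<phi>2))) =
      cnj (of_real (1 / \<Delta> x) * cinner (Dinv \<phi>1) (Dinv \<phi>2))"
    using \<psi> by (subst (asm) mult_cancel_left) (simp add: cinner_self)
  then show ?thesis by (simp only: complex_cnj_cancel_iff)
qed

text \<open>Both sides are positive self-adjoint operators in \<open>u\<close> after multiplication by
  \<open>\<pi>(x)\<^sup>*\<close>, and by the orthogonality relations they have the same form.\<close>

lemma Dinv_rep: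
  assumes x: "x \<in> carrier G" and u: "u \<in> S"
  shows "Dinv (\<pi> x u) = (1 / sqrt (\<Delta> x)) *\<^sub>R \<pi> x (Dinv u)"
proof -
  have r: "0 < sqrt (\<Delta> x)" using modular_pos[OF x] by simp
  have "sqrt (\<Delta> x) *\<^sub>R \<pi> (inv x) (Dinv (\<pi> x u)) = Dinv u"
  proof (rule positive_selfadjoint_form_unique[OF _ Dinv_props(1) _ u])
    show "positive_selfadjoint S (\<lambda>u. sqrt (\<Delta> x) *\<^sub>R \<pi> (inv x) (Dinv (\<pi> x u)))"
      by (rule positive_selfadjoint_rep_conj[OF group_axioms rep x Dinv_props(1) r])
        (rule admissible_rep_iff[OF x])
    fix u v assume "u \<in> S" "v \<in> S"
    from Dinv_form_rep[OF x this] 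
    show "cinner (sqrt (\<Delta> x) *\<^sub>R \<pi> (inv x) (Dinv (\<pi> x u))) (sqrt (\<Delta> x) *\<^sub>R \<pi> (inv x) (Dinv (\<pi> x v))) =
        cinner (Dinv u) (Dinv v)"
      using x modular_pos[OF x]
      by (simp add: cinner_scaleR_left cinner_scaleR_right rep_rules flip: of_real_mult mult.assoc)
  qed
  then have "\<pi> x (Dinv u) = \<pi> x (sqrt (\<Delta> x) *\<^sub>R \<pi> (inv x) (Dinv (\<pi> x u)))" by simp
  also have "\<dots> = sqrt (\<Delta> x) *\<^sub>R Dinv (\<pi> x u)" using x by (simp add: rep_rules)
  finally show ?thesis using r by simp
qed

lemma mu_nonzero: "\<not> (AE z in \<mu>r. False)"
proof
  assume "AE z in \<mu>r. False"
  then have "emeasure \<mu>r (carrier G) = 0" using AE_E2[OF \<open>AE z in \<mu>r. False\<close>] by simp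
  then show False using haar(2) by (simp add: right_haar_def borel_radon_on_def)
qed

text \<open>Each wavelet coefficient of \<phi> vanishes outside a null set that depends on \<psi>. A
  countable dense set of \<psi> yields one common point z, where density and continuity give
  \<pi>(z^-1) \<phi> = 0. The resulting injectivity makes \<open>inv_into S Dinv\<close> the genuine
  inverse in the Fourier-Wigner integral.\<close>

lemma Dinv_kernel:
  assumes \<phi>: "\<phi> \<in> S" "Dinv \<phi> = 0"
  shows "\<phi> = 0"
proof -
  have "AE z in \<mu>r. wavelet \<pi> \<phi> \<psi> z = 0" for \<psi>
  proof -
    have "integrable \<mu>r (\<lambda>z. (cmod (wavelet \<pi> \<phi> \<psi> z))\<^sup>2)"
      using \<phi> Dinv_props(2) by (auto simp: L2_def)
    moreover have "complex_of_real (\<integral>z. (cmod (wavelet \<pi> \<phi> \<psi> z))\<^sup>2 \<partial>\<mu>r) = 0"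
      using Dinv_props(3)[OF \<phi>(1) \<phi>(1), of \<psi> \<psi>] \<phi>(2)
      unfolding complex_norm_square[symmetric] integral_complex_of_real by simp
    ultimately have "AE z in \<mu>r. (cmod (wavelet \<pi> \<phi> \<psi> z))\<^sup>2 = 0"
      by (subst (asm) of_real_eq_0_iff, subst integral_nonneg_eq_0_iff_AE[symmetric]) auto
    then show ?thesis by simp
  qed
  moreover obtain D :: "'h set" where D: "countable D" "\<And>X. open X \<Longrightarrow> X \<noteq> {} \<Longrightarrow> \<exists>d\<in>D. d \<in> X"
    using countable_dense_exists by blast
  ultimately have "AE z in \<mu>r. \<forall>\<psi>\<in>D. wavelet \<pi> \<phi> \<psi> z = 0" by (simp add: AE_ball_countable)
  then have AE: "AE z in \<mu>r. z \<in> carrier G \<and> (\<forall>\<psi>\<in>D. wavelet \<pi> \<phi> \<psi> z = 0)"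
    using AE_space[of \<mu>r] by eventually_elim simp
  have "\<exists>z. z \<in> carrier G \<and> (\<forall>\<psi>\<in>D. wavelet \<pi> \<phi> \<psi> z = 0)"
  proof (rule ccontr)
    assume no: "\<not> ?thesis"
    from AE have "AE z in \<mu>r. False" by (rule eventually_mono) (use no in blast)
    then show False using mu_nonzero by contradiction
  qed
  then obtain z where z: "z \<in> carrier G" "\<And>\<psi>. \<psi> \<in> D \<Longrightarrow> wavelet \<pi> \<phi> \<psi> z = 0"
    by blast
  define v where "v = \<pi> (inv z) \<phi>"
  have Dv: "cinner d v = 0" if "d \<in> D" for d using z(2)[OF that] z(1) by (simp add: wavelet_apply v_def)
  have "open {u. cinner u v \<noteq> 0}"
    by (intro open_Collect_neq bounded_bilinear.continuous_on[OF bounded_bilinear_cinner]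
        continuous_intros)
  then have "{u. cinner u v \<noteq> 0} = {}" using D(2) Dv by blast
  then have "cinner v v = 0" by blast
  then have "v = 0" by (simp add: cinner_self)
  then show ?thesis using rep_rules(2)[of "inv z" \<phi>] z(1) by (simp add: v_def)
qed

lemma Dinv_inj: "inj_on Dinv S"
proof (rule inj_onI)
  fix u v assume uv: "u \<in> S" "v \<in> S" "Dinv u = Dinv v"
  have sub: "csubspace S" and lin: "clinear_on S Dinv" using Dinv_props(1) by (auto simp: positive_selfadjoint_def)
  have m: "(-1) *\<^sub>C v \<in> S" "Dinv ((-1) *\<^sub>C v) = (-1) *\<^sub>C Dinv v"
    using sub lin uv by (auto simp: csubspace_def clinear_on_def)
  have neg: "(-1) *\<^sub>C w = - w" for w :: 'h using scaleC_of_real[of "-1" w] by simp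
  have "u + (-1) *\<^sub>C v \<in> S" using sub uv(1) m(1) unfolding csubspace_def by blast
  then have "u - v \<in> S" by (simp add: neg)
  moreover have "Dinv (u + (-1) *\<^sub>C v) = Dinv u + Dinv ((-1) *\<^sub>C v)"
    using lin uv(1) m(1) by (simp add: clinear_on_def)
  then have "Dinv (u - v) = 0" using m(2) uv(3) by (simp add: neg)
  ultimately show "u = v" using Dinv_kernel by force
qed

section \<open>The Fourier-Wigner transform\<close>

abbreviation conj_fun :: "'g \<Rightarrow> ('g \<Rightarrow> complex) \<Rightarrow> 'g \<Rightarrow> complex" where
  "conj_fun x g \<equiv> (\<lambda>z. of_real (1 / sqrt (\<Delta> x)) * g (x \<otimes> z \<otimes> inv x))"

text \<open>For \<phi> = \<open>Dinv s\<close> the preimage of \<pi>(x) \<phi> under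
  \<open>Dinv\<close> is r \<pi>(x) s with r the square root of \<Delta>(x). In the integrand the
  three unitary operators combine to \<pi>(z^-1) after the substitution.\<close>

lemma fourier_wigner_integral_conj:
  assumes x: "x \<in> carrier G" and B: "fourier_wigner_integral G \<mu>r \<pi> S Dinv g B"
  shows "fourier_wigner_integral G \<mu>r \<pi> S Dinv (conj_fun x g) (rep_conj G \<pi> x B)"
  unfolding fourier_wigner_integral_def
proof (intro conjI ballI)
  show "hilbert_schmidt (rep_conj G \<pi> x B)"
    using B by (intro hilbert_schmidt_rep_conj[OF group_axioms rep x]) (simp add: fourier_wigner_integral_def)
  fix \<phi> assume "\<phi> \<in> Dinv ` S"
  then obtain s where s: "s \<in> S" "\<phi> = Dinv s" by blast
  define r where "r = sqrt (\<Delta> x)"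
  have r: "0 < r" "r * r = \<Delta> x" using modular_pos[OF x] by (simp_all add: r_def)
  have sub: "csubspace S" and lin: "clinear_on S Dinv" using Dinv_props(1) by (auto simp: positive_selfadjoint_def)
  have xs: "\<pi> x s \<in> S" using admissible_rep[OF x s(1)] .
  then have rxs: "r *\<^sub>R \<pi> x s \<in> S" and "Dinv (r *\<^sub>R \<pi> x s) = r *\<^sub>R Dinv (\<pi> x s)"
    using sub lin by (auto simp: csubspace_def clinear_on_def simp flip: scaleC_of_real)
  then have D: "Dinv (r *\<^sub>R \<pi> x s) = \<pi> x \<phi>" using Dinv_rep[OF x s(1)] r s(2) by (simp add: r_def)
  have iv: "inv_into S Dinv \<phi> = s" "inv_into S Dinv (\<pi> x \<phi>) = r *\<^sub>R \<pi> x s"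
    using inv_into_f_f[OF Dinv_inj s(1)] inv_into_f_f[OF Dinv_inj rxs] by (simp_all add: s(2) D[unfolded s(2)])
  define H where "H = (\<lambda>z. g z *\<^sub>C \<pi> (inv x) (\<pi> (inv z) (\<pi> x s)))"
  have im: "\<pi> x \<phi> \<in> Dinv ` S" using D rxs by (metis imageI)
  have "B (\<pi> x \<phi>) = (\<integral>z. g z *\<^sub>C \<pi> (inv z) (r *\<^sub>R \<pi> x s) \<partial>\<mu>r)"
    using B im unfolding fourier_wigner_integral_def iv(2)[symmetric] by blast
  then have "rep_conj G \<pi> x B \<phi> = \<pi> (inv x) (\<integral>z. g z *\<^sub>C \<pi> (inv z) (r *\<^sub>R \<pi> x s) \<partial>\<mu>r)"
    by (simp add: rep_conj_def[OF group_axioms rep])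
  \<comment> \<open>\<open>\<pi> (inv x)\<close> has the bounded inverse \<open>\<pi> x\<close>, so
    it passes through the integral even when the integrand is not integrable.\<close>
  also have "\<dots> = (\<integral>z. \<pi> (inv x) (g z *\<^sub>C \<pi> (inv z) (r *\<^sub>R \<pi> x s)) \<partial>\<mu>r)"
    by (rule integral_bounded_linear'[symmetric, OF rep_bounded_linear[OF group_axioms rep, of "inv x"]
          rep_bounded_linear[OF group_axioms rep x]]) (use x in \<open>simp_all add: rep_rules\<close>)
  also have "\<dots> = (\<integral>z. r *\<^sub>R H z \<partial>\<mu>r)"
    using x by (intro Bochner_Integration.integral_cong) (simp_all add: H_def rep_rules scaleC_scaleR_commute)
  \<comment> \<open>The factor r = \<Delta>(x) / r is split so that \<Delta>(x) is absorbed by the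
    substitution and 1 / r remains for \<open>conj_fun\<close>.\<close>
  also have "\<dots> = (1 / r) *\<^sub>R (\<Delta> x *\<^sub>R (\<integral>z. H z \<partial>\<mu>r))"
    using r by (simp add: field_simps flip: r(2))
  also have "\<Delta> x *\<^sub>R (\<integral>z. H z \<partial>\<mu>r) = (\<integral>z. H (x \<otimes> z \<otimes> inv x) \<partial>\<mu>r)"
    by (rule scaling_map_integral[OF conj_scaling[OF x], symmetric])
  also have "(1 / r) *\<^sub>R \<dots> = (\<integral>z. (1 / r) *\<^sub>R H (x \<otimes> z \<otimes> inv x) \<partial>\<mu>r)" by simp
  also have "\<dots> = (\<integral>z. conj_fun x g z *\<^sub>C \<pi> (inv z) s \<partial>\<mu>r)"
  proof (rule Bochner_Integration.integral_cong)
    fix z assume "z \<in> space \<mu>r"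
    then have z: "z \<in> carrier G" by simp
    have "inv x \<otimes> (inv (x \<otimes> z \<otimes> inv x) \<otimes> x) = inv z"
      using x z by (simp add: inv_mult_group m_assoc) (simp add: m_assoc[symmetric])
    then have eq: "\<pi> (inv x) (\<pi> (inv (x \<otimes> z \<otimes> inv x)) (\<pi> x s)) = \<pi> (inv z) s"
      using x z by (simp add: rep_rules(3)[symmetric])
    then show "(1 / r) *\<^sub>R H (x \<otimes> z \<otimes> inv x) = conj_fun x g z *\<^sub>C \<pi> (inv z) s"
      by (simp only: H_def r_def eq scaleC_scaleC[symmetric] scaleC_of_real)
  qed simp
  finally show "rep_conj G \<pi> x B \<phi> = (\<integral>z. conj_fun x g z *\<^sub>C \<pi> (inv z) (inv_into S Dinv \<phi>) \<partial>\<mu>r)"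
    by (simp add: iv)
qed

lemma fourier_wigner_limit_conj:
  assumes x: "x \<in> carrier G" and A: "fourier_wigner_limit G \<mu>r \<pi> S Dinv g A"
  shows "fourier_wigner_limit G \<mu>r \<pi> S Dinv (conj_fun x g) (rep_conj G \<pi> x A)"
proof -
  from A obtain fs B where fs: "\<And>k. integrable \<mu>r (fs k)"
      "\<And>k. fourier_wigner_integral G \<mu>r \<pi> S Dinv (fs k) (B k)" "L2_tendsto \<mu>r fs g" "HS_tendsto B A"
    unfolding fourier_wigner_limit_def by blast
  have "integrable \<mu>r (conj_fun x (fs k))" for k
    using scaling_map_integrable[OF conj_scaling[OF x] fs(1)] by simp
  moreover have "L2_tendsto \<mu>r (\<lambda>k. conj_fun x (fs k)) (conj_fun x g)"
    by (rule L2_tendsto_scaling[OF conj_scaling[OF x] fs(3)])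
  ultimately show ?thesis
    unfolding fourier_wigner_limit_def
    using fourier_wigner_integral_conj[OF x fs(2)] HS_tendsto_rep_conj[OF group_axioms rep x fs(4)]
    by (intro exI[of _ "\<lambda>k. conj_fun x (fs k)"] exI[of _ "\<lambda>k. rep_conj G \<pi> x (B k)"]) blast
qed

lemma fourier_wigner_limit_cong_AE:
  assumes "fourier_wigner_limit G \<mu>r \<pi> S Dinv g A" "g' \<in> borel_measurable \<mu>r" "AE z in \<mu>r. g' z = g z"
  shows "fourier_wigner_limit G \<mu>r \<pi> S Dinv g' A"
  using assms L2_tendsto_cong_AE unfolding fourier_wigner_limit_def by blast

text \<open>Conjugation by \<open>x\<close> and by \<open>inv x\<close> gives mutually inverse maps
  between the possible limit operators of g and of \<open>g'\<close>. Unique existence is therefore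
  equivalent for the two, and if it fails both transforms are the zero operator, which conjugation
  fixes.\<close>

lemma fourier_wigner_inv_conj:
  assumes x: "x \<in> carrier G" and m: "g \<in> borel_measurable \<mu>r" "g' \<in> borel_measurable \<mu>r"
    and eq: "AE z in \<mu>r. g' z = conj_fun x g z"
  shows "fourier_wigner_inv G \<mu>r \<pi> S Dinv g' = rep_conj G \<pi> x (fourier_wigner_inv G \<mu>r \<pi> S Dinv g)"
proof -
  let ?P = "fourier_wigner_limit G \<mu>r \<pi> S Dinv g" and ?Q = "fourier_wigner_limit G \<mu>r \<pi> S Dinv g'"
  have i: "inv x \<in> carrier G" using x by simp
  note cinv = rep_conj_inv[OF group_axioms rep x]
  have PQ: "?Q (rep_conj G \<pi> x A)" if "?P A" for A
    by (rule fourier_wigner_limit_cong_AE[OF fourier_wigner_limit_conj[OF x that] m(2) eq])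
  have "AE z in \<mu>r. g z = conj_fun (inv x) g' z"
    using scaling_map_AE[OF conj_scaling[OF i] eq] AE_space[of \<mu>r]
  proof eventually_elim
    case (elim z)
    then have "x \<otimes> (inv x \<otimes> z \<otimes> inv (inv x)) \<otimes> inv x = z"
      using x by (simp add: m_assoc) (simp add: m_assoc[symmetric])
    then show ?case
      using elim modular_pos[OF x] x by (simp add: modular_inv real_sqrt_divide flip: of_real_mult mult.assoc)
  qed
  then have QP: "?P (rep_conj G \<pi> (inv x) A)" if "?Q A" for A
    using fourier_wigner_limit_cong_AE[OF fourier_wigner_limit_conj[OF i that] m(1)] by blast
  show ?thesis
  proof (cases "\<exists>!A. ?P A")
    case True
    then obtain A where A: "?P A" "\<And>A'. ?P A' \<Longrightarrow> A' = A" by blast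
    have Q: "?Q A' \<longleftrightarrow> A' = rep_conj G \<pi> x A" for A'
      using PQ[OF A(1)] A(2)[OF QP[of A']] cinv(2)[of A'] by auto
    then have "\<exists>!A. ?Q A" by auto
    moreover have "(THE A. ?P A) = A" by (rule the_equality) (use A in blast)+
    moreover have "(THE A. ?Q A) = rep_conj G \<pi> x A" by (rule the_equality) (simp_all only: Q)
    ultimately show ?thesis using True by (simp add: fourier_wigner_inv_def)
  next
    case False
    have "\<not> (\<exists>!A. ?Q A)"
    proof
      assume "\<exists>!A. ?Q A"
      then obtain A where A: "?Q A" "\<And>A'. ?Q A' \<Longrightarrow> A' = A" by blast
      have "?P A' \<longleftrightarrow> A' = rep_conj G \<pi> (inv x) A" for A'
        using QP[OF A(1)] A(2)[OF PQ[of A']] cinv(1)[of A'] by auto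
      then show False using False by auto
    qed
    then show ?thesis using False
      by (simp add: fourier_wigner_inv_def rep_conj_zero[OF group_axioms rep x] if_not_P)
  qed
qed

section \<open>The Fourier-Kirillov transform\<close>

lemma kappa_apply: "y \<in> carrier G \<Longrightarrow> blinfun_apply (kappa G Exp F y) X = blinfun_apply F (Ad y X)"
  by (simp add: kappa_def coadjoint_def bounded_linear_Blinfun_apply bounded_linear_Ad)

abbreviation Ad_fun :: "'g \<Rightarrow> (real^'n \<Rightarrow> complex) \<Rightarrow> real^'n \<Rightarrow> complex" where
  "Ad_fun x h \<equiv> (\<lambda>X. of_real (1 / sqrt (\<Delta> x)) * h (Ad x X))"

text \<open>Here \<Delta>(y) = \<Delta>(x) \<Delta>(y x^-1) splits the weight in the denominator;
  this is where the factor in \<open>Ad_fun\<close> comes from.\<close>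

lemma fourier_kirillov_integrand:
  assumes x: "x \<in> carrier G" and y: "y \<in> carrier G"
  shows "complex_of_real (sqrt (P * \<Delta> y)) =
    of_real (sqrt (\<Delta> x)) * of_real (sqrt (P * \<Delta> (y \<otimes> inv x)))"
  using x y modular_pos[OF x]
  by (simp add: modular_mult modular_inv real_sqrt_mult[symmetric] flip: of_real_mult)

text \<open>The phase matches because \<kappa>(y) at X equals \<kappa>(y x^-1) at Ad_x X, and right
  translation preserves the measure. The equality holds at every X and also when the integral takes
  its default value.\<close>

lemma fourier_kirillov_integral_translate:
  assumes x: "x \<in> carrier G"
  shows "fourier_kirillov_integral G Exp n b F \<mu>r \<Delta> (\<lambda>y. f (y \<otimes> inv x)) =
    Ad_fun x (fourier_kirillov_integral G Exp n b F \<mu>r \<Delta> f)"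
proof
  fix X
  define P where "P = \<bar>Pf_form G Exp n b F\<bar>"
  define g where "g = (\<lambda>y. f y * cis (- 2 * pi * blinfun_apply (kappa G Exp F y) (Ad x X)) /
      complex_of_real (sqrt (P * \<Delta> y)))"
  have i: "inv x \<in> carrier G" using x by simp
  have "f (y \<otimes> inv x) * cis (- 2 * pi * blinfun_apply (kappa G Exp F y) X) /
      complex_of_real (sqrt (P * \<Delta> y)) = of_real (1 / sqrt (\<Delta> x)) * g (y \<otimes> inv x)"
    if "y \<in> space \<mu>r" for y
  proof -
    have y: "y \<in> carrier G" using that by simp
    then show ?thesis
      using x by (simp add: g_def fourier_kirillov_integrand[OF x y] kappa_apply Ad_mult Ad_inv)
  qed
  then have "fourier_kirillov_integral G Exp n b F \<mu>r \<Delta> (\<lambda>y. f (y \<otimes> inv x)) X =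
      (\<integral>y. of_real (1 / sqrt (\<Delta> x)) * g (y \<otimes> inv x) \<partial>\<mu>r)"
    unfolding fourier_kirillov_integral_def P_def[symmetric]
    by (intro Bochner_Integration.integral_cong) auto
  also have "\<dots> = of_real (1 / sqrt (\<Delta> x)) * (\<integral>y. g (y \<otimes> inv x) \<partial>\<mu>r)" by simp
  also have "(\<integral>y. g (y \<otimes> inv x) \<partial>\<mu>r) = (\<integral>y. g y \<partial>\<mu>r)"
    using scaling_map_integral[OF right_scaling[OF i], of g] by simp
  finally show "fourier_kirillov_integral G Exp n b F \<mu>r \<Delta> (\<lambda>y. f (y \<otimes> inv x)) X =
      Ad_fun x (fourier_kirillov_integral G Exp n b F \<mu>r \<Delta> f) X"
    by (simp add: fourier_kirillov_integral_def g_def P_def)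
qed

lemma fourier_kirillov_limit_translate:
  assumes x: "x \<in> carrier G" and b: "basis_family (2 * n) b"
    and h: "fourier_kirillov_limit G Exp n b F \<mu>r \<Delta> f h"
  shows "fourier_kirillov_limit G Exp n b F \<mu>r \<Delta> (\<lambda>y. f (y \<otimes> inv x)) (Ad_fun x h)"
proof -
  define P where "P = \<bar>Pf_form G Exp n b F\<bar>"
  have i: "inv x \<in> carrier G" using x by simp
  from h obtain fs where fs: "\<And>k. integrable \<mu>r (\<lambda>y. fs k y / complex_of_real (sqrt (P * \<Delta> y)))"
      "L2_tendsto \<mu>r fs f" "L2_tendsto (basis_lebesgue (2 * n) b)
          (\<lambda>k. fourier_kirillov_integral G Exp n b F \<mu>r \<Delta> (fs k)) h"
    unfolding fourier_kirillov_limit_def P_def by blast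
  obtain c where c: "scaling_map (basis_lebesgue (2 * n) b) (Ad x) (Ad (inv x)) c"
    using basis_lebesgue_linear_scaling[OF b linear_Ad[OF x] linear_Ad[OF i] Ad_inv[OF x]] .
  have "integrable \<mu>r (\<lambda>y. fs k (y \<otimes> inv x) / complex_of_real (sqrt (P * \<Delta> y)))" for k
  proof -
    have "integrable \<mu>r (\<lambda>y. of_real (1 / sqrt (\<Delta> x)) *
        (fs k (y \<otimes> inv x) / complex_of_real (sqrt (P * \<Delta> (y \<otimes> inv x)))))"
      by (rule integrable_mult_right) (rule scaling_map_integrable[OF right_scaling[OF i] fs(1)])
    then show ?thesis
      by (rule Bochner_Integration.integrable_cong[THEN iffD1, rotated 2])
        (simp_all add: fourier_kirillov_integrand[OF x])
  qed
  moreover have "L2_tendsto \<mu>r (\<lambda>k y. fs k (y \<otimes> inv x)) (\<lambda>y. f (y \<otimes> inv x))"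
    using L2_tendsto_scaling[OF right_scaling[OF i] fs(2), of 1] by simp
  moreover have "L2_tendsto (basis_lebesgue (2 * n) b)
      (\<lambda>k. fourier_kirillov_integral G Exp n b F \<mu>r \<Delta> (\<lambda>y. fs k (y \<otimes> inv x))) (Ad_fun x h)"
    unfolding fourier_kirillov_integral_translate[OF x] by (rule L2_tendsto_scaling[OF c fs(3)])
  ultimately show ?thesis
    unfolding fourier_kirillov_limit_def P_def
    by (intro exI[of _ "\<lambda>k y. fs k (y \<otimes> inv x)"]) blast
qed

text \<open>The identity is first obtained almost everywhere on the Lie algebra, by transporting the
  limit relation in both directions, and then carried to the group by the exponential map, where
  \<open>Ad x\<close> becomes conjugation.\<close>

lemma fourier_kirillov_inv_translate:
  assumes x: "x \<in> carrier G" and b: "basis_family (2 * n) b" and f: "f \<in> borel_measurable \<mu>r"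
    and \<mu>r: "\<mu>r = distr (density (basis_lebesgue (2 * n) b) (\<lambda>X. ennreal (lie_Theta G Exp X))) BG Exp"
  shows "AE z in \<mu>r. fourier_kirillov_inv \<sigma> G Exp n b F \<mu>r \<Delta> (\<lambda>y. f (y \<otimes> inv x)) z =
    conj_fun x (fourier_kirillov_inv \<sigma> G Exp n b F \<mu>r \<Delta> f) z"
proof -
  let ?L = "basis_lebesgue (2 * n) b" and ?lim = "fourier_kirillov_limit G Exp n b F \<mu>r \<Delta>"
  have i: "inv x \<in> carrier G" using x by simp
  obtain c where c: "scaling_map ?L (Ad x) (Ad (inv x)) c"
    using basis_lebesgue_linear_scaling[OF b linear_Ad[OF x] linear_Ad[OF i] Ad_inv[OF x]] .
  have sq: "1 / sqrt (\<Delta> x) * (1 / sqrt (\<Delta> (inv x))) = 1"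
    using modular_pos[OF x] x by (simp add: modular_inv real_sqrt_divide)
  then have sq': "of_real (1 / sqrt (\<Delta> x)) * (of_real (1 / sqrt (\<Delta> (inv x))) * w) = w"
      "of_real (1 / sqrt (\<Delta> (inv x))) * (of_real (1 / sqrt (\<Delta> x)) * w) = w" for w :: complex
    by (metis mult.assoc mult.left_neutral of_real_1 of_real_mult mult.commute)+
  have "AE X in ?L. the_AE ?L (?lim (\<lambda>y. f (y \<otimes> inv x))) X = Ad_fun x (the_AE ?L (?lim f)) X"
  proof (rule the_AE_transport)
    fix h
    show "?lim (\<lambda>y. f (y \<otimes> inv x)) (Ad_fun x h)" if "?lim f h"
      using fourier_kirillov_limit_translate[OF x b that] .
    show "?lim f (Ad_fun (inv x) h)" if "?lim (\<lambda>y. f (y \<otimes> inv x)) h"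
    proof -
      \<comment> \<open>Translating back gives f only at points of the carrier. Outside it a HOL
        function is arbitrary, so the return to f is made almost everywhere.\<close>
      have "?lim (\<lambda>y. f (y \<otimes> inv (inv x) \<otimes> inv x)) (Ad_fun (inv x) h)"
        using fourier_kirillov_limit_translate[OF i b that] .
      moreover have "AE y in \<mu>r. f y = f (y \<otimes> inv (inv x) \<otimes> inv x)"
        using AE_space[of \<mu>r] by eventually_elim (use x in \<open>simp add: m_assoc\<close>)
      ultimately show ?thesis
        unfolding fourier_kirillov_limit_def using L2_tendsto_cong_AE[OF _ f] by blast
    qed
    show "Ad_fun x (Ad_fun (inv x) h) = h" "Ad_fun (inv x) (Ad_fun x h) = h"
      unfolding sq' using x by (simp_all add: Ad_inv)
    fix h' assume *: "AE X in ?L. h X = h' X"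
    show "AE X in ?L. Ad_fun x h X = Ad_fun x h' X"
      using scaling_map_AE[OF c *] by eventually_elim simp
    show "AE X in ?L. Ad_fun (inv x) h X = Ad_fun (inv x) h' X"
      using scaling_map_AE[OF scaling_map_inverse[OF c] *] by eventually_elim simp
  qed simp
  then have "AE X in density ?L (\<lambda>X. ennreal (lie_Theta G Exp X)).
      the_AE ?L (?lim (\<lambda>y. f (y \<otimes> inv x))) X = Ad_fun x (the_AE ?L (?lim f)) X"
    (is "AE X in ?D. ?E X") by (rule AE_density_of_AE)
  then obtain N where N: "{X \<in> space ?D. \<not> ?E X} \<subseteq> N" "emeasure ?D N = 0" "N \<in> sets ?D" by (rule AE_E)
  have sD: "sets ?D = sets borel" "space ?D = UNIV" by (simp_all add: basis_lebesgue_def)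
  have Exp_m: "Exp \<in> measurable ?D BG" using Exp_measurable by (simp add: measurable_cong_sets[OF sD(1) refl])
  have N': "lie_log Exp -` N \<inter> carrier G \<in> sets BG"
    using measurable_sets[OF log_measurable, of N] N(3) sD by simp
  have "Exp -` (lie_log Exp -` N \<inter> carrier G) \<inter> space ?D = N" using sD by auto
  then have "emeasure \<mu>r (lie_log Exp -` N \<inter> carrier G) = 0"
    using N(2) N' Exp_m by (subst \<mu>r) (simp add: emeasure_distr)
  moreover have "sets \<mu>r = sets BG" by (subst \<mu>r) simp
  ultimately have "AE z in \<mu>r. ?E (lie_log Exp z)"
    using N(1) N' sD by (intro AE_I'[of "lie_log Exp -` N \<inter> carrier G"]) (auto simp: null_sets_def)
  then show ?thesis using AE_space[of \<mu>r]
    by eventually_elim (use x in \<open>simp add: fourier_kirillov_inv_def log_conj Theta_Ad\<close>)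
qed

lemma fourier_kirillov_inv_measurable:
  assumes "\<sigma> \<in> borel_measurable borel"
  shows "fourier_kirillov_inv \<sigma> G Exp n b F \<mu>r \<Delta> f \<in> borel_measurable \<mu>r"
proof -
  let ?L = "basis_lebesgue (2 * n) b"
  have "the_AE ?L (fourier_kirillov_limit G Exp n b F \<mu>r \<Delta> f) \<in> borel_measurable ?L"
    by (rule the_AE_measurable) (auto simp: fourier_kirillov_limit_def L2_tendsto_def L2_def)
  then have h: "the_AE ?L (fourier_kirillov_limit G Exp n b F \<mu>r \<Delta> f) \<in> borel_measurable borel"
    by (simp add: basis_lebesgue_def)
  have log: "lie_log Exp \<in> measurable \<mu>r borel"
    using log_measurable haar(2) by (simp add: right_haar_def radon_cong(2))
  have "(\<lambda>z. \<sigma> (lie_Theta G Exp (lie_log Exp z))) \<in> borel_measurable \<mu>r"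
    by (rule measurable_compose[OF measurable_compose[OF log borel_measurable_Theta] assms])
  with measurable_compose[OF log h] show ?thesis
    unfolding fourier_kirillov_inv_def[abs_def] by measurable
qed

end

theorem proposition4p4:
  fixes G :: "('g, 'e) monoid_scheme" (structure)
    and Exp :: "real^'n \<Rightarrow> 'g"
    and F :: "(real^'n) \<Rightarrow>\<^sub>L real"
    and n :: nat and b :: "nat \<Rightarrow> real^'n"
    and \<mu>l \<mu>r :: "'g measure" and \<Delta> :: "'g \<Rightarrow> real"
    and \<hh> :: "(real^'n) set"
    and \<pi> :: "'g \<Rightarrow> 'h \<Rightarrow> 'h::{complex_hilbert, second_countable_topology}"
    and DomDinv :: "'h set" and Dinv :: "'h \<Rightarrow> 'h"
    and \<sigma> :: "real \<Rightarrow> real"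
    and f :: "'g \<Rightarrow> complex" and x :: 'g
  assumes lie_group: "exponential_lie_group G Exp"
    and trivial_stabilizer: "{g \<in> carrier G. coadjoint G Exp g F = F} = {\<one>}"
    and basis: "CARD('n) = 2 * n" "basis_family (2 * n) b"
    and haar: "left_haar G Exp (carrier G) \<mu>l" "right_haar G Exp (carrier G) \<mu>r"
    and modular: "modular_function G (carrier G) \<mu>l \<Delta>" "\<mu>l = density \<mu>r (\<lambda>y. ennreal (\<Delta> y))"
    and haar_normalized: "\<mu>r = distr (density (basis_lebesgue (2 * n) b)
            (\<lambda>X. ennreal (lie_Theta G Exp X))) (group_borel G Exp) Exp"
    and basis_compatible: "distr \<mu>r borel (kappa G Exp F) = density (dual_lebesgue (2 * n) b)
            (\<lambda>Y. ennreal (\<bar>Pf_form G Exp n b F\<bar> * \<Delta> (the_inv_into (carrier G) (kappa G Exp F) Y))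
                 * indicator (coadjoint_orbit G Exp F) Y)"
    and polarization: "pukanszky_polarization G Exp F \<hh>"
    and rep: "unitary_rep G Exp \<pi>" "irreducible_rep G \<pi>" "square_integrable_rep \<mu>r \<pi>"
    and induced: "is_induced_rep G Exp (Exp ` \<hh>) (orbit_character Exp F) \<mu>l \<Delta> \<pi>"
    and duflo_moore: "duflo_moore \<mu>r \<pi> DomDinv Dinv"
    and prefactor: "\<sigma> = sqrt \<or> \<sigma> = (\<lambda>t. 1 / sqrt t)"
    and f: "f \<in> L2 \<mu>r"
    and x: "x \<in> carrier G"
  shows "cadj (\<pi> x) \<circ> quantization \<sigma> G Exp n b F \<mu>r \<Delta> \<pi> DomDinv Dinv f \<circ> \<pi> x =
         quantization \<sigma> G Exp n b F \<mu>r \<Delta> \<pi> DomDinv Dinv (\<lambda>y. f (y \<otimes> inv x))"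
proof -
  interpret exponential_lie_group G Exp by (rule lie_group)
  interpret duflo_moore_setting G Exp \<mu>l \<mu>r \<Delta> \<pi> DomDinv Dinv
    using haar modular rep duflo_moore by unfold_locales (auto simp: irreducible_rep_def)
  have \<sigma>: "\<sigma> \<in> borel_measurable borel" using prefactor by auto
  have "f \<in> borel_measurable \<mu>r" using f by (simp add: L2_def)
  from fourier_kirillov_inv_translate[OF x basis(2) this haar_normalized]
  have "quantization \<sigma> G Exp n b F \<mu>r \<Delta> \<pi> DomDinv Dinv (\<lambda>y. f (y \<otimes> inv x)) =
      rep_conj G \<pi> x (quantization \<sigma> G Exp n b F \<mu>r \<Delta> \<pi> DomDinv Dinv f)"
    unfolding quantization_def
    by (intro fourier_wigner_inv_conj[OF x] fourier_kirillov_inv_measurable \<sigma>)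
  then show ?thesis
    by (simp add: rep_conj_def[OF group_axioms rep(1)] rep_cadj[OF group_axioms rep(1) x])
qed

end
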